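(* Let $2\le p<\infty$ and $\alpha'>2/p$, and let $\mu$ be a $\Lambda(p)$ Cantor measure with $N$ sufficiently large depending on $p$ and $\alpha'$. For $f\in\mathcal{S}(\mathbb{R})$ let $\mathcal{A}_tf(x)=\int f(x-ty)\,d\mu(y)$. Then: (i) For every $r$ with $p<r<\infty$ we have $$\Big\|\,\|\mathcal{A}_tf(x)\|_{L^r([1,2],dt)}\Big\|_{L^p(dx)}\lesssim_N\|f\|_p\qquad\text{for all }f\in\mathcal{S}(\mathbb{R}),$$ provided that $N$ is sufficiently large depending on $r$. (ii) For $\gamma<\alpha/2$ we have $$\Big\|\big[(1+|\xi|^2)^{\gamma/2}\widehat f(\xi)\,\widehat\mu(t\xi)\big]^\vee\Big\|_{L^p(\mathbb{R}_x\times[1,2]_t)}\lesssim_N\|f\|_p\qquad\text{for all }f\in\mathcal{S}(\mathbb{R}),$$ provided that $N$ is sufficiently large depending on $\gamma$, where ${}^\vee$ denotes the inverse Fourier transform in the $x$ variable only (i.e. $\xi\to x$, for each fixed $t$).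
   Context: Fourier transforms: $\widehat f(\xi)=\int e^{-2\pi i x\xi}f(x)\,dx$, $\widehat\mu(\xi)=\int e^{-2\pi i x\xi}\,d\mu(x)$. $\mathcal{S}(\mathbb{R})$ is the Schwartz space. $X\lesssim_N Y$ means $X\le CY$ with $C$ possibly depending on $N$ (and on the fixed parameters such as $p,r,\gamma$) but not on $f$. **$\Lambda(p)$ Cantor sets and measures.** For the given $p$, constants $c_0,c_1,C(p)>0$ independent of $N$ are fixed throughout, such that for every sufficiently large $N$ there are sets $S$ with the properties (a), (b) below (their existence is a theorem of Bourgain). Write $[N]=\{0,1,\dots,N-1\}$. Let $N$ be a large positive integer, $0<N_0<N$ an integer, and let $\Sigma$ be a non-empty collection of subsets $S\subset[N-1]=\{0,\dots,N-2\}$ with $|S|=N_0$ for all $S\in\Sigma$, each satisfying (a) $\big\|\sum_{a\in S}c_ae^{2\pi i ax}\big\|_{L^p([0,1])}\le C(p)\big(\sum_{a\in S}|c_a|^2\big)^{1/2}$ for all coefficients $\{c_a\}_{a\in S}$; (b) $c_0N^{2/p}\le|S|\le c_1N^{2/p}$. Choose $S_1\in\Sigma$ and let $A_1=1+N^{-1}S_1$, $E_1=A_1+[0,N^{-1}]$. Inductively, for $k\ge1$ and every $a\in A_k$ choose $S_{k+1,a}\in\Sigma$ and let $A_{k+1,a}=a+N^{-k-1}S_{k+1,a}$, $A_{k+1}=\bigcup_{a\in A_k}A_{k+1,a}$, $E_{k+1}=A_{k+1}+[0,N^{-k-1}]$. Then $E_\infty=\bigcap_{j\ge1}E_j\subset[1,2]$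 is called a $\Lambda(p)$ Cantor set, and the weak limit $\mu$ of the probability measures $\frac1{|E_j|}\mathbf{1}_{E_j}\,dx$ is called a $\Lambda(p)$ Cantor measure (with parameter $N$). One puts $\alpha=\log N_0/\log N$, so $N_0=N^\alpha$; $\alpha$ is the Hausdorff dimension of $E_\infty$. "$N$ sufficiently large depending on given quantities" means $N\ge N_*$, where $N_*$ depends only on these quantities, on $p$, and on the fixed constants $c_0,c_1,C(p)$.
   Formalization: In (ii) the single value γ = 1/p is excluded: there γ < α/2 can hold for all large N only with margin O(1/log N), and the bound can fail for every large N (e.g. p = 4, γ = 1/4, S a union of Sidon sets in a short interval). *)

theory Defs
  imports "HOL-Probability.Probability"
begin

section \<open>Extended-real-valued Lebesgue norms\<close>

(* Only used with s > 0. *)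
definition enn_powr :: "ennreal \<Rightarrow> real \<Rightarrow> ennreal" where
  "enn_powr x s = (if x = \<top> then \<top> else ennreal (enn2real x powr s))"

(* Nonnegative extended functions are admitted so that norms can be iterated.  The values are
   the usual ones for measurable arguments; nn_integral of a non-measurable function
   would be a lower integral. *)
definition eLp_norm :: "'a measure \<Rightarrow> real \<Rightarrow> ('a \<Rightarrow> ennreal) \<Rightarrow> ennreal" where
  "eLp_norm M p g = enn_powr (\<integral>\<^sup>+ x. enn_powr (g x) p \<partial>M) (1 / p)"

definition Lp_norm :: "'a measure \<Rightarrow> real \<Rightarrow> ('a \<Rightarrow> complex) \<Rightarrow> ennreal" where
  "Lp_norm M p f = eLp_norm M p (\<lambda>x. ennreal (norm (f x)))"

section \<open>Schwartz functions and Fourier transforms\<close>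

(* D n is the n-th derivative of f. *)
definition schwartz :: "(real \<Rightarrow> complex) \<Rightarrow> bool" where
  "schwartz f \<longleftrightarrow> (\<exists>D :: nat \<Rightarrow> real \<Rightarrow> complex. D 0 = f
      \<and> (\<forall>n x. (D n has_vector_derivative D (Suc n) x) (at x))
      \<and> (\<forall>m n. bounded (range (\<lambda>x. x ^ m *\<^sub>R D n x))))"

definition fourier :: "(real \<Rightarrow> complex) \<Rightarrow> real \<Rightarrow> complex" where
  "fourier f \<xi> = (LINT x|lborel. iexp (- (2 * pi * x * \<xi>)) * f x)"

definition inv_fourier :: "(real \<Rightarrow> complex) \<Rightarrow> real \<Rightarrow> complex" where
  "inv_fourier g x = (LINT \<xi>|lborel. iexp (2 * pi * x * \<xi>) * g \<xi>)"

(* The characteristic function char \<mu> s integrates exp(i s x), hence the rescaling. *)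
definition fourier_measure :: "real measure \<Rightarrow> real \<Rightarrow> complex" where
  "fourier_measure \<mu> \<xi> = char \<mu> (- (2 * pi * \<xi>))"

definition average :: "real measure \<Rightarrow> (real \<Rightarrow> complex) \<Rightarrow> real \<Rightarrow> real \<Rightarrow> complex" where
  "average \<mu> f t x = (LINT y|\<mu>. f (x - t * y))"

section \<open>Lambda(p) Cantor measures\<close>

definition Lambda_set :: "real \<Rightarrow> real \<Rightarrow> nat set \<Rightarrow> bool" where
  "Lambda_set p C S \<longleftrightarrow> (\<forall>c :: nat \<Rightarrow> complex.
      Lp_norm (restrict_space lborel {0..1}) p (\<lambda>x. \<Sum>a\<in>S. c a * iexp (2 * pi * real a * x))
        \<le> ennreal (C * sqrt (\<Sum>a\<in>S. (norm (c a))\<^sup>2)))"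

(* The alphabet is {0, ..., N - 2}; leaving out N - 1 keeps the intervals descending
   from different parents disjoint. *)
definition admissible_set ::
  "real \<Rightarrow> real \<Rightarrow> real \<Rightarrow> real \<Rightarrow> nat \<Rightarrow> nat set \<Rightarrow> bool" where
  "admissible_set p c0 c1 C N S \<longleftrightarrow> S \<subseteq> {..<N - 1} \<and> Lambda_set p C S
      \<and> c0 * real N powr (2 / p) \<le> real (card S)
      \<and> real (card S) \<le> c1 * real N powr (2 / p)"

definition admissible_family ::
  "real \<Rightarrow> real \<Rightarrow> real \<Rightarrow> real \<Rightarrow> nat \<Rightarrow> nat \<Rightarrow> nat set set \<Rightarrow> bool" where
  "admissible_family p c0 c1 C N N0 \<Sigma> \<longleftrightarrow> 0 < N0 \<and> N0 < N \<and> \<Sigma> \<noteq> {}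
      \<and> (\<forall>S\<in>\<Sigma>. card S = N0 \<and> admissible_set p c0 c1 C N S)"

(* Starting from {1} instead of 1 + S_1 / N lets the first step be the instance
   k = 0 of the recursion, the choice S_1 being S 1 1. *)
primrec cantor_points :: "nat \<Rightarrow> (nat \<Rightarrow> real \<Rightarrow> nat set) \<Rightarrow> nat \<Rightarrow> real set" where
  "cantor_points N S 0 = {1}"
| "cantor_points N S (Suc k) =
     (\<Union>a\<in>cantor_points N S k. (\<lambda>s. a + real s / real N ^ Suc k) ` S (Suc k) a)"

definition cantor_level :: "nat \<Rightarrow> (nat \<Rightarrow> real \<Rightarrow> nat set) \<Rightarrow> nat \<Rightarrow> real set" where
  "cantor_level N S k = (\<Union>a\<in>cantor_points N S k. {a .. a + 1 / real N ^ k})"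

definition cantor_measure :: "nat \<Rightarrow> nat set set \<Rightarrow> real measure \<Rightarrow> bool" where
  "cantor_measure N \<Sigma> \<mu> \<longleftrightarrow> (\<exists>S :: nat \<Rightarrow> real \<Rightarrow> nat set.
      (\<forall>k. \<forall>a\<in>cantor_points N S k. S (Suc k) a \<in> \<Sigma>)
      \<and> real_distribution \<mu>
      \<and> weak_conv_m (\<lambda>j. uniform_measure lborel (cantor_level N S (Suc j))) \<mu>)"

(* The exponent \<alpha> with N0 = N powr \<alpha>.  For admissible families with fixed constants
   it tends to 2/p as N grows, so \<gamma> < \<alpha>/2 with \<gamma> = 1/p can hold for all large N, but
   only with a margin O(1 / log N).  In that borderline case the estimates of order \<gamma>
   can fail no matter how large N is. *)
definition cantor_dim :: "nat \<Rightarrow> nat \<Rightarrow> real" where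
  "cantor_dim N N0 = log (real N) (real N0)"

end

theory Submission
  imports Defs
begin

text \<open>
Write e(x) for exp(2 pi i x).  The space-time Fourier transform of A_t f(x) lives on the lines
(xi, -y xi), y in the Cantor set.  For xi near a fixed xi_0 the second coordinate is close to -y xi_0, so
that at each x the dependence on t is governed by exponential sums whose frequencies are
dilated Cantor points.  These are what the Lambda(p) hypothesis controls.

Fix a frequency xi_0 of size R, let N^k be the largest power of N that is at most R, and let
F(x,t) be the integral of w(y) e(-xi_0 t y) h(x - t y) against the measure, where |w| <= 1 and
h has frequencies O(R/N).  When a cell of generation j is split into its N_0 children, F becomes,
after a shear in x, a sum over the digits s of e(-xi_0 t s / N^(j+1)) G_s(x,t), where G_s varies
with t only on the scale N^(j+1)/R, one period of the exponential sum.  The fundamental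
theorem of calculus freezes G_s on intervals of that length at the cost of one t-derivative,
and the Lambda(p) property then gives, with B independent of N (\<open>Lambda_step\<close>),
  ||sum_s e(..) G_s||_p^p <= B N_0^(p/2-1) sum_s (||G_s||_p^p + ||(N^(j+1)/R) d/dt G_s||_p^p).
The derivative of G_s is a sum of two terms of the same kind as G_s, with a new weight w and
possibly with the derivative of h in place of h, so the inequality can be iterated k times
(\<open>energy_step\<close>, \<open>energy_iterate\<close>).  A cell of generation k has mass
O(N_0^(-k)) (\<open>measure_cell\<close>), so the trivial estimate for the N_0^k final pieces yields, with a
larger B,
  ||F||_p^p <= B^k N_0^(-kp/2) max_m (N/R)^(mp) ||h^(m)||_p^p.
Since N_0 is comparable to N^(2/p), the power N_0^(-kp/2) is 1/R up to a constant to the power k and a factor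
depending on N, and B^k <= R^epsilon once N is large.  So A_t gains R^(-1/p+epsilon) at
frequency R.

It remains to cut f into pieces to which this applies and to add up.  Tent functions on the geometric grid of
ratio 1 + 1/N split the frequency line into windows whose width is, except for those next to the origin,
their distance from the origin divided by N.
Two integrations by parts bound the L^1 norms of the window kernels and of their derivatives of every
order (\<open>kernel_decay\<close>, \<open>window_kernel_bound\<close>), hence the window pieces of f in L^p (\<open>piece_Lp\<close>).
For part (ii) the weight (1 + xi^2)^(gamma/2) costs R^gamma with gamma < 1/p, and the bounds of the
windows form a geometric series (\<open>mixed_suminf\<close>).  For part (i) the weight is 1, and
passing from L^p to L^r in t costs R^(1/p-1/r) by Sobolev embedding (\<open>mixed_norm_le\<close>), which
again leaves a negative power of R.  Fourier inversion (\<open>fourier_inversion\<close>) identifies the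
averages with the multiplier of weight 1, so both parts are instances of
\<open>averaged_multiplier_bound\<close>.  When gamma > 1/p the condition gamma < alpha/2 fails for all
large N, because alpha tends to 2/p.
\<close>

section \<open>Powers of extended nonnegative reals\<close>

lemma enn_powr_ennreal: "x \<ge> 0 \<Longrightarrow> enn_powr (ennreal x) s = ennreal (x powr s)"
  by (simp add: enn_powr_def)

lemma enn_powr_0 [simp]: "enn_powr 0 s = 0"
  by (simp add: enn_powr_def)

lemma enn_powr_top [simp]: "enn_powr \<top> s = \<top>"
  by (simp add: enn_powr_def)

lemma enn_powr_mono: "0 \<le> s \<Longrightarrow> x \<le> y \<Longrightarrow> enn_powr x s \<le> enn_powr y s"
  by (cases x; cases y) (auto simp: enn_powr_ennreal intro!: ennreal_leI powr_mono2 simp: top_unique)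

lemma enn_powr_mult: "0 < s \<Longrightarrow> enn_powr (x * y) s = enn_powr x s * enn_powr y s"
proof -
  assume s: "0 < s"
  have top: "enn_powr (\<top> * y) s = \<top> * enn_powr y s" for y
  proof (cases y)
    case (real r)
    then show ?thesis using s
      by (cases "r = 0") (auto simp: enn_powr_ennreal ennreal_top_mult)
  qed (simp add: enn_powr_def)
  show ?thesis
  proof (cases x; cases y)
    fix a b assume "x = ennreal a" "y = ennreal b" "0 \<le> a" "0 \<le> b"
    then show ?thesis
      by (simp add: enn_powr_ennreal ennreal_mult[symmetric] powr_mult)
  qed (use top[of y] top[of x] in \<open>auto simp: mult.commute\<close>)
qed

lemma enn_powr_enn_powr:
  "0 < s \<Longrightarrow> 0 < t \<Longrightarrow> enn_powr (enn_powr x s) t = enn_powr x (s * t)"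
  by (cases x) (auto simp: enn_powr_ennreal powr_powr)

lemma enn_powr_1 [simp]: "enn_powr x 1 = x"
  by (cases x) (auto simp: enn_powr_ennreal)

lemma measurable_enn_powr [measurable]:
  "f \<in> borel_measurable M \<Longrightarrow> (\<lambda>x. enn_powr (f x) s) \<in> borel_measurable M"
proof -
  assume [measurable]: "f \<in> borel_measurable M"
  have "f -` {\<top>} \<inter> space M \<in> sets M" by (rule measurable_sets[of f M borel]) auto
  moreover have "f -` {\<top>} \<inter> space M = {x \<in> space M. f x = \<top>}" by auto
  ultimately have [measurable]: "{x \<in> space M. f x = \<top>} \<in> sets M" by simp
  show ?thesis unfolding enn_powr_def
    by measurable
qed

lemma enn_powr_le_iff_le: 
  assumes "0 < s" "enn_powr x s \<le> enn_powr y s" shows "x \<le> y"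
proof -
  have inv: "enn_powr (enn_powr z s) (1/s) = z" for z
    using enn_powr_enn_powr[of s "1/s" z] assms(1) by simp
  have "enn_powr (enn_powr x s) (1/s) \<le> enn_powr (enn_powr y s) (1/s)"
    using assms by (intro enn_powr_mono[of "1/s"]) auto
  then show ?thesis by (simp only: inv)
qed

lemma measurable_cis [measurable (raw)]:
  "f \<in> borel_measurable M \<Longrightarrow> (\<lambda>x. cis (f x)) \<in> borel_measurable M"
  unfolding cis_conv_exp by measurable

lemma norm_add_powr_le:
  fixes a b :: real
  assumes "0 \<le> a" "0 \<le> b" "0 \<le> p"
  shows "(a + b) powr p \<le> 2 powr p * (a powr p + b powr p)"
proof -
  have "(a + b) powr p \<le> (2 * max a b) powr p"
    using assms by (intro powr_mono2) auto
  also have "\<dots> = 2 powr p * (max a b) powr p" using assms by (simp add: powr_mult)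
  also have "(max a b) powr p \<le> a powr p + b powr p" by (auto simp: max_def)
  finally show ?thesis by simp
qed

lemma enn_powr_add_le:
  assumes "0 < p"
  shows "enn_powr (a + b) p \<le> ennreal (2 powr p) * (enn_powr a p + enn_powr b p)"
proof (cases a; cases b)
  fix x y assume *: "a = ennreal x" "b = ennreal y" "0 \<le> x" "0 \<le> y"
  have "ennreal ((x + y) powr p) \<le> ennreal (2 powr p * (x powr p + y powr p))"
    using * assms by (intro ennreal_leI norm_add_powr_le) auto
  then show ?thesis using *
    by (simp add: enn_powr_ennreal ennreal_mult[symmetric] ennreal_plus[symmetric] del: ennreal_plus)
qed (auto simp: ennreal_mult_top)

text \<open>
The tangent of the convex function x powr p at l lies below its graph.
\<close>

lemma young_tangent:
  fixes x l p :: real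
  assumes "1 \<le> p" "0 \<le> x" "0 < l"
  shows "p * l powr (p - 1) * x \<le> x powr p + (p - 1) * l powr p"
proof (cases "p = 1")
  case True then show ?thesis using assms by simp
next
  case False
  then have p: "1 < p" using assms by simp
  define q where "q = p / (p - 1)"
  have q: "1 < q" "1 / p + 1 / q = 1" "(p - 1) * q = p" "p / q = p - 1"
    using p by (auto simp: q_def field_simps)
  have "x * l powr (p - 1) \<le> x powr p / p + (l powr (p - 1)) powr q / q"
    using p q assms by (intro Youngs_inequality) auto
  also have "(l powr (p - 1)) powr q = l powr p" by (simp add: powr_powr q)
  finally have "p * (x * l powr (p - 1)) \<le> p * (x powr p / p + l powr p / q)"
    using p by (intro mult_left_mono) auto
  also have "\<dots> = x powr p + p / q * l powr p" using p by (simp add: field_simps)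
  finally show ?thesis by (simp add: q algebra_simps)
qed

text \<open>
Integrate the tangent inequality and choose the point of tangency to be the mean value.
This form, for measures of any finite mass, serves for cells, kernels and finite sums alike.
\<close>

lemma jensen_nn_integral:
  assumes "finite_measure M" and g[measurable]: "g \<in> borel_measurable M" and p: "1 \<le> p"
  shows "enn_powr (\<integral>\<^sup>+x. g x \<partial>M) p
      \<le> ennreal (measure M (space M) powr (p - 1)) * (\<integral>\<^sup>+x. enn_powr (g x) p \<partial>M)"
proof -
  interpret finite_measure M by fact
  define W where "W = measure M (space M)"
  define B where "B = (\<integral>\<^sup>+x. enn_powr (g x) p \<partial>M)"
  define G where "G = (\<integral>\<^sup>+x. g x \<partial>M)"
  have W: "emeasure M (space M) = ennreal W" by (simp add: W_def emeasure_eq_measure)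
  have W0: "0 \<le> W" by (simp add: W_def)
  have tangent: "ennreal (p * l powr (p - 1)) * G \<le> B + ennreal ((p - 1) * l powr p * W)"
    if l: "l > 0" for l
  proof -
    have pt: "ennreal (p * l powr (p - 1)) * g x \<le> enn_powr (g x) p + ennreal ((p - 1) * l powr p)" for x
    proof (cases "g x")
      case (real r)
      have "ennreal (p * l powr (p - 1) * r) \<le> ennreal (r powr p + (p - 1) * l powr p)"
        using l p real by (intro ennreal_leI young_tangent)
      then show ?thesis using real p
        by (simp add: enn_powr_ennreal ennreal_mult[symmetric] ennreal_plus[symmetric] del: ennreal_plus)
    qed simp
    have "ennreal (p * l powr (p - 1)) * G = (\<integral>\<^sup>+x. ennreal (p * l powr (p - 1)) * g x \<partial>M)"
      unfolding G_def by (simp add: nn_integral_cmult)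
    also have "\<dots> \<le> (\<integral>\<^sup>+x. enn_powr (g x) p + ennreal ((p - 1) * l powr p) \<partial>M)"
      by (intro nn_integral_mono pt)
    also have "\<dots> = B + ennreal ((p - 1) * l powr p) * ennreal W"
      unfolding B_def by (subst nn_integral_add) (auto simp: W)
    finally show ?thesis using p W0 by (simp add: ennreal_mult)
  qed
  show ?thesis
  proof (cases "W = 0")
    case True
    then have "emeasure M (space M) = 0" using W by simp
    then have "G = 0" unfolding G_def by (simp add: nn_integral_0_iff_AE) (rule AE_I'[of "space M"], auto simp: null_setsI)
    then show ?thesis by (simp add: G_def)
  next
    case False
    with W0 have Wp: "W > 0" by simp
    show ?thesis
    proof (cases B)
      case top
      have "ennreal (W powr (p - 1)) * B = \<top>" using Wp top by (simp add: ennreal_mult_top)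
      then show ?thesis unfolding W_def B_def by simp
    next
      case (real b)
      have "ennreal p * G \<le> ennreal (b + (p - 1) * W)"
        using tangent[of 1] p real W0 by (simp add: ennreal_plus)
      then have "G \<noteq> \<top>" using p by (auto simp: ennreal_mult_top top_unique)
      then obtain c where c: "G = ennreal c" "0 \<le> c" by (cases G) auto
      show ?thesis
      proof (cases "c = 0")
        case True
        then show ?thesis using c by (simp add: G_def)
      next
        case False
        with c have cp: "0 < c" by simp
        define l where "l = c / W"
        have l: "l > 0" "c = l * W" using cp Wp by (auto simp: l_def)
        have "ennreal (p * l powr (p - 1) * c) \<le> ennreal (b + (p - 1) * l powr p * W)"
          using tangent[OF l(1)] p real W0 c by (simp add: ennreal_mult ennreal_plus)
        then have "p * l powr (p - 1) * c \<le> b + (p - 1) * l powr p * W"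
          using real p W0 by (subst (asm) ennreal_le_iff) auto
        moreover have "l powr p = l powr (p - 1) * l" using l by (simp add: powr_mult_base powr_diff)
        ultimately have "l powr p * W \<le> b" using l by (simp add: algebra_simps)
        then have "W powr (p - 1) * (l powr p * W) \<le> W powr (p - 1) * b" by (intro mult_left_mono) auto
        moreover have "W powr (p - 1) * (l powr p * W) = c powr p"
          using l Wp by (simp add: powr_mult powr_diff)
        ultimately have "ennreal (c powr p) \<le> ennreal (W powr (p - 1) * b)" by (intro ennreal_leI) simp
        then show ?thesis using c real
          unfolding G_def[symmetric] B_def[symmetric] W_def[symmetric]
          by (simp add: enn_powr_ennreal ennreal_mult)
      qed
    qed
  qed
qed

lemma power_mean:
  fixes x :: "'a \<Rightarrow> real"
  assumes "finite S" "\<And>s. s \<in> S \<Longrightarrow> 0 \<le> x s" "1 \<le> p"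
  shows "(\<Sum>s\<in>S. x s) powr p \<le> real (card S) powr (p - 1) * (\<Sum>s\<in>S. x s powr p)"
proof -
  have "finite_measure (count_space S)" using assms by (intro finite_measure_count_space)
  from jensen_nn_integral[OF this, of "\<lambda>s. ennreal (x s)" p]
  have "enn_powr (\<Sum>s\<in>S. ennreal (x s)) p \<le> ennreal (real (card S) powr (p - 1)) * (\<Sum>s\<in>S. enn_powr (ennreal (x s)) p)"
    using assms by (simp add: nn_integral_count_space_finite)
  also have "(\<Sum>s\<in>S. ennreal (x s)) = ennreal (\<Sum>s\<in>S. x s)" using assms by (simp add: sum_ennreal)
  also have "(\<Sum>s\<in>S. enn_powr (ennreal (x s)) p) = (\<Sum>s\<in>S. ennreal (x s powr p))"
    using assms by (intro sum.cong) (auto simp: enn_powr_ennreal)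
  also have "\<dots> = ennreal (\<Sum>s\<in>S. x s powr p)" by (intro sum_ennreal) auto
  finally show ?thesis using assms
    by (simp add: enn_powr_ennreal sum_nonneg ennreal_mult[symmetric])
qed

text \<open>
Weights that are summable replace Minkowski's inequality wherever the terms decay
geometrically: each a n is at most c n times the root of the weighted sum on the right.
\<close>

lemma enn_powr_suminf_weighted:
  fixes a :: "nat \<Rightarrow> ennreal" and c :: "nat \<Rightarrow> real"
  assumes q: "0 < q" and c: "\<And>n. 0 < c n" and C: "(\<Sum>n. ennreal (c n)) \<le> ennreal C"
  shows "enn_powr (\<Sum>n. a n) q \<le> ennreal (C powr q) * (\<Sum>n. ennreal (c n powr (- q)) * enn_powr (a n) q)"
proof -
  define T where "T = (\<Sum>n. ennreal (c n powr (- q)) * enn_powr (a n) q)"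
  have "ennreal (c 0) \<le> (\<Sum>n. ennreal (c n))"
    using sum_le_suminf[of "\<lambda>n. ennreal (c n)" "{0}"] by auto
  with C have "ennreal (c 0) \<le> ennreal C" by simp
  with c[of 0] have Cp: "0 < C" by (simp add: ennreal_le_iff2)
  have a_le: "a n \<le> ennreal (c n) * enn_powr T (1 / q)" for n
  proof (rule enn_powr_le_iff_le[OF q])
    have "ennreal (c n powr (- q)) * enn_powr (a n) q \<le> T"
      unfolding T_def using sum_le_suminf[of "\<lambda>n. ennreal (c n powr (- q)) * enn_powr (a n) q" "{n}"] by auto
    then have "ennreal (c n powr q) * (ennreal (c n powr (- q)) * enn_powr (a n) q) \<le> ennreal (c n powr q) * T"
      by (intro mult_left_mono) auto
    moreover have "ennreal (c n powr q) * (ennreal (c n powr (- q)) * enn_powr (a n) q) = enn_powr (a n) q"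
      using c[of n] by (simp add: mult.assoc[symmetric] ennreal_mult[symmetric] powr_minus)
    ultimately show "enn_powr (a n) q \<le> enn_powr (ennreal (c n) * enn_powr T (1 / q)) q"
      using q c[of n] by (simp add: enn_powr_mult enn_powr_enn_powr enn_powr_ennreal)
  qed
  have "(\<Sum>n. a n) \<le> (\<Sum>n. ennreal (c n) * enn_powr T (1 / q))" by (intro suminf_le a_le) auto
  also have "\<dots> = (\<Sum>n. ennreal (c n)) * enn_powr T (1 / q)" by (rule ennreal_suminf_multc)
  also have "\<dots> \<le> ennreal C * enn_powr T (1 / q)" by (intro mult_right_mono C) auto
  finally have "enn_powr (\<Sum>n. a n) q \<le> enn_powr (ennreal C * enn_powr T (1 / q)) q"
    using q by (intro enn_powr_mono) auto
  also have "\<dots> = ennreal (C powr q) * T" using q Cp by (simp add: enn_powr_mult enn_powr_enn_powr enn_powr_ennreal)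
  finally show ?thesis by (simp add: T_def)
qed

text \<open>
The l^1 norm is at most the l^q norm for q \<le> 1.  If T is the sum of the q-th powers then each term
satisfies a n = (a n)^q * (a n)^(1-q) \<le> (a n)^q * T^(1/q - 1).
\<close>

lemma enn_powr_suminf_subadditive:
  fixes a :: "nat \<Rightarrow> ennreal"
  assumes q: "0 < q" "q \<le> 1"
  shows "enn_powr (\<Sum>n. a n) q \<le> (\<Sum>n. enn_powr (a n) q)"
proof (cases "(\<Sum>n. enn_powr (a n) q)")
  case (real T)
  define T' where "T' = T powr (1 / q - 1)"
  have a_le: "a n \<le> enn_powr (a n) q * ennreal T'" for n
  proof -
    have le: "enn_powr (a n) q \<le> ennreal T"
      using sum_le_suminf[of "\<lambda>n. enn_powr (a n) q" "{n}"] real by auto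
    then obtain x where x: "a n = ennreal x" "0 \<le> x" by (cases "a n") (auto simp: top_unique)
    have "x powr q \<le> T" using le x real by (simp add: enn_powr_ennreal)
    then have "(x powr q) powr (1 / q - 1) \<le> T'" unfolding T'_def using q
      by (intro powr_mono2) auto
    then have "x powr q * (x powr q) powr (1 / q - 1) \<le> x powr q * T'" by (intro mult_left_mono) auto
    moreover have "x powr q * (x powr q) powr (1 / q - 1) = x"
    proof (cases "x = 0")
      case False
      then have "x powr q * (x powr q) powr (1 / q - 1) = x powr (q + q * (1 / q - 1))"
        by (simp add: powr_powr powr_add)
      also have "q + q * (1 / q - 1) = 1" using q by (simp add: field_simps)
      finally show ?thesis using x by simp
    qed simp
    ultimately have "ennreal x \<le> ennreal (x powr q * T')" by (intro ennreal_leI) simp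
    then show ?thesis using x by (simp add: enn_powr_ennreal ennreal_mult T'_def)
  qed
  have "(\<Sum>n. a n) \<le> (\<Sum>n. enn_powr (a n) q * ennreal T')" by (intro suminf_le a_le) auto
  also have "\<dots> = ennreal T * ennreal T'" using real by simp
  also have "\<dots> = ennreal (T * T')" using real by (simp add: ennreal_mult T'_def)
  also have "T * T' = T powr (1 / q)"
  proof (cases "T = 0")
    case False then show ?thesis using real by (simp add: T'_def powr_diff)
  qed (auto simp: T'_def)
  finally have "enn_powr (\<Sum>n. a n) q \<le> enn_powr (ennreal (T powr (1 / q))) q"
    using q by (intro enn_powr_mono) auto
  also have "\<dots> = ennreal T" using q real by (simp add: enn_powr_ennreal powr_powr)
  finally show ?thesis using real by simp
qed simp

section \<open>Decoupling one generation\<close>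

lemma set_nn_integral_Icc_split:
  fixes a b c :: real
  assumes [measurable]: "g \<in> borel_measurable borel" and "a \<le> b" "b \<le> c"
  shows "(\<integral>\<^sup>+t\<in>{a..c}. g t \<partial>lborel) = (\<integral>\<^sup>+t\<in>{a..b}. g t \<partial>lborel) + (\<integral>\<^sup>+t\<in>{b..c}. g t \<partial>lborel)"
proof -
  have "(\<integral>\<^sup>+t\<in>{a..c}. g t \<partial>lborel)
      = (\<integral>\<^sup>+t. g t * indicator {a..b} t + g t * indicator {b..c} t \<partial>lborel)"
    using AE_lborel_singleton[of b] assms(2,3)
    by (intro nn_integral_cong_AE) (auto split: split_indicator)
  also have "\<dots> = (\<integral>\<^sup>+t\<in>{a..b}. g t \<partial>lborel) + (\<integral>\<^sup>+t\<in>{b..c}. g t \<partial>lborel)"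
    by (intro nn_integral_add) auto
  finally show ?thesis .
qed

lemma set_nn_integral_Icc_partition:
  fixes a l :: real
  assumes [measurable]: "g \<in> borel_measurable borel" and l: "0 \<le> l"
  shows "(\<integral>\<^sup>+t\<in>{a..a + real n * l}. g t \<partial>lborel)
       = (\<Sum>i<n. \<integral>\<^sup>+t\<in>{a + real i * l..a + real i * l + l}. g t \<partial>lborel)"
proof (induction n)
  case 0
  have "AE t in lborel. g t * indicator {a..a} t = 0"
    using AE_lborel_singleton[of a] by eventually_elim (auto split: split_indicator)
  then have "(\<integral>\<^sup>+t\<in>{a..a}. g t \<partial>lborel) = (\<integral>\<^sup>+(t::real). 0 \<partial>lborel)"
    by (rule nn_integral_cong_AE)
  then show ?case by simp
next
  case (Suc n)
  have "(\<integral>\<^sup>+t\<in>{a..a + real (Suc n) * l}. g t \<partial>lborel)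
     = (\<integral>\<^sup>+t\<in>{a..a + real n * l}. g t \<partial>lborel) + (\<integral>\<^sup>+t\<in>{a + real n * l..a + real (Suc n) * l}. g t \<partial>lborel)"
    using l by (intro set_nn_integral_Icc_split) (auto simp: algebra_simps)
  moreover have "a + real (Suc n) * l = a + real n * l + l" by (simp add: algebra_simps)
  ultimately show ?case by (simp only: Suc sum.lessThan_Suc)
qed

text \<open>
The value u t differs from any other value u v on the interval by at most the integral of |u'|.
Take p-th powers and average over v.
\<close>

lemma sobolev_interval:
  fixes u u' :: "real \<Rightarrow> complex"
  assumes l: "0 < l" and p: "1 \<le> p" and t: "t \<in> {a..a + l}"
    and [measurable]: "u \<in> borel_measurable borel" "u' \<in> borel_measurable borel"
    and ftc: "\<And>s t. a \<le> s \<Longrightarrow> s \<le> t \<Longrightarrow> t \<le> a + l \<Longrightarrow>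
      set_integrable lborel {s..t} u' \<and> u t - u s = (LINT v:{s..t}|lborel. u' v)"
  shows "ennreal (l * norm (u t) powr p) \<le> ennreal (2 powr p) *
    ((\<integral>\<^sup>+v\<in>{a..a + l}. ennreal (norm (u v) powr p) \<partial>lborel)
     + ennreal (l powr p) * (\<integral>\<^sup>+v\<in>{a..a + l}. ennreal (norm (u' v) powr p) \<partial>lborel))"
proof -
  let ?J = "{a..a + l}"
  define V where "V = (\<integral>\<^sup>+v\<in>?J. ennreal (norm (u' v)) \<partial>lborel)"
  define W where "W = (\<integral>\<^sup>+v\<in>?J. ennreal (norm (u' v) powr p) \<partial>lborel)"
  have diff: "ennreal (norm (u x - u y)) \<le> V" if "a \<le> y" "y \<le> x" "x \<le> a + l" for x y
  proof -
    have "ennreal (norm (LINT v|lborel. indicator {y..x} v *\<^sub>R u' v))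
        \<le> (\<integral>\<^sup>+v. ennreal (norm (indicator {y..x} v *\<^sub>R u' v)) \<partial>lborel)"
      using ftc[OF that] unfolding set_integrable_def
      by (intro integral_norm_bound_ennreal) auto
    also have "(LINT v|lborel. indicator {y..x} v *\<^sub>R u' v) = u x - u y"
      using ftc[OF that] unfolding set_lebesgue_integral_def by simp
    also have "(\<integral>\<^sup>+v. ennreal (norm (indicator {y..x} v *\<^sub>R u' v)) \<partial>lborel)
        = (\<integral>\<^sup>+v\<in>{y..x}. ennreal (norm (u' v)) \<partial>lborel)"
      by (intro nn_integral_cong) (auto split: split_indicator)
    also have "\<dots> \<le> V" unfolding V_def using that
      by (intro nn_integral_mono) (auto split: split_indicator)
    finally show ?thesis .
  qed
  have V: "enn_powr V p \<le> ennreal (l powr (p - 1)) * W"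
  proof -
    have "finite_measure (restrict_space lborel ?J)"
      using l by (intro finite_measureI) (auto simp: emeasure_restrict_space)
    from jensen_nn_integral[OF this _ p, of "\<lambda>v. ennreal (norm (u' v))"]
    show ?thesis unfolding V_def W_def using l
      by (simp add: nn_integral_restrict_space enn_powr_ennreal measure_restrict_space measurable_restrict_space1)
  qed
  have pt: "ennreal (norm (u t) powr p) \<le> ennreal (2 powr p) *
      (ennreal (norm (u v) powr p) + ennreal (l powr (p - 1)) * W)" if v: "v \<in> ?J" for v
  proof -
    have "ennreal (norm (u t)) \<le> ennreal (norm (u v) + norm (u t - u v))"
      by (intro ennreal_leI) (metis add.commute norm_triangle_sub)
    also have "\<dots> = ennreal (norm (u v)) + ennreal (norm (u t - u v))" by simp
    also have "ennreal (norm (u t - u v)) \<le> V"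
      using diff[of v t] diff[of t v] v t by (cases "v \<le> t") (auto simp: norm_minus_commute)
    finally have "ennreal (norm (u t)) \<le> ennreal (norm (u v)) + V" by simp
    then have "enn_powr (ennreal (norm (u t))) p \<le> enn_powr (ennreal (norm (u v)) + V) p"
      using p by (intro enn_powr_mono) auto
    also have "\<dots> \<le> ennreal (2 powr p) * (enn_powr (ennreal (norm (u v))) p + enn_powr V p)"
      using p by (intro enn_powr_add_le) auto
    also have "\<dots> \<le> ennreal (2 powr p) * (enn_powr (ennreal (norm (u v))) p + ennreal (l powr (p - 1)) * W)"
      by (intro mult_left_mono add_left_mono V) auto
    finally show ?thesis by (simp add: enn_powr_ennreal)
  qed
  have "ennreal (l * norm (u t) powr p) = (\<integral>\<^sup>+v. ennreal (norm (u t) powr p) * indicator ?J v \<partial>lborel)"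
    using l by (simp add: nn_integral_cmult_indicator ennreal_mult mult.commute)
  also have "\<dots> \<le> (\<integral>\<^sup>+v. ennreal (2 powr p) *
      (ennreal (norm (u v) powr p) * indicator ?J v + ennreal (l powr (p - 1)) * W * indicator ?J v) \<partial>lborel)"
    using pt by (intro nn_integral_mono) (auto split: split_indicator)
  also have "\<dots> = ennreal (2 powr p) * ((\<integral>\<^sup>+v\<in>?J. ennreal (norm (u v) powr p) \<partial>lborel)
      + ennreal (l powr (p - 1)) * W * ennreal l)"
    using l by (simp add: nn_integral_cmult nn_integral_add nn_integral_cmult_indicator)
  also have "ennreal (l powr (p - 1)) * W * ennreal l = ennreal (l powr (p - 1) * l) * W"
    using l by (simp add: ennreal_mult mult_ac)
  also have "l powr (p - 1) * l = l powr p" using l by (simp add: powr_diff)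
  finally show ?thesis by (simp add: W_def)
qed

lemma Lambda_unit:
  assumes Lam: "Lambda_set p C S" and p: "0 < p" and C: "0 \<le> C"
  shows "(\<integral>\<^sup>+x\<in>{0..1}. ennreal (norm (\<Sum>s\<in>S. c s * cis (2 * pi * real s * x)) powr p) \<partial>lborel)
     \<le> ennreal (C powr p * (\<Sum>s\<in>S. (norm (c s))\<^sup>2) powr (p / 2))"
proof -
  let ?I = "\<integral>\<^sup>+x\<in>{0..1}. ennreal (norm (\<Sum>s\<in>S. c s * cis (2 * pi * real s * x)) powr p) \<partial>lborel"
  let ?X = "\<Sum>s\<in>S. (norm (c s))\<^sup>2"
  have X: "0 \<le> ?X" by (simp add: sum_nonneg)
  have "enn_powr ?I (1 / p) \<le> ennreal (C * sqrt ?X)"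
    using Lam[unfolded Lambda_set_def, rule_format, of c]
    by (simp add: Lp_norm_def eLp_norm_def enn_powr_ennreal nn_integral_restrict_space cis_conv_exp)
  then have "enn_powr (enn_powr ?I (1 / p)) p \<le> enn_powr (ennreal (C * sqrt ?X)) p"
    using p by (intro enn_powr_mono) auto
  also have "enn_powr (enn_powr ?I (1 / p)) p = ?I"
    using enn_powr_enn_powr[of "1 / p" p ?I] p by simp
  also have "enn_powr (ennreal (C * sqrt ?X)) p = ennreal (C powr p * ?X powr (p / 2))"
    using C X by (simp add: enn_powr_ennreal powr_mult powr_half_sqrt[symmetric] powr_powr)
  finally show ?thesis .
qed

lemma Lambda_interval_pos:
  assumes Lam: "Lambda_set p C S" and p: "0 < p" and C: "0 \<le> C" and k: "0 < k"
  shows "(\<integral>\<^sup>+x\<in>{a..a + 2 / k}. ennreal (norm (\<Sum>s\<in>S. c s * cis (2 * pi * k * real s * x)) powr p) \<partial>lborel)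
     \<le> ennreal (2 / k * (C powr p * (\<Sum>s\<in>S. (norm (c s))\<^sup>2) powr (p / 2)))"
proof -
  let ?B = "ennreal (C powr p * (\<Sum>s\<in>S. (norm (c s))\<^sup>2) powr (p / 2))"
  define d where "d s = c s * cis (2 * pi * k * real s * a)" for s
  define g where "g x = ennreal (norm (\<Sum>s\<in>S. d s * cis (2 * pi * real s * x)) powr p)" for x
  have [measurable]: "g \<in> borel_measurable borel" unfolding g_def cis_conv_exp by measurable
  have nd: "norm (d s) = norm (c s)" for s by (simp add: d_def norm_mult)
  have g1: "(\<integral>\<^sup>+x\<in>{0..1}. g x \<partial>lborel) \<le> ?B"
    unfolding g_def using Lambda_unit[OF Lam p C, of d] by (simp add: nd)
  have per: "g (1 + x) = g x" for x
  proof -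
    have "cis (2 * pi * real s * (1 + x)) = cis (2 * pi * real s * x)" for s
    proof -
      have "cis (2 * pi * real s * (1 + x)) = cis (2 * pi * real s) * cis (2 * pi * real s * x)"
        by (simp add: cis_mult algebra_simps)
      also have "cis (2 * pi * real s) = 1" using cis_multiple_2pi[of "real s"] by simp
      finally show ?thesis by simp
    qed
    then show ?thesis by (simp add: g_def)
  qed
  have "(\<integral>\<^sup>+x\<in>{1..2}. g x \<partial>lborel) = (\<integral>\<^sup>+x. g (1 + x) * indicator {1..2} (1 + x) \<partial>lborel)"
    using nn_integral_real_affine[of "\<lambda>x. g x * indicator {1..2} x" 1 1] by simp
  also have "\<dots> = (\<integral>\<^sup>+x\<in>{0..1}. g x \<partial>lborel)"
    by (intro nn_integral_cong) (auto simp: per split: split_indicator)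
  finally have g2: "(\<integral>\<^sup>+x\<in>{1..2}. g x \<partial>lborel) \<le> ?B" using g1 by simp
  have e: "g (k * (x - a)) = ennreal (norm (\<Sum>s\<in>S. c s * cis (2 * pi * k * real s * x)) powr p)" for x
  proof -
    have "(\<Sum>s\<in>S. d s * cis (2 * pi * real s * (k * (x - a)))) = (\<Sum>s\<in>S. c s * cis (2 * pi * k * real s * x))"
      unfolding d_def by (intro sum.cong) (auto simp: mult.assoc cis_mult algebra_simps)
    then show ?thesis by (simp add: g_def)
  qed
  have "(\<integral>\<^sup>+x\<in>{a..a + 2 / k}. g (k * (x - a)) \<partial>lborel)
     = ennreal (1 / k) * (\<integral>\<^sup>+x. g (k * (a + 1 / k * x - a)) * indicator {a..a + 2 / k} (a + 1 / k * x) \<partial>lborel)"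
    using nn_integral_real_affine[of "\<lambda>x. g (k * (x - a)) * indicator {a..a + 2 / k} x" "1 / k" a] k by simp
  also have "(\<integral>\<^sup>+x. g (k * (a + 1 / k * x - a)) * indicator {a..a + 2 / k} (a + 1 / k * x) \<partial>lborel)
     = (\<integral>\<^sup>+x\<in>{0..2}. g x \<partial>lborel)"
    using k by (intro nn_integral_cong) (auto simp: field_simps split: split_indicator)
  also have "\<dots> = (\<integral>\<^sup>+x\<in>{0..1}. g x \<partial>lborel) + (\<integral>\<^sup>+x\<in>{1..2}. g x \<partial>lborel)"
    by (intro set_nn_integral_Icc_split) auto
  also have "ennreal (1 / k) * \<dots> \<le> ennreal (1 / k) * (?B + ?B)"
    by (intro mult_left_mono add_mono g1 g2) auto
  also have "\<dots> = ennreal (2 / k * (C powr p * (\<Sum>s\<in>S. (norm (c s))\<^sup>2) powr (p / 2)))"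
    using k by (simp add: ennreal_mult[symmetric] ennreal_plus[symmetric] del: ennreal_plus)
  finally show ?thesis unfolding e .
qed

text \<open>
On an interval whose length is at least one and at most two periods of the frequency k, the Lambda(p)
inequality holds with respect to normalised length.  The l^2 sum is converted to an l^p sum by
the power mean inequality; this loses nothing later, because all children of a cell have
comparable mass.  The sign of k is absorbed by conjugating the coefficients.
\<close>

lemma Lambda_interval:
  assumes Lam: "Lambda_set p C S" and p: "2 \<le> p" and C: "0 \<le> C" and S: "finite S"
    and k: "k \<noteq> 0" "1 / \<bar>k\<bar> \<le> l" "l \<le> 2 / \<bar>k\<bar>"
  shows "(\<integral>\<^sup>+x\<in>{a..a + l}. ennreal (norm (\<Sum>s\<in>S. cis (2 * pi * k * real s * x) * c s) powr p) \<partial>lborel)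
     \<le> ennreal (2 * l * C powr p * real (card S) powr (p / 2 - 1) * (\<Sum>s\<in>S. norm (c s) powr p))"
proof -
  have l: "0 < l" using k by (smt (verit) divide_pos_pos zero_less_abs_iff)
  define d where "d s = (if 0 < k then c s else cnj (c s))" for s
  have nd: "norm (d s) = norm (c s)" for s by (simp add: d_def)
  have e: "norm (\<Sum>s\<in>S. cis (2 * pi * k * real s * x) * c s)
      = norm (\<Sum>s\<in>S. d s * cis (2 * pi * \<bar>k\<bar> * real s * x))" for x
  proof (cases "0 < k")
    case False
    have "(\<Sum>s\<in>S. d s * cis (2 * pi * \<bar>k\<bar> * real s * x)) = cnj (\<Sum>s\<in>S. cis (2 * pi * k * real s * x) * c s)"
      using False unfolding cnj_sum by (intro sum.cong) (auto simp: d_def cis_cnj)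
    then show ?thesis by (metis complex_mod_cnj)
  qed (simp add: d_def mult.commute)
  have "(\<integral>\<^sup>+x\<in>{a..a + l}. ennreal (norm (\<Sum>s\<in>S. cis (2 * pi * k * real s * x) * c s) powr p) \<partial>lborel)
     \<le> (\<integral>\<^sup>+x\<in>{a..a + 2 / \<bar>k\<bar>}. ennreal (norm (\<Sum>s\<in>S. d s * cis (2 * pi * \<bar>k\<bar> * real s * x)) powr p) \<partial>lborel)"
    unfolding e using k by (intro nn_integral_mono) (auto split: split_indicator)
  also have "\<dots> \<le> ennreal (2 / \<bar>k\<bar> * (C powr p * (\<Sum>s\<in>S. (norm (d s))\<^sup>2) powr (p / 2)))"
    using p k by (intro Lambda_interval_pos[OF Lam _ C]) auto
  also have "\<dots> \<le> ennreal (2 * l * C powr p * real (card S) powr (p / 2 - 1) * (\<Sum>s\<in>S. norm (c s) powr p))"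
  proof (rule ennreal_leI)
    have "(\<Sum>s\<in>S. (norm (d s))\<^sup>2) powr (p / 2)
        \<le> real (card S) powr (p / 2 - 1) * (\<Sum>s\<in>S. ((norm (d s))\<^sup>2) powr (p / 2))"
      using p S by (intro power_mean) auto
    also have "(\<Sum>s\<in>S. ((norm (d s))\<^sup>2) powr (p / 2)) = (\<Sum>s\<in>S. norm (c s) powr p)"
      by (intro sum.cong) (auto simp: nd powr_powr simp flip: powr_numeral)
    finally have *: "(\<Sum>s\<in>S. (norm (d s))\<^sup>2) powr (p / 2)
        \<le> real (card S) powr (p / 2 - 1) * (\<Sum>s\<in>S. norm (c s) powr p)" .
    have "2 / \<bar>k\<bar> * (C powr p * (\<Sum>s\<in>S. (norm (d s))\<^sup>2) powr (p / 2))
        \<le> (2 * l) * (C powr p * (real (card S) powr (p / 2 - 1) * (\<Sum>s\<in>S. norm (c s) powr p)))"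
      using k l * by (intro mult_mono) (auto simp: sum_nonneg)
    then show "2 / \<bar>k\<bar> * (C powr p * (\<Sum>s\<in>S. (norm (d s))\<^sup>2) powr (p / 2))
        \<le> 2 * l * C powr p * real (card S) powr (p / 2 - 1) * (\<Sum>s\<in>S. norm (c s) powr p)"
      by (simp add: mult.assoc)
  qed
  finally show ?thesis .
qed

lemma ennreal_mult_assoc: "0 \<le> a \<Longrightarrow> 0 \<le> b \<Longrightarrow> ennreal a * (ennreal b * x) = ennreal (a * b) * x"
  by (simp add: ennreal_mult mult.assoc)

text \<open>
Decoupling on a single period.  For fixed t the function v \<mapsto> Z G t v has frozen phases, so the
Sobolev bound compares its value at v = t with its averages over the interval.  After
exchanging the order of integration the coefficients G s v are constants for the integral in t,
to which the Lambda(p) inequality applies.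
\<close>

lemma Lambda_step_interval:
  fixes G G' :: "nat \<Rightarrow> real \<Rightarrow> complex"
  assumes Lam: "Lambda_set p C S" and p: "2 \<le> p" and C: "0 \<le> C" and S: "finite S"
    and k: "k \<noteq> 0" "1 / \<bar>k\<bar> \<le> l" "l \<le> 2 / \<bar>k\<bar>"
    and G[measurable]: "\<And>s. G s \<in> borel_measurable borel" "\<And>s. G' s \<in> borel_measurable borel"
    and ftc: "\<And>s x y. a \<le> x \<Longrightarrow> x \<le> y \<Longrightarrow> y \<le> a + l \<Longrightarrow>
      set_integrable lborel {x..y} (G' s) \<and> G s y - G s x = (LINT t:{x..y}|lborel. G' s t)"
  shows "(\<integral>\<^sup>+t\<in>{a..a + l}. ennreal (norm (\<Sum>s\<in>S. cis (2 * pi * k * real s * t) * G s t) powr p) \<partial>lborel)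
     \<le> ennreal (2 powr (2 * p + 1) * C powr p * real (card S) powr (p / 2 - 1)) *
       (\<Sum>s\<in>S. \<integral>\<^sup>+t\<in>{a..a + l}. ennreal (norm (G s t) powr p + \<bar>k\<bar> powr - p * norm (G' s t) powr p) \<partial>lborel)"
proof -
  let ?J = "{a..a + l}"
  have l: "0 < l" using k by (smt (verit) divide_pos_pos zero_less_abs_iff)
  define D where "D = C powr p * real (card S) powr (p / 2 - 1)"
  have D: "0 \<le> D" by (simp add: D_def)
  define Z where "Z H t v = (\<Sum>s\<in>S. cis (2 * pi * k * real s * t) * H s v)"
    for H :: "nat \<Rightarrow> real \<Rightarrow> complex" and t v
  define I where "I H = (\<Sum>s\<in>S. \<integral>\<^sup>+v\<in>?J. ennreal (norm (H s v) powr p) \<partial>lborel)"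
    for H :: "nat \<Rightarrow> real \<Rightarrow> complex"
  have Zm: "(\<lambda>x. Z H (f x) (g x)) \<in> borel_measurable N"
    if [measurable]: "\<And>s. H s \<in> borel_measurable borel" "f \<in> borel_measurable N" "g \<in> borel_measurable N"
    for H f g and N :: "'x measure"
    unfolding Z_def by measurable
  have bound: "(\<integral>\<^sup>+t\<in>?J. \<integral>\<^sup>+v\<in>?J. ennreal (norm (Z H t v) powr p) \<partial>lborel \<partial>lborel)
      \<le> ennreal (2 * l * D) * I H"
    if H[measurable]: "\<And>s. H s \<in> borel_measurable borel" for H
  proof -
    note [measurable (raw)] = Zm[OF H]
    have lam: "(\<integral>\<^sup>+t\<in>?J. ennreal (norm (Z H t v) powr p) \<partial>lborel)
        \<le> ennreal (2 * l * D * (\<Sum>s\<in>S. norm (H s v) powr p))" for v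
      using Lambda_interval[OF Lam p C S k, where a = a and c = "\<lambda>s. H s v"]
      unfolding D_def Z_def by (simp only: mult.assoc)
    have "(\<integral>\<^sup>+t\<in>?J. \<integral>\<^sup>+v\<in>?J. ennreal (norm (Z H t v) powr p) \<partial>lborel \<partial>lborel)
        = (\<integral>\<^sup>+t. \<integral>\<^sup>+v. ennreal (norm (Z H t v) powr p) * indicator ?J t * indicator ?J v \<partial>lborel \<partial>lborel)"
      by (subst nn_integral_multc[symmetric]) (auto simp: mult_ac)
    also have "\<dots> = (\<integral>\<^sup>+v. \<integral>\<^sup>+t. ennreal (norm (Z H t v) powr p) * indicator ?J t * indicator ?J v \<partial>lborel \<partial>lborel)"
      by (rule lborel_pair.Fubini') measurable
    also have "\<dots> = (\<integral>\<^sup>+v\<in>?J. \<integral>\<^sup>+t\<in>?J. ennreal (norm (Z H t v) powr p) \<partial>lborel \<partial>lborel)"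
      by (subst nn_integral_multc) auto
    also have "\<dots> \<le> (\<integral>\<^sup>+v\<in>?J. ennreal (2 * l * D * (\<Sum>s\<in>S. norm (H s v) powr p)) \<partial>lborel)"
      by (intro nn_integral_mono mult_right_mono lam) auto
    also have "\<dots> = (\<integral>\<^sup>+v. ennreal (2 * l * D) * (\<Sum>s\<in>S. ennreal (norm (H s v) powr p) * indicator ?J v) \<partial>lborel)"
      using l D by (intro nn_integral_cong) (auto simp: ennreal_mult sum_nonneg sum_ennreal split: split_indicator)
    also have "\<dots> = ennreal (2 * l * D) * I H"
      unfolding I_def by (simp add: nn_integral_cmult nn_integral_sum)
    finally show ?thesis .
  qed
  have sob: "ennreal (l * norm (Z G t t) powr p) \<le> ennreal (2 powr p) *
      ((\<integral>\<^sup>+v\<in>?J. ennreal (norm (Z G t v) powr p) \<partial>lborel)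
       + ennreal (l powr p) * (\<integral>\<^sup>+v\<in>?J. ennreal (norm (Z G' t v) powr p) \<partial>lborel))" if t: "t \<in> ?J" for t
  proof (rule sobolev_interval[OF l _ t])
    show "Z G t \<in> borel_measurable borel" "Z G' t \<in> borel_measurable borel"
      unfolding Z_def by measurable
    fix x y assume xy: "a \<le> x" "x \<le> y" "y \<le> a + l"
    have int: "integrable lborel (\<lambda>v. indicator {x..y} v *\<^sub>R (cis (2 * pi * k * real s * t) * G' s v))" for s
      using ftc[OF xy, of s] unfolding set_integrable_def mult_scaleR_right[symmetric]
      by (intro integrable_mult_right) auto
    have eq: "(LINT v|lborel. indicator {x..y} v *\<^sub>R (cis (2 * pi * k * real s * t) * G' s v))
        = cis (2 * pi * k * real s * t) * (G s y - G s x)" for s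
      unfolding conjunct2[OF ftc[OF xy, of s]] set_lebesgue_integral_def integral_mult_right_zero[symmetric]
      by simp
    have "set_integrable lborel {x..y} (Z G' t)"
      unfolding set_integrable_def Z_def scaleR_sum_right by (intro Bochner_Integration.integrable_sum int)
    moreover have "(LINT v:{x..y}|lborel. Z G' t v) = Z G t y - Z G t x"
      unfolding set_lebesgue_integral_def Z_def scaleR_sum_right
      by (subst Bochner_Integration.integral_sum[OF int]) (simp only: eq right_diff_distrib sum_subtractf)
    ultimately show "set_integrable lborel {x..y} (Z G' t) \<and> Z G t y - Z G t x = (LINT v:{x..y}|lborel. Z G' t v)"
      by simp
  qed (use p in auto)
  note [measurable (raw)] = Zm[OF G(1)] Zm[OF G(2)]
  have Zd[measurable]: "(\<lambda>t. Z G t t) \<in> borel_measurable borel" unfolding Z_def by measurable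
  define T where "T = (\<integral>\<^sup>+t\<in>?J. ennreal (norm (Z G t t) powr p) \<partial>lborel)"
  have "ennreal l * T = (\<integral>\<^sup>+t\<in>?J. ennreal (l * norm (Z G t t) powr p) \<partial>lborel)"
    unfolding T_def using l by (simp add: nn_integral_cmult[symmetric] ennreal_mult mult_ac)
  also have "\<dots> \<le> (\<integral>\<^sup>+t. ennreal (2 powr p) *
      ((\<integral>\<^sup>+v\<in>?J. ennreal (norm (Z G t v) powr p) \<partial>lborel) * indicator ?J t
       + ennreal (l powr p) * ((\<integral>\<^sup>+v\<in>?J. ennreal (norm (Z G' t v) powr p) \<partial>lborel) * indicator ?J t)) \<partial>lborel)"
    using sob by (intro nn_integral_mono) (auto split: split_indicator)
  also have "\<dots> = ennreal (2 powr p) *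
      ((\<integral>\<^sup>+t\<in>?J. \<integral>\<^sup>+v\<in>?J. ennreal (norm (Z G t v) powr p) \<partial>lborel \<partial>lborel)
       + ennreal (l powr p) * (\<integral>\<^sup>+t\<in>?J. \<integral>\<^sup>+v\<in>?J. ennreal (norm (Z G' t v) powr p) \<partial>lborel \<partial>lborel))"
    by (subst nn_integral_cmult, measurable, subst nn_integral_add, measurable, subst nn_integral_cmult, measurable)
  also have "\<dots> \<le> ennreal (2 powr p) * (ennreal (2 * l * D) * I G + ennreal (l powr p) * (ennreal (2 * l * D) * I G'))"
    by (intro mult_left_mono add_mono bound G) auto
  also have "\<dots> \<le> ennreal (2 powr p) * (ennreal (2 * l * D) * (ennreal (2 powr p) * I G)
      + ennreal (2 powr p * \<bar>k\<bar> powr - p) * (ennreal (2 * l * D) * I G'))"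
  proof (intro mult_left_mono add_mono mult_right_mono ennreal_leI)
    have "1 \<le> 2 powr p" using p by (simp add: ge_one_powr_ge_zero)
    then have "ennreal 1 * I G \<le> ennreal (2 powr p) * I G" by (intro mult_right_mono ennreal_leI) auto
    then show "I G \<le> ennreal (2 powr p) * I G" by simp
    have "l powr p \<le> (2 / \<bar>k\<bar>) powr p" using k l p by (intro powr_mono2) auto
    then show "l powr p \<le> 2 powr p * \<bar>k\<bar> powr - p" by (simp add: powr_divide powr_minus divide_simps)
  qed auto
  also have "\<dots> = ennreal l * (ennreal (2 powr (2 * p + 1) * D) * (I G + ennreal (\<bar>k\<bar> powr - p) * I G'))"
  proof -
    have "2 powr (2 * p + 1) = 2 powr (p + p + 1)" by (simp add: mult_2[symmetric])
    then have two: "2 powr (2 * p + 1) = 2 powr p * 2 powr p * 2" by (simp only: powr_add) simp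
    have e: "2 powr p * (2 * l * D * 2 powr p) = l * (2 powr (2 * p + 1) * D)"
      by (simp add: two)
    have e': "2 powr p * (2 powr p * \<bar>k\<bar> powr - p * (2 * l * D)) = l * (2 powr (2 * p + 1) * D * \<bar>k\<bar> powr - p)"
      by (simp add: two)
    show ?thesis
      unfolding distrib_left using l D by (simp only: ennreal_mult_assoc e e' mult_nonneg_nonneg powr_ge_zero
          zero_le_numeral less_imp_le)
  qed
  finally have "T \<le> ennreal (2 powr (2 * p + 1) * D) * (I G + ennreal (\<bar>k\<bar> powr - p) * I G')"
    using l by (simp add: ennreal_mult_le_mult_iff)
  also have "I G + ennreal (\<bar>k\<bar> powr - p) * I G' = (\<Sum>s\<in>S. \<integral>\<^sup>+t\<in>?J. ennreal (norm (G s t) powr p + \<bar>k\<bar> powr - p * norm (G' s t) powr p) \<partial>lborel)"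
    unfolding I_def
    by (simp add: ennreal_mult distrib_right nn_integral_add nn_integral_cmult sum.distrib sum_distrib_left mult.assoc)
  finally show ?thesis unfolding T_def Z_def D_def by (simp add: mult.assoc)
qed

text \<open>
The interval [1,2] is cut into as many intervals as |k| has integer part, so that each of
them is between one and two periods long.
\<close>

lemma Lambda_step:
  fixes G G' :: "nat \<Rightarrow> real \<Rightarrow> complex"
  assumes Lam: "Lambda_set p C S" and p: "2 \<le> p" and C: "0 \<le> C" and S: "finite S"
    and k: "1 \<le> \<bar>k\<bar>"
    and G[measurable]: "\<And>s. G s \<in> borel_measurable borel" "\<And>s. G' s \<in> borel_measurable borel"
    and ftc: "\<And>s x y. 1 \<le> x \<Longrightarrow> x \<le> y \<Longrightarrow> y \<le> 2 \<Longrightarrow>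
      set_integrable lborel {x..y} (G' s) \<and> G s y - G s x = (LINT t:{x..y}|lborel. G' s t)"
  shows "(\<integral>\<^sup>+t\<in>{1..2}. ennreal (norm (\<Sum>s\<in>S. cis (2 * pi * k * real s * t) * G s t) powr p) \<partial>lborel)
     \<le> ennreal (2 powr (2 * p + 1) * C powr p * real (card S) powr (p / 2 - 1)) *
       (\<Sum>s\<in>S. \<integral>\<^sup>+t\<in>{1..2}. ennreal (norm (G s t) powr p + \<bar>k\<bar> powr - p * norm (G' s t) powr p) \<partial>lborel)"
proof -
  define M where "M = nat \<lfloor>\<bar>k\<bar>\<rfloor>"
  define l where "l = 1 / real M"
  have M1: "1 \<le> real M" using k by (simp add: M_def)
  have "real M = of_int \<lfloor>\<bar>k\<bar>\<rfloor>" using k by (simp add: M_def)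
  with M1 have M: "1 \<le> real M" "real M \<le> \<bar>k\<bar>" "\<bar>k\<bar> \<le> 2 * real M" by linarith+
  have l: "0 < l" "real M * l = 1" "1 / \<bar>k\<bar> \<le> l" "l \<le> 2 / \<bar>k\<bar>" "k \<noteq> 0"
    using M k by (auto simp: l_def field_simps)
  have split: "(\<integral>\<^sup>+t\<in>{1..2}. g t \<partial>lborel) = (\<Sum>i<M. \<integral>\<^sup>+t\<in>{1 + real i * l..1 + real i * l + l}. g t \<partial>lborel)"
    if [measurable]: "g \<in> borel_measurable borel" for g
    using set_nn_integral_Icc_partition[OF that, of l 1 M] l by simp
  have step: "(\<integral>\<^sup>+t\<in>{1 + real i * l..1 + real i * l + l}. ennreal (norm (\<Sum>s\<in>S. cis (2 * pi * k * real s * t) * G s t) powr p) \<partial>lborel)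
     \<le> ennreal (2 powr (2 * p + 1) * C powr p * real (card S) powr (p / 2 - 1)) *
       (\<Sum>s\<in>S. \<integral>\<^sup>+t\<in>{1 + real i * l..1 + real i * l + l}. ennreal (norm (G s t) powr p + \<bar>k\<bar> powr - p * norm (G' s t) powr p) \<partial>lborel)"
    if i: "i < M" for i
  proof (rule Lambda_step_interval[OF Lam p C S])
    have "(real i + 1) * l \<le> real M * l" using i l by (intro mult_right_mono) auto
    then have *: "1 + real i * l + l \<le> 2" "0 \<le> real i * l" using l by (auto simp: algebra_simps)
    fix s x y assume "1 + real i * l \<le> x" "x \<le> y" "y \<le> 1 + real i * l + l"
    with * show "set_integrable lborel {x..y} (G' s) \<and> G s y - G s x = (LINT t:{x..y}|lborel. G' s t)"
      by (intro ftc) linarith+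
  qed (use l in auto)
  show ?thesis
    apply (subst split, measurable)
    apply (subst split, measurable)
    apply (subst sum.swap)
    apply (subst sum_distrib_left)
    using step by (intro sum_mono) auto
qed

section \<open>Cells of the Cantor construction\<close>

text \<open>
Only the size of the digit sets matters for the geometry of the cells; the Lambda(p) property enters
in the decoupling steps.
\<close>

locale cantor_system =
  fixes N N0 :: nat and S :: "nat \<Rightarrow> real \<Rightarrow> nat set" and \<mu> :: "real measure"
  assumes N: "2 \<le> N" and N0: "0 < N0"
    and digits: "\<And>k a. a \<in> cantor_points N S k \<Longrightarrow> S (Suc k) a \<subseteq> {..<N - 1} \<and> card (S (Suc k) a) = N0"
    and mu: "real_distribution \<mu>"
    and weak: "weak_conv_m (\<lambda>j. uniform_measure lborel (cantor_level N S (Suc j))) \<mu>"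
begin

abbreviation pts :: "nat \<Rightarrow> real set" where "pts \<equiv> cantor_points N S"

text \<open>
Half-open cells of one generation are disjoint, while closed ones may share end points.
\<close>

definition cell :: "nat \<Rightarrow> real \<Rightarrow> real set" where
  "cell k a = {a..<a + 1 / real N ^ k}"

definition child :: "nat \<Rightarrow> real \<Rightarrow> nat \<Rightarrow> real" where
  "child k a s = a + real s / real N ^ Suc k"

declare cantor_points.simps(2) [simp del]

lemma N_pos: "0 < real N" using N by simp

lemma sets_cell [measurable]: "cell k a \<in> sets borel"
  by (simp add: cell_def)

lemma self_in_cell [simp]: "a \<in> cell k a"
  using N_pos by (simp add: cell_def)

lemma finite_digits: "a \<in> pts k \<Longrightarrow> finite (S (Suc k) a)"
  using digits[of a k] finite_subset[of _ "{..<N - 1}"] by auto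

lemma pts_Suc: "pts (Suc k) = (\<Union>a\<in>pts k. child k a ` S (Suc k) a)"
  by (simp add: child_def cantor_points.simps(2))

lemma pts_grid: "a \<in> pts k \<Longrightarrow> \<exists>m::int. a = of_int m / real N ^ k"
proof (induction k arbitrary: a)
  case 0
  then show ?case by (auto intro: exI[of _ 1])
next
  case (Suc k)
  then obtain b s where b: "b \<in> pts k" "a = child k b s" by (auto simp: pts_Suc simp del: cantor_points.simps)
  from Suc.IH[OF b(1)] obtain m :: int where m: "b = of_int m / real N ^ k" by auto
  have "a = of_int (m * int N + int s) / real N ^ Suc k"
    using N_pos by (simp add: b m child_def field_simps)
  then show ?case by blast
qed

text \<open>
Points of generation k are integer multiples of N^(-k), so the cell of y is found by rounding.
In this way the offset of y in its cell is a function of y alone, which makes it usable as a global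
weight (see \<open>cell_offset\<close>).
\<close>

lemma cell_floor:
  assumes "a \<in> pts k" "y \<in> cell k a"
  shows "a = of_int \<lfloor>real N ^ k * y\<rfloor> / real N ^ k"
proof -
  obtain m :: int where m: "a = of_int m / real N ^ k" using pts_grid[OF assms(1)] by auto
  have "of_int m \<le> real N ^ k * y" "real N ^ k * y < of_int m + 1"
    using assms(2) N_pos by (auto simp: cell_def m field_simps)
  then have "\<lfloor>real N ^ k * y\<rfloor> = m" by (simp add: floor_eq_iff)
  then show ?thesis by (simp add: m)
qed

lemma cell_offset:
  assumes "a \<in> pts k" "y \<in> cell k a"
  shows "y - a = frac (real N ^ k * y) / real N ^ k"
  using cell_floor[OF assms] N_pos by (simp add: frac_def field_simps)

lemma cell_inj: "a \<in> pts k \<Longrightarrow> b \<in> pts k \<Longrightarrow> y \<in> cell k a \<Longrightarrow> y \<in> cell k b \<Longrightarrow> a = b"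
  using cell_floor by metis

text \<open>
Digits are at most N - 2, so even the closed interval of a child stays inside the half-open cell
of its parent.
\<close>

lemma Icc_child_subset:
  assumes "a \<in> pts k" "s \<in> S (Suc k) a"
  shows "{child k a s..child k a s + 1 / real N ^ Suc k} \<subseteq> cell k a"
proof -
  have "s < N - 1" using digits[OF assms(1)] assms(2) by auto
  then have "real s + 1 < real N" by linarith
  then have "(real s + 1) / real N ^ Suc k < real N / real N ^ Suc k"
    using N_pos by (intro divide_strict_right_mono) auto
  then have "real s / real N ^ Suc k + 1 / real N ^ Suc k < 1 / real N ^ k"
    using N_pos by (simp add: add_divide_distrib)
  moreover have "0 \<le> real s / real N ^ Suc k" using N_pos by simp
  ultimately show ?thesis unfolding cell_def child_def by (intro subsetI) (simp only: atLeastAtMost_iff atLeastLessThan_iff, linarith)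
qed

lemma cell_child_subset:
  "a \<in> pts k \<Longrightarrow> s \<in> S (Suc k) a \<Longrightarrow> cell (Suc k) (child k a s) \<subseteq> cell k a"
  using Icc_child_subset[of a k s] unfolding cell_def[of "Suc k"] by (auto simp del: power_Suc)

lemma child_in_cell: "a \<in> pts k \<Longrightarrow> s \<in> S (Suc k) a \<Longrightarrow> child k a s \<in> cell k a"
  using cell_child_subset[of a k s] self_in_cell by blast

lemma child_in_pts: "a \<in> pts k \<Longrightarrow> s \<in> S (Suc k) a \<Longrightarrow> child k a s \<in> pts (Suc k)"
  by (auto simp: pts_Suc)

lemma child_inj: "inj_on (child k a) A"
  using N_pos by (auto simp: inj_on_def child_def)

lemma finite_pts: "finite (pts k)"
  by (induction k) (auto simp: pts_Suc finite_digits)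

lemma sum_pts_Suc:
  fixes f :: "real \<Rightarrow> 'b::comm_monoid_add"
  shows "(\<Sum>b\<in>pts (Suc k). f b) = (\<Sum>a\<in>pts k. \<Sum>s\<in>S (Suc k) a. f (child k a s))"
proof -
  have "(\<Sum>b\<in>pts (Suc k). f b) = (\<Sum>a\<in>pts k. \<Sum>b\<in>child k a ` S (Suc k) a. f b)"
    unfolding pts_Suc
  proof (rule sum.UNION_disjoint)
    show "\<forall>a\<in>pts k. \<forall>b\<in>pts k. a \<noteq> b \<longrightarrow> child k a ` S (Suc k) a \<inter> child k b ` S (Suc k) b = {}"
    proof (intro ballI impI)
      fix a b assume ab: "a \<in> pts k" "b \<in> pts k" "a \<noteq> b"
      have "child k a ` S (Suc k) a \<subseteq> cell k a" "child k b ` S (Suc k) b \<subseteq> cell k b"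
        using child_in_cell ab by auto
      then show "child k a ` S (Suc k) a \<inter> child k b ` S (Suc k) b = {}"
        using cell_inj[OF ab(1,2)] ab(3) by blast
    qed
  qed (auto simp: finite_pts finite_digits)
  also have "\<dots> = (\<Sum>a\<in>pts k. \<Sum>s\<in>S (Suc k) a. f (child k a s))"
    by (intro sum.cong) (auto simp: sum.reindex[OF child_inj])
  finally show ?thesis .
qed

lemma ancestor: "b \<in> pts (k + i) \<Longrightarrow> \<exists>a\<in>pts k. cell (k + i) b \<subseteq> cell k a"
proof (induction i arbitrary: b)
  case (Suc i)
  then obtain c s where c: "c \<in> pts (k + i)" "s \<in> S (Suc (k + i)) c" "b = child (k + i) c s"
    by (auto simp: pts_Suc simp del: cantor_points.simps)
  from Suc.IH[OF c(1)] cell_child_subset[OF c(1,2)] show ?case by (auto simp: c(3))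
qed auto

lemma Icc_ancestor:
  assumes "b \<in> pts (k + Suc i)"
  shows "\<exists>a\<in>pts k. {b..b + 1 / real N ^ (k + Suc i)} \<subseteq> cell k a"
proof -
  obtain c s where c: "c \<in> pts (k + i)" "s \<in> S (Suc (k + i)) c" "b = child (k + i) c s"
    using assms by (auto simp: pts_Suc simp del: cantor_points.simps)
  from ancestor[OF c(1)] Icc_child_subset[OF c(1,2)] show ?thesis by (auto simp: c(3))
qed

text \<open>
By \<open>cell_inj\<close> a descendant lies in the cell of a point if and only if its own parent does.
\<close>

lemma card_descendants: "a \<in> pts k \<Longrightarrow> card {b \<in> pts (k + i). b \<in> cell k a} = N0 ^ i"
proof (induction i)
  case 0
  have "b = a" if "b \<in> pts k" "b \<in> cell k a" for b
    using cell_inj[OF that(1) 0 self_in_cell that(2)] .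
  then have "{b \<in> pts k. b \<in> cell k a} = {a}" using 0 by auto
  then show ?case by simp
next
  case (Suc i)
  have cnt: "card {b \<in> pts j. P b} = (\<Sum>b\<in>pts j. if P b then 1 else 0)" for j P
    using finite_pts by (simp add: sum.If_cases Int_def)
  have iff: "child (k + i) b s \<in> cell k a \<longleftrightarrow> b \<in> cell k a"
    if b: "b \<in> pts (k + i)" "s \<in> S (Suc (k + i)) b" for b s
  proof -
    obtain a' where a': "a' \<in> pts k" "cell (k + i) b \<subseteq> cell k a'" using ancestor[OF b(1)] by auto
    have "child (k + i) b s \<in> cell k a'" "b \<in> cell k a'" using a' child_in_cell[OF b] self_in_cell by blast+
    then show ?thesis using cell_inj[OF a'(1) Suc.prems] by blast
  qed
  have "card {b \<in> pts (k + Suc i). b \<in> cell k a}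
      = (\<Sum>b\<in>pts (k + i). \<Sum>s\<in>S (Suc (k + i)) b. if child (k + i) b s \<in> cell k a then 1 else 0)"
    unfolding cnt by (simp add: sum_pts_Suc del: cantor_points.simps)
  also have "\<dots> = (\<Sum>b\<in>pts (k + i). if b \<in> cell k a then N0 else 0)"
    using digits by (intro sum.cong) (auto simp: iff)
  also have "\<dots> = N0 * card {b \<in> pts (k + i). b \<in> cell k a}"
    unfolding cnt sum_distrib_left by (intro sum.cong) auto
  finally show ?case using Suc by simp
qed

lemma card_pts: "card (pts k) = N0 ^ k"
proof -
  have "{b \<in> pts (0 + k). b \<in> cell 0 1} = pts k"
    using ancestor[of _ 0 k] self_in_cell by fastforce
  then show ?thesis using card_descendants[of 1 0 k] by simp
qed

lemma level_antimono: "cantor_level N S (k + i) \<subseteq> cantor_level N S k"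
proof (cases i)
  case (Suc j)
  show ?thesis
  proof
    fix x assume "x \<in> cantor_level N S (k + i)"
    then obtain b where b: "b \<in> pts (k + Suc j)" "x \<in> {b..b + 1 / real N ^ (k + Suc j)}"
      by (auto simp: cantor_level_def Suc simp del: cantor_points.simps power_Suc)
    then obtain a where "a \<in> pts k" "x \<in> cell k a" using Icc_ancestor by blast
    then show "x \<in> cantor_level N S k" by (auto simp: cantor_level_def cell_def intro!: bexI[of _ a])
  qed
qed simp

lemma closed_level: "closed (cantor_level N S k)"
  unfolding cantor_level_def using finite_pts by (intro closed_UN) auto

lemma sets_level [measurable]: "cantor_level N S k \<in> sets borel"
  using closed_level by (rule borel_closed)

lemma emeasure_level_ge: "ennreal ((real N0 / real N) ^ k) \<le> emeasure lborel (cantor_level N S k)"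
proof -
  have disj: "disjoint_family_on (cell k) (pts k)"
    unfolding disjoint_family_on_def using cell_inj by blast
  have "emeasure lborel (\<Union>a\<in>pts k. cell k a) = (\<Sum>a\<in>pts k. emeasure lborel (cell k a))"
    using disj finite_pts by (intro sum_emeasure[symmetric]) auto
  also have "\<dots> = (\<Sum>a\<in>pts k. ennreal (1 / real N ^ k))"
    using N_pos by (intro sum.cong) (auto simp: cell_def)
  also have "\<dots> = ennreal ((real N0 / real N) ^ k)"
    using N_pos by (simp add: card_pts power_divide ennreal_of_nat_eq_real_of_nat ennreal_mult[symmetric])
  finally have eq: "emeasure lborel (\<Union>a\<in>pts k. cell k a) = ennreal ((real N0 / real N) ^ k)" .
  have "(\<Union>a\<in>pts k. cell k a) \<subseteq> cantor_level N S k"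
    unfolding cantor_level_def cell_def by (intro UN_mono) auto
  then show ?thesis unfolding eq[symmetric] by (intro emeasure_mono) auto
qed

lemma emeasure_level_finite: "emeasure lborel (cantor_level N S k) < \<infinity>"
proof -
  have "bounded (cantor_level N S k)"
    unfolding cantor_level_def using finite_pts by (intro bounded_UN) auto
  then show ?thesis by (rule emeasure_bounded_finite)
qed

abbreviation "\<nu> j \<equiv> uniform_measure lborel (cantor_level N S (Suc j))"

lemma emeasure_level_pos: "0 < emeasure lborel (cantor_level N S k)"
proof -
  have "0 < (real N0 / real N) ^ k" using N_pos N0 by simp
  then have "0 < ennreal ((real N0 / real N) ^ k)" by simp
  then show ?thesis using emeasure_level_ge[of k] by (rule less_le_trans)
qed

lemma real_distribution_nu: "real_distribution (\<nu> j)"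
proof -
  have "prob_space (\<nu> j)"
    using emeasure_level_pos[of "Suc j"] emeasure_level_finite[of "Suc j"] by (intro prob_space_uniform_measure) auto
  then show ?thesis by (simp add: real_distribution_def real_distribution_axioms_def)
qed

lemma nu_conv:
  fixes \<phi> :: "real \<Rightarrow> real"
  assumes "\<And>x. isCont \<phi> x" "\<And>x. norm (\<phi> x) \<le> B"
  shows "(\<lambda>j. LINT x|\<nu> j. \<phi> x) \<longlonglongrightarrow> (LINT x|\<mu>. \<phi> x)"
  using weak_conv_imp_integral_bdd_continuous_conv[OF real_distribution_nu mu weak assms] .

text \<open>
The function min 1 (dist y E) is continuous and vanishes on all later approximations of the
measure, hence its integral against the limit vanishes as well.
\<close>

lemma AE_level: "AE y in \<mu>. y \<in> cantor_level N S (Suc k)"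
proof -
  interpret real_distribution \<mu> by (rule mu)
  let ?E = "cantor_level N S (Suc k)"
  define \<phi> where "\<phi> y = min 1 (infdist y ?E)" for y :: real
  have ne: "?E \<noteq> {}" using emeasure_level_pos[of "Suc k"] by (metis emeasure_empty less_irrefl)
  have b: "0 \<le> \<phi> y" "\<phi> y \<le> 1" for y by (auto simp: \<phi>_def infdist_nonneg)
  have c: "isCont \<phi> y" for y unfolding \<phi>_def by (intro continuous_intros)
  then have [measurable]: "\<phi> \<in> borel_measurable borel"
    by (intro borel_measurable_continuous_onI continuous_at_imp_continuous_on) auto
  have z: "(LINT x|\<nu> j. \<phi> x) = 0" if "j \<ge> k" for j
  proof -
    have sub: "cantor_level N S (Suc j) \<subseteq> ?E" using level_antimono[of "Suc k" "j - k"] that by simp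
    have "AE x in \<nu> j. x \<in> cantor_level N S (Suc j)"
      by (intro AE_uniform_measureI) auto
    then have "AE x in \<nu> j. \<phi> x = 0"
      by eventually_elim (use sub in \<open>auto simp: \<phi>_def\<close>)
    then show ?thesis by (rule integral_eq_zero_AE)
  qed
  have "(\<lambda>j. LINT x|\<nu> j. \<phi> x) \<longlonglongrightarrow> (LINT x|\<mu>. \<phi> x)"
    using b by (intro nu_conv[OF c, of 1]) auto
  moreover have "(\<lambda>j. LINT x|\<nu> j. \<phi> x) \<longlonglongrightarrow> 0"
    using z by (intro tendsto_eventually) (auto simp: eventually_sequentially)
  ultimately have "(LINT x|\<mu>. \<phi> x) = 0" by (rule LIMSEQ_unique)
  moreover have "integrable \<mu> \<phi>" using b by (intro integrable_const_bound[of _ 1]) auto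
  ultimately have "AE x in \<mu>. \<phi> x = 0" using b by (subst (asm) integral_nonneg_eq_0_iff_AE) auto
  then show ?thesis
  proof eventually_elim
    case (elim y)
    then have "infdist y ?E = 0" by (auto simp: \<phi>_def min_def split: if_splits)
    then show ?case using in_closed_iff_infdist_zero[OF closed_level ne] by blast
  qed
qed

lemma AE_cell: "AE y in \<mu>. \<exists>a\<in>pts k. y \<in> cell k a"
  using AE_level[of k]
proof eventually_elim
  case (elim y)
  then obtain b where b: "b \<in> pts (k + Suc 0)" "y \<in> {b..b + 1 / real N ^ (k + Suc 0)}"
    by (auto simp: cantor_level_def simp del: cantor_points.simps power_Suc)
  then show ?case using Icc_ancestor by blast
qed

lemma AE_child:
  assumes a: "a \<in> pts k"
  shows "AE y in \<mu>. y \<in> cell k a \<longrightarrow> (\<exists>s\<in>S (Suc k) a. y \<in> cell (Suc k) (child k a s))"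
  using AE_cell[of "Suc k"]
proof eventually_elim
  case (elim y)
  then obtain c s where c: "c \<in> pts k" "s \<in> S (Suc k) c" "y \<in> cell (Suc k) (child k c s)"
    by (auto simp: pts_Suc simp del: cantor_points.simps)
  moreover have "y \<in> cell k c" using cell_child_subset[OF c(1,2)] c(3) by auto
  ultimately show ?case using cell_inj[OF a c(1)] by blast
qed

text \<open>
Test the weak convergence with a trapezoid function that is 1 on the cell and is supported
in an interval meeting at most five cells of the same generation.  The approximating
measures give each such cell the mass N0^(-k).
\<close>

lemma measure_cell:
  assumes a: "a \<in> pts k"
  shows "measure \<mu> (cell k a) \<le> 5 / real N0 ^ k"
proof -
  interpret real_distribution \<mu> by (rule mu)
  define \<phi> where "\<phi> x = max 0 (min 1 (2 - \<bar>x - a\<bar> * real N ^ k))" for x :: real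
  define U where "U = {x. \<bar>x - a\<bar> < 2 / real N ^ k}"
  have [measurable]: "U \<in> sets borel" unfolding U_def by measurable
  have b: "0 \<le> \<phi> y" "\<phi> y \<le> 1" for y by (auto simp: \<phi>_def)
  have c: "isCont \<phi> y" for y unfolding \<phi>_def by (intro continuous_intros)
  then have [measurable]: "\<phi> \<in> borel_measurable borel"
    by (intro borel_measurable_continuous_onI continuous_at_imp_continuous_on) auto
  have le: "\<phi> x \<le> indicator U x" for x
    using N_pos by (auto simp: \<phi>_def U_def field_simps split: split_indicator)
  have ge: "indicator (cell k a) x \<le> \<phi> x" for x
  proof (cases "x \<in> cell k a")
    case True
    then have "\<bar>x - a\<bar> * real N ^ k \<le> 1" using N_pos by (auto simp: cell_def field_simps)
    then show ?thesis using True by (auto simp: \<phi>_def)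
  qed (simp add: b)
  have nu: "(LINT x|\<nu> j. \<phi> x) \<le> 5 / real N0 ^ k" if j: "j \<ge> k" for j
  proof -
    interpret n: real_distribution "\<nu> j" by (rule real_distribution_nu)
    define i where "i = j - k"
    have ji: "Suc j = k + Suc i" using j by (simp add: i_def)
    let ?E = "cantor_level N S (Suc j)"
    define I where "I b = {b..b + 1 / real N ^ (k + Suc i)}" for b :: real
    define B where "B = {b \<in> pts (k + Suc i). I b \<inter> U \<noteq> {}}"
    have fB: "finite B" unfolding B_def by (rule finite_subset[OF _ finite_pts[of "k + Suc i"]]) auto
    define anc where "anc q = (if a + of_int q / real N ^ k \<in> pts k
        then {b \<in> pts (k + Suc i). b \<in> cell k (a + of_int q / real N ^ k)} else {})" for q :: int
    \<comment> \<open>B collects the intervals of the approximation that meet U; they descend from at most five points.\<close>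
    have "B \<subseteq> (\<Union>q\<in>{-2..2}. anc q)"
    proof
      fix b assume "b \<in> B"
      then obtain x where b: "b \<in> pts (k + Suc i)" "x \<in> I b" "x \<in> U" by (auto simp: B_def)
      then obtain a' where a': "a' \<in> pts k" "I b \<subseteq> cell k a'" using Icc_ancestor unfolding I_def by blast
      have bI: "b \<in> I b" using N_pos by (simp add: I_def)
      obtain m m' :: int where m: "a = of_int m / real N ^ k" "a' = of_int m' / real N ^ k"
        using pts_grid a a'(1) by metis
      have "x \<in> cell k a'" using a' b by auto
      then have "\<bar>a' - a\<bar> < 3 / real N ^ k" using b(3) by (auto simp: cell_def U_def)
      then have "\<bar>of_int (m' - m) / real N ^ k\<bar> < 3 / real N ^ k" by (simp add: m diff_divide_distrib)
      then have "\<bar>of_int (m' - m) :: real\<bar> < 3" using N_pos by (simp add: abs_divide divide_less_cancel)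
      then have "\<bar>m' - m\<bar> < 3" by linarith
      then have "m' - m \<in> {-2..2}" by auto
      moreover have "a' = a + of_int (m' - m) / real N ^ k" by (simp add: m diff_divide_distrib)
      then have "b \<in> anc (m' - m)" using a' b bI by (auto simp: anc_def)
      ultimately show "b \<in> (\<Union>q\<in>{-2..2}. anc q)" by blast
    qed
    then have "card B \<le> card (\<Union>q\<in>{-2..2}. anc q)"
      using finite_pts by (intro card_mono) (auto simp: anc_def)
    also have "\<dots> \<le> (\<Sum>q\<in>{-2..2}. card (anc q))" by (rule card_UN_le) auto
    also have "\<dots> \<le> (\<Sum>q\<in>{-2..2::int}. N0 ^ Suc i)"
      using card_descendants[of _ k "Suc i"] by (intro sum_mono) (auto simp: anc_def)
    also have "\<dots> = 5 * N0 ^ Suc i" by simp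
    finally have cB: "real (card B) \<le> 5 * real N0 ^ Suc i"
      by (metis of_nat_le_iff of_nat_mult of_nat_numeral of_nat_power)
    have "emeasure lborel (?E \<inter> U) \<le> emeasure lborel (\<Union>b\<in>B. I b)"
      using fB by (intro emeasure_mono) (auto simp: cantor_level_def ji B_def I_def simp del: cantor_points.simps power_Suc)
    also have "\<dots> \<le> (\<Sum>b\<in>B. emeasure lborel (I b))"
      using fB by (intro emeasure_subadditive_finite) (auto simp: I_def)
    also have "\<dots> = (\<Sum>b\<in>B. ennreal (1 / real N ^ (k + Suc i)))"
      using N_pos by (intro sum.cong) (auto simp: I_def simp del: power_Suc)
    also have "\<dots> = ennreal (real (card B) / real N ^ (k + Suc i))"
      using N_pos by (simp add: ennreal_of_nat_eq_real_of_nat ennreal_mult[symmetric] del: power_Suc)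
    also have "\<dots> \<le> ennreal (5 * real N0 ^ Suc i / real N ^ (k + Suc i))"
      using cB N_pos by (intro ennreal_leI divide_right_mono) auto
    finally have num: "measure lborel (?E \<inter> U) \<le> 5 * real N0 ^ Suc i / real N ^ (k + Suc i)"
      by (simp add: measure_def enn2real_leI)
    have den: "(real N0 / real N) ^ (k + Suc i) \<le> measure lborel ?E"
      using emeasure_level_ge[of "Suc j"] emeasure_level_finite[of "Suc j"] unfolding ji
      by (simp add: emeasure_eq_ennreal_measure less_top del: power_Suc)
    have p: "0 < (real N0 / real N) ^ (k + Suc i)" using N_pos N0 by simp
    have "(LINT x|\<nu> j. \<phi> x) \<le> (LINT x|\<nu> j. indicator U x)"
      using le b by (intro integral_mono n.integrable_const_bound[of _ 1]) auto
    also have "\<dots> = measure (\<nu> j) U" by simp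
    also have "\<dots> = measure lborel (?E \<inter> U) / measure lborel ?E"
      using emeasure_level_pos[of "Suc j"] emeasure_level_finite[of "Suc j"]
      by (intro measure_uniform_measure) auto
    also have "\<dots> \<le> (5 * real N0 ^ Suc i / real N ^ (k + Suc i)) / (real N0 / real N) ^ (k + Suc i)"
      using num den p by (intro frac_le) auto
    also have "\<dots> = 5 / real N0 ^ k" using N_pos N0 by (simp add: power_divide power_add)
    finally show ?thesis .
  qed
  have "(\<lambda>j. LINT x|\<nu> j. \<phi> x) \<longlonglongrightarrow> (LINT x|\<mu>. \<phi> x)"
    using b by (intro nu_conv[OF c, of 1]) auto
  then have "(LINT x|\<mu>. \<phi> x) \<le> 5 / real N0 ^ k"
    using nu by (intro LIMSEQ_le_const2) auto
  moreover have "(LINT x|\<mu>. indicator (cell k a) x) \<le> (LINT x|\<mu>. \<phi> x)"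
    using ge b by (intro integral_mono integrable_const_bound[of _ 1]) auto
  ultimately show ?thesis by simp
qed

end

section \<open>Iterated decoupling\<close>

text \<open>
Up to a phase in x, this is the average A_t of the function e(\<beta> x) h(x), with the
measure weighted by w.
\<close>

definition osc ::
  "real measure \<Rightarrow> real \<Rightarrow> (real \<Rightarrow> complex) \<Rightarrow> (real \<Rightarrow> complex) \<Rightarrow> real \<Rightarrow> real \<Rightarrow> complex" where
  "osc \<mu> \<beta> w h x t = (LINT y|\<mu>. w y * cis (- (2 * pi * \<beta> * t * y)) * h (x - t * y))"

definition restr :: "real set \<Rightarrow> (real \<Rightarrow> complex) \<Rightarrow> real \<Rightarrow> complex" where
  "restr A w y = indicator A y * w y"

definition energy ::
  "real measure \<Rightarrow> real \<Rightarrow> real \<Rightarrow> (real \<Rightarrow> complex) \<Rightarrow> (real \<Rightarrow> complex) \<Rightarrow> ennreal" where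
  "energy \<mu> p \<beta> w h
    = (\<integral>\<^sup>+t\<in>{1..2}. (\<integral>\<^sup>+x. ennreal (norm (osc \<mu> \<beta> w h x t) powr p) \<partial>lborel) \<partial>lborel)"

lemma measurable_restr [measurable]:
  assumes [measurable]: "A \<in> sets borel" "w \<in> borel_measurable borel"
  shows "restr A w \<in> borel_measurable borel"
  unfolding restr_def by measurable

lemma norm_restr_le: "norm (w y) \<le> c \<Longrightarrow> norm (restr A w y) \<le> c"
  using order_trans[OF norm_ge_zero, of "w y" c] by (auto simp: restr_def split: split_indicator)

context real_distribution
begin

lemma measurable_osc [measurable (raw)]:
  assumes [measurable]: "w \<in> borel_measurable borel" "h \<in> borel_measurable borel"
    "f \<in> borel_measurable L" "g \<in> borel_measurable L"
  shows "(\<lambda>z. osc M \<beta> w h (f z) (g z)) \<in> borel_measurable L"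
  unfolding osc_def by measurable

lemma integrable_bounded:
  fixes f :: "real \<Rightarrow> complex"
  assumes "f \<in> borel_measurable borel" "\<And>y. norm (f y) \<le> B"
  shows "integrable M f"
  using assms by (intro integrable_const_bound[of _ B]) auto

text \<open>
Translations in x that depend on t preserve the energy.  With a equal to a Cantor point, the shear
x + t a turns the line of slope a in frequency space into a horizontal one.
\<close>

lemma energy_shift:
  assumes [measurable]: "w \<in> borel_measurable borel" "h \<in> borel_measurable borel"
  shows "energy M p \<beta> w h
    = (\<integral>\<^sup>+x. (\<integral>\<^sup>+t\<in>{1..2}. ennreal (norm (osc M \<beta> w h (x + t * a) t) powr p) \<partial>lborel) \<partial>lborel)"
proof -
  have "energy M p \<beta> w h
    = (\<integral>\<^sup>+t. (\<integral>\<^sup>+x. ennreal (norm (osc M \<beta> w h (x + t * a) t) powr p) * indicator {1..2} t \<partial>lborel) \<partial>lborel)"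
    unfolding energy_def
  proof (rule nn_integral_cong)
    fix t :: real
    have "(\<integral>\<^sup>+x. ennreal (norm (osc M \<beta> w h x t) powr p) \<partial>lborel)
        = (\<integral>\<^sup>+x. ennreal (norm (osc M \<beta> w h (x + t * a) t) powr p) \<partial>lborel)"
      using nn_integral_real_affine[of "\<lambda>x. ennreal (norm (osc M \<beta> w h x t) powr p)" 1 "t * a"]
      by (simp add: add.commute)
    then show "(\<integral>\<^sup>+x. ennreal (norm (osc M \<beta> w h x t) powr p) \<partial>lborel) * indicator {1..2} t
        = (\<integral>\<^sup>+x. ennreal (norm (osc M \<beta> w h (x + t * a) t) powr p) * indicator {1..2} t \<partial>lborel)"
      by (simp add: nn_integral_multc)
  qed
  also have "\<dots> = (\<integral>\<^sup>+x. (\<integral>\<^sup>+t\<in>{1..2}. ennreal (norm (osc M \<beta> w h (x + t * a) t) powr p) \<partial>lborel) \<partial>lborel)"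
    by (rule lborel_pair.Fubini') measurable
  finally show ?thesis .
qed

text \<open>
The trivial bound by Jensen's inequality, for the last generation, where no oscillation is left to
exploit.
\<close>

lemma energy_restr_le:
  assumes p: "1 \<le> p" and A[measurable]: "A \<in> sets borel"
    and [measurable]: "w \<in> borel_measurable borel" "h \<in> borel_measurable borel"
    and w: "\<And>y. norm (w y) \<le> 1"
  shows "energy M p \<beta> (restr A w) h
    \<le> ennreal (measure M A powr p) * (\<integral>\<^sup>+x. ennreal (norm (h x) powr p) \<partial>lborel)"
proof -
  let ?m = "measure M A" and ?I = "\<integral>\<^sup>+x. ennreal (norm (h x) powr p) \<partial>lborel"
  have m: "0 \<le> ?m" by simp
  have pt: "ennreal (norm (osc M \<beta> (restr A w) h x t) powr p)
      \<le> ennreal (?m powr (p - 1)) * (\<integral>\<^sup>+y\<in>A. ennreal (norm (h (x - t * y)) powr p) \<partial>M)" for x t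
  proof -
    have "ennreal (norm (osc M \<beta> (restr A w) h x t)) \<le> (\<integral>\<^sup>+y\<in>A. ennreal (norm (h (x - t * y))) \<partial>M)"
    proof (cases "integrable M (\<lambda>y. restr A w y * cis (- (2 * pi * \<beta> * t * y)) * h (x - t * y))")
      case True
      have "ennreal (norm (osc M \<beta> (restr A w) h x t))
          \<le> (\<integral>\<^sup>+y. ennreal (norm (restr A w y * cis (- (2 * pi * \<beta> * t * y)) * h (x - t * y))) \<partial>M)"
        unfolding osc_def by (rule integral_norm_bound_ennreal[OF True])
      also have "\<dots> \<le> (\<integral>\<^sup>+y\<in>A. ennreal (norm (h (x - t * y))) \<partial>M)"
        using w by (intro nn_integral_mono)
          (auto simp: restr_def norm_mult mult_left_le_one_le intro!: ennreal_leI split: split_indicator)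
      finally show ?thesis .
    next
      case False
      then show ?thesis by (simp add: osc_def not_integrable_integral_eq)
    qed
    then have "enn_powr (ennreal (norm (osc M \<beta> (restr A w) h x t))) p
        \<le> enn_powr (\<integral>\<^sup>+y\<in>A. ennreal (norm (h (x - t * y))) \<partial>M) p"
      using p by (intro enn_powr_mono) auto
    also have "\<dots> \<le> ennreal (?m powr (p - 1)) * (\<integral>\<^sup>+y\<in>A. enn_powr (ennreal (norm (h (x - t * y)))) p \<partial>M)"
      using jensen_nn_integral[OF finite_measure_restrict_space[OF finite_measure_axioms] _ p,
          of A "\<lambda>y. ennreal (norm (h (x - t * y)))"]
      by (simp add: nn_integral_restrict_space measure_restrict_space measurable_restrict_space1 space_restrict_space)
    finally show ?thesis by (simp add: enn_powr_ennreal)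
  qed
  have sect: "(\<integral>\<^sup>+x. ennreal (norm (osc M \<beta> (restr A w) h x t) powr p) \<partial>lborel) \<le> ennreal (?m powr p) * ?I" for t
  proof -
    interpret P: pair_sigma_finite lborel M ..
    have "(\<integral>\<^sup>+x. ennreal (norm (osc M \<beta> (restr A w) h x t) powr p) \<partial>lborel)
        \<le> (\<integral>\<^sup>+x. ennreal (?m powr (p - 1)) * (\<integral>\<^sup>+y\<in>A. ennreal (norm (h (x - t * y)) powr p) \<partial>M) \<partial>lborel)"
      by (intro nn_integral_mono pt)
    also have "\<dots> = ennreal (?m powr (p - 1)) * (\<integral>\<^sup>+x. (\<integral>\<^sup>+y\<in>A. ennreal (norm (h (x - t * y)) powr p) \<partial>M) \<partial>lborel)"
      by (rule nn_integral_cmult) measurable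
    also have "(\<integral>\<^sup>+x. (\<integral>\<^sup>+y\<in>A. ennreal (norm (h (x - t * y)) powr p) \<partial>M) \<partial>lborel)
        = (\<integral>\<^sup>+y. (\<integral>\<^sup>+x. ennreal (norm (h (x - t * y)) powr p) * indicator A y \<partial>lborel) \<partial>M)"
      by (rule P.Fubini'[symmetric]) measurable
    also have "\<dots> = (\<integral>\<^sup>+y. ?I * indicator A y \<partial>M)"
    proof (rule nn_integral_cong)
      fix y
      have "?I = (\<integral>\<^sup>+x. ennreal (norm (h (x - t * y)) powr p) \<partial>lborel)"
        using nn_integral_real_affine[of "\<lambda>x. ennreal (norm (h x) powr p)" 1 "- (t * y)"]
        by (simp add: algebra_simps)
      then show "(\<integral>\<^sup>+x. ennreal (norm (h (x - t * y)) powr p) * indicator A y \<partial>lborel) = ?I * indicator A y"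
        by (simp add: nn_integral_multc)
    qed
    also have "\<dots> = ?I * ennreal ?m" by (simp add: nn_integral_cmult_indicator emeasure_eq_measure)
    also have "ennreal (?m powr (p - 1)) * \<dots> = ennreal (?m powr (p - 1) * ?m) * ?I"
      by (simp add: ennreal_mult mult_ac)
    also have "?m powr (p - 1) * ?m = ?m powr p"
      using m by (cases "?m = 0") (auto simp: powr_diff)
    finally show ?thesis .
  qed
  have "energy M p \<beta> (restr A w) h \<le> (\<integral>\<^sup>+t. (ennreal (?m powr p) * ?I) * indicator {1..2::real} t \<partial>lborel)"
    unfolding energy_def by (intro nn_integral_mono mult_right_mono sect) auto
  also have "\<dots> = ennreal (?m powr p) * ?I" by (simp add: nn_integral_cmult_indicator)
  finally show ?thesis .
qed

text \<open>
Differentiation under the integral sign in integrated form: the fundamental theorem of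
calculus is applied for each y, and then the order of integration is exchanged.
\<close>

lemma FTC_osc:
  fixes c h h' :: "real \<Rightarrow> complex" and u v :: "real \<Rightarrow> real" and g x :: real
  assumes [measurable]: "c \<in> borel_measurable borel" "u \<in> borel_measurable borel" "v \<in> borel_measurable borel"
    and c: "\<And>y. norm (c y) \<le> 1" and u: "\<And>y. \<bar>u y\<bar> \<le> 2" and v: "\<And>y. \<bar>v y\<bar> \<le> 2"
    and der: "\<And>x. (h has_vector_derivative h' x) (at x)" and cont: "continuous_on UNIV h'"
    and h: "\<And>x. norm (h x) \<le> B" and h': "\<And>x. norm (h' x) \<le> B'"
    and ab: "a \<le> b"
  defines "K \<equiv> \<lambda>t. LINT y|M. c y * (cis (g * (t * u y)) * h (x - t * v y))"
    and "K' \<equiv> \<lambda>t. LINT y|M. c y * (\<i> * g * u y * cis (g * (t * u y)) * h (x - t * v y)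
        - v y * cis (g * (t * u y)) * h' (x - t * v y))"
  shows "set_integrable lborel {a..b} K' \<and> K b - K a = (LINT t:{a..b}|lborel. K' t)"
    and "K \<in> borel_measurable borel" and "K' \<in> borel_measurable borel"
proof -
  have B0: "0 \<le> B" "0 \<le> B'" using norm_ge_zero order_trans h[of 0] h'[of 0] by blast+
  have contH: "continuous_on UNIV h"
    using der by (meson continuous_at_imp_continuous_on has_vector_derivative_continuous)
  have [measurable]: "h \<in> borel_measurable borel" "h' \<in> borel_measurable borel"
    using contH cont by (auto intro: borel_measurable_continuous_onI)
  define k where "k t y = c y * (cis (g * (t * u y)) * h (x - t * v y))" for t y
  define k' where "k' t y = c y * (\<i> * g * u y * cis (g * (t * u y)) * h (x - t * v y)
        - v y * cis (g * (t * u y)) * h' (x - t * v y))" for t y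
  have K: "K t = (LINT y|M. k t y)" "K' t = (LINT y|M. k' t y)" for t
    by (simp_all add: K_def K'_def k_def k'_def)
  have [measurable (raw)]: "(\<lambda>z. k (f z) (f' z)) \<in> borel_measurable L" "(\<lambda>z. k' (f z) (f' z)) \<in> borel_measurable L"
    if [measurable]: "f \<in> borel_measurable L" "f' \<in> borel_measurable L" for f f' and L :: "'x measure"
    unfolding k_def k'_def by measurable
  show "K \<in> borel_measurable borel" "K' \<in> borel_measurable borel" unfolding K by measurable
  define Q where "Q = \<bar>g\<bar> * 2 * B + 2 * B'"
  have bk': "norm (k' t y) \<le> Q" for t y
  proof -
    have "norm (\<i> * g * u y * cis (g * (t * u y)) * h (x - t * v y)) \<le> \<bar>g\<bar> * 2 * B"
    proof -
      have "norm (\<i> * g * u y * cis (g * (t * u y)) * h (x - t * v y)) = \<bar>g\<bar> * \<bar>u y\<bar> * norm (h (x - t * v y))"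
        by (simp add: norm_mult)
      also have "\<dots> \<le> \<bar>g\<bar> * 2 * B" using u[of y] h[of "x - t * v y"] B0 by (intro mult_mono) auto
      finally show ?thesis .
    qed
    moreover have "norm (v y * cis (g * (t * u y)) * h' (x - t * v y)) \<le> 2 * B'"
    proof -
      have "norm (v y * cis (g * (t * u y)) * h' (x - t * v y)) = \<bar>v y\<bar> * norm (h' (x - t * v y))"
        by (simp add: norm_mult)
      also have "\<dots> \<le> 2 * B'" using v[of y] h'[of "x - t * v y"] B0 by (intro mult_mono) auto
      finally show ?thesis .
    qed
    ultimately have "norm (\<i> * g * u y * cis (g * (t * u y)) * h (x - t * v y)
        - v y * cis (g * (t * u y)) * h' (x - t * v y)) \<le> Q"
      unfolding Q_def by (intro order_trans[OF norm_triangle_ineq4]) auto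
    then have "norm (k' t y) \<le> 1 * Q" unfolding k'_def norm_mult[of "c y"] using c[of y] by (intro mult_mono) auto
    then show ?thesis by simp
  qed
  have bk: "norm (k t y) \<le> B" for t y
  proof -
    have "norm (k t y) = norm (c y) * norm (h (x - t * v y))" by (simp add: k_def norm_mult)
    also have "\<dots> \<le> 1 * B" using c h by (intro mult_mono) auto
    finally show ?thesis by simp
  qed
  have dk: "((\<lambda>t. k t y) has_vector_derivative k' t y) (at t)" for t y
  proof -
    have 1: "((\<lambda>t. cis (g * (t * u y))) has_vector_derivative (g * u y) *\<^sub>R (\<i> * cis (g * (t * u y)))) (at t)"
    proof -
      have "((\<lambda>t. iexp t) \<circ> (\<lambda>t. g * (t * u y)) has_vector_derivative (g * u y) *\<^sub>R (\<i> * iexp (g * (t * u y)))) (at t)"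
        by (rule vector_diff_chain_at) (auto intro!: derivative_eq_intros)
      then show ?thesis by (simp add: o_def cis_conv_exp)
    qed
    have 2: "((\<lambda>t. h (x - t * v y)) has_vector_derivative (- v y) *\<^sub>R h' (x - t * v y)) (at t)"
    proof -
      have "(h \<circ> (\<lambda>t. x - t * v y) has_vector_derivative (- v y) *\<^sub>R h' (x - t * v y)) (at t)"
        by (rule vector_diff_chain_at) (auto intro!: derivative_eq_intros der)
      then show ?thesis by (simp add: o_def)
    qed
    show ?thesis unfolding k_def k'_def
      by (rule has_vector_derivative_eq_rhs, rule has_vector_derivative_mult_right,
          rule has_vector_derivative_mult[OF 1 2])
        (simp add: scaleR_conv_of_real algebra_simps)
  qed
  have ck': "continuous_on S (\<lambda>t. k' t y)" for S y
    unfolding k'_def cis_conv_exp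
    by (intro continuous_intros continuous_on_compose2[OF contH] continuous_on_compose2[OF cont]) auto
  have pt: "(LINT t|lborel. indicator {a..b} t *\<^sub>R k' t y) = k b y - k a y" for y
    using dk ck' ab by (intro integral_FTC_Icc) (auto intro: has_vector_derivative_at_within)
  interpret P: pair_sigma_finite lborel M ..
  have int: "integrable (lborel \<Otimes>\<^sub>M M) (\<lambda>(t, y). indicator {a..b} t *\<^sub>R k' t y)"
  proof (rule integrableI_bounded_set[where A = "{a..b} \<times> UNIV" and B = Q])
    show "emeasure (lborel \<Otimes>\<^sub>M M) ({a..b} \<times> UNIV) < \<infinity>"
      using emeasure_pair_measure_Times[of "{a..b}" lborel UNIV] ab
      by (simp add: emeasure_space_1[simplified])
    show "AE x\<in>{a..b} \<times> UNIV in lborel \<Otimes>\<^sub>M M. norm (case x of (t, y) \<Rightarrow> indicat_real {a..b} t *\<^sub>R k' t y) \<le> Q"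
      using bk' by (intro AE_I2) auto
    show "{a..b} \<times> UNIV \<in> sets (lborel \<Otimes>\<^sub>M M)" by (intro pair_measureI) auto
  qed (auto intro!: AE_I2 simp: indicator_def split: if_splits)
  have "K b - K a = (LINT y|M. k b y - k a y)"
    unfolding K by (intro Bochner_Integration.integral_diff[symmetric] integrable_bounded[of _ B] bk) measurable
  also have "\<dots> = (LINT y|M. LINT t|lborel. indicator {a..b} t *\<^sub>R k' t y)" by (simp add: pt)
  also have "\<dots> = (LINT t|lborel. LINT y|M. indicator {a..b} t *\<^sub>R k' t y)" by (rule P.Fubini_integral[OF int])
  also have "\<dots> = (LINT t:{a..b}|lborel. K' t)" unfolding set_lebesgue_integral_def K by simp
  finally have 1: "K b - K a = (LINT t:{a..b}|lborel. K' t)" .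
  have "integrable lborel (\<lambda>t. LINT y|M. indicator {a..b} t *\<^sub>R k' t y)"
    using P.integrable_fst'[OF int] by simp
  then have "set_integrable lborel {a..b} K'" unfolding set_integrable_def K by simp
  with 1 show "set_integrable lborel {a..b} K' \<and> K b - K a = (LINT t:{a..b}|lborel. K' t)" by simp
qed

end

lemma has_derivative_family_props:
  fixes H :: "nat \<Rightarrow> real \<Rightarrow> complex"
  assumes "\<And>m x. (H m has_vector_derivative H (Suc m) x) (at x)"
  shows "continuous_on UNIV (H m)" "H m \<in> borel_measurable borel"
proof -
  show "continuous_on UNIV (H m)"
    using assms by (meson continuous_at_imp_continuous_on has_vector_derivative_continuous)
  then show "H m \<in> borel_measurable borel" by (rule borel_measurable_continuous_onI)
qed

context cantor_system
begin

sublocale real_distribution \<mu> by (rule mu)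

text \<open>
One generation of decoupling.  On the cell of the child with digit s write y = b s + u y, where b s is the
child and u y the offset.  After the shear by a, the phase e(-\<beta> t y) becomes e(\<kappa> s t)
times e(-\<beta> t (u y)), with \<kappa> = -\<beta> / N^(j+1) and a common unimodular factor.
Differentiating the remaining integral in t produces the factor u y, of size N^(-j-1), from
the phase, and the factor y - a, of size N^(-j), together with a derivative of H m.  These offsets are
fractional parts, so they can be absorbed in the weight; the Lambda(p) step divides by |\<kappa>|, which
makes the first factor harmless and turns the second one into N / |\<beta>|.
\<close>

lemma energy_step:
  fixes H :: "nat \<Rightarrow> real \<Rightarrow> complex"
  assumes p: "2 \<le> p" and C: "0 \<le> C" and a: "a \<in> pts j" and Lam: "Lambda_set p C (S (Suc j) a)"
    and \<beta>: "real N ^ Suc j \<le> \<bar>\<beta>\<bar>"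
    and der: "\<And>m x. (H m has_vector_derivative H (Suc m) x) (at x)"
    and bnd: "\<And>m. \<exists>B. \<forall>x. norm (H m x) \<le> B"
    and w[measurable]: "w \<in> borel_measurable borel" and w1: "\<And>y. norm (w y) \<le> 1"
  defines "A \<equiv> \<lambda>s. cell (Suc j) (child j a s)"
  shows "energy \<mu> p \<beta> (restr (cell j a) w) (H m)
    \<le> ennreal (2 powr (2 * p + 1) * C powr p * real N0 powr (p / 2 - 1)) *
      (\<Sum>s\<in>S (Suc j) a. energy \<mu> p \<beta> (restr (A s) w) (H m)
        + ennreal ((4 * pi) powr p) * energy \<mu> p \<beta> (restr (A s) (\<lambda>y. w y * frac (real N ^ Suc j * y))) (H m)
        + ennreal ((2 * real N / \<bar>\<beta>\<bar>) powr p) * energy \<mu> p \<beta> (restr (A s) (\<lambda>y. w y * frac (real N ^ j * y))) (H (Suc m)))"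
    (is "_ \<le> ennreal ?D * (\<Sum>s\<in>?S. ?e0 s + ennreal ?c1 * ?e1 s + ennreal ?c2 * ?e2 s)")
proof -
  define \<kappa> where "\<kappa> = - \<beta> / real N ^ Suc j"
  define u where "u y = frac (real N ^ Suc j * y) / real N ^ Suc j" for y
  define v where "v y = frac (real N ^ j * y) / real N ^ j" for y
  define w1 where "w1 y = w y * frac (real N ^ Suc j * y)" for y
  define w2 where "w2 y = w y * frac (real N ^ j * y)" for y
  define g where "g = - (2 * pi * \<beta>)"
  define b where "b = child j a"
  have NS: "0 < real N ^ Suc j" "0 < real N ^ j" "1 \<le> real N ^ Suc j" "1 \<le> real N ^ j"
    using N_pos N by (auto simp del: power_Suc)
  have [measurable]: "u \<in> borel_measurable borel" "v \<in> borel_measurable borel"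
    "w1 \<in> borel_measurable borel" "w2 \<in> borel_measurable borel"
    unfolding u_def v_def w1_def w2_def frac_def by measurable
  have fr: "0 \<le> frac z" "frac z \<le> 1" for z :: real using frac_lt_1[of z] by auto
  have small: "\<bar>z / c\<bar> \<le> 2" if "0 \<le> z" "z \<le> 1" "1 \<le> c" for z c :: real
  proof -
    have "z / c \<le> 1" "0 \<le> z / c" using that by auto
    then show ?thesis by linarith
  qed
  have uv: "\<bar>u y\<bar> \<le> 2" "\<bar>v y\<bar> \<le> 2" for y
    unfolding u_def v_def by (rule small; use fr NS in blast)+
  \<comment> \<open>The quantities of the statement after the shear by a.\<close>
  let ?o = "\<lambda>X w m x t. norm (osc \<mu> \<beta> (restr X w) (H m) (x + t * a) t)"
  let ?T = "\<lambda>F. \<integral>\<^sup>+t\<in>{1..2}. ennreal (F t powr p) \<partial>lborel"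
  note contH = has_derivative_family_props(1)[of H, OF der]
  note [measurable] = has_derivative_family_props(2)[of H, OF der]
  obtain B B' where B: "\<And>x. norm (H m x) \<le> B" and B': "\<And>x. norm (H (Suc m) x) \<le> B'"
    using bnd by meson
  have cA[measurable]: "A s \<in> sets borel" "cell j a \<in> sets borel" for s unfolding A_def by auto
  have off: "y - b s = u y" "y - a = v y" if "s \<in> ?S" "y \<in> A s" for s y
    using cell_offset[OF child_in_pts[OF a that(1)], of y] cell_offset[OF a, of y]
      cell_child_subset[OF a that(1)] that(2)
    unfolding u_def v_def A_def b_def by auto
  define K where "K x s t = (LINT y|\<mu>. restr (A s) w y * (cis (g * (t * u y)) * H m (x - t * v y)))" for x s t
  define K' where "K' x s t = (LINT y|\<mu>. restr (A s) w y * (\<i> * g * u y * cis (g * (t * u y)) * H m (x - t * v y)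
        - v y * cis (g * (t * u y)) * H (Suc m) (x - t * v y)))" for x s t
  have ftc: "set_integrable lborel {s'..t} (K' x s) \<and> K x s t - K x s s' = (LINT t:{s'..t}|lborel. K' x s t)"
    "K x s \<in> borel_measurable borel" "K' x s \<in> borel_measurable borel" if "s' \<le> t" for x s s' t
  proof -
    have m: "restr (A s) w \<in> borel_measurable borel" "u \<in> borel_measurable borel" "v \<in> borel_measurable borel"
      by measurable
    have n: "norm (restr (A s) w y) \<le> 1" for y by (intro norm_restr_le w1)
    have K: "K x s = (\<lambda>t. LINT y|\<mu>. restr (A s) w y * (cis (g * (t * u y)) * H m (x - t * v y)))"
      "K' x s = (\<lambda>t. LINT y|\<mu>. restr (A s) w y * (\<i> * g * u y * cis (g * (t * u y)) * H m (x - t * v y)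
        - v y * cis (g * (t * u y)) * H (Suc m) (x - t * v y)))"
      by (simp_all add: K_def K'_def fun_eq_iff)
    note * = FTC_osc[where g = g and x = x, OF m n uv der contH B B' that, folded K]
    show "set_integrable lborel {s'..t} (K' x s) \<and> K x s t - K x s s' = (LINT t:{s'..t}|lborel. K' x s t)"
      using *(1) by (simp only: K)
    show "K x s \<in> borel_measurable borel" by (rule *)
    show "K' x s \<in> borel_measurable borel" by (rule *)
  qed
  have o: "osc \<mu> \<beta> (restr X w') h (x + t * a) t = (LINT y|\<mu>. restr X w' y * cis (g * t * y) * h (x - t * (y - a)))"
    for X w' h x t
    unfolding osc_def g_def by (simp add: algebra_simps)
  have split: "osc \<mu> \<beta> (restr (cell j a) w) (H m) (x + t * a) t = (\<Sum>s\<in>?S. cis (g * t * b s) * K x s t)" for x t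
  proof -
    have ind: "AE y in \<mu>. indicator (cell j a) y = (\<Sum>s\<in>?S. indicator (A s) y :: complex)"
      using AE_child[OF a]
    proof eventually_elim
      case (elim y)
      show ?case
      proof (cases "y \<in> cell j a")
        case True
        then obtain s where s: "s \<in> ?S" "y \<in> A s" using elim unfolding A_def by auto
        have uniq: "s' = s" if s': "s' \<in> ?S" "y \<in> A s'" for s'
        proof -
          have "child j a s' = child j a s"
            using cell_inj[OF child_in_pts[OF a s'(1)] child_in_pts[OF a s(1)]] s s' unfolding A_def by auto
          then show ?thesis using child_inj[of j a UNIV] by (auto simp: inj_on_def)
        qed
        have "(\<Sum>s\<in>?S. indicator (A s) y :: complex) = (\<Sum>s'\<in>?S. if s' = s then 1 else 0)"
        proof (rule sum.cong[OF refl])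
          fix s' assume "s' \<in> ?S"
          then show "indicator (A s') y = (if s' = s then 1 else 0 :: complex)"
            using uniq[of s'] s by (cases "y \<in> A s'") auto
        qed
        then show ?thesis using True s finite_digits[OF a] by simp
      next
        case False
        then have "y \<notin> A s" if "s \<in> ?S" for s
          using cell_child_subset[OF a that] unfolding A_def by auto
        then show ?thesis using False by simp
      qed
    qed
    have "osc \<mu> \<beta> (restr (cell j a) w) (H m) (x + t * a) t
        = (LINT y|\<mu>. (\<Sum>s\<in>?S. restr (A s) w y * cis (g * t * y) * H m (x - t * (y - a))))"
      unfolding o
    proof (rule integral_cong_AE)
      show "AE y in \<mu>. restr (cell j a) w y * cis (g * t * y) * H m (x - t * (y - a))
          = (\<Sum>s\<in>?S. restr (A s) w y * cis (g * t * y) * H m (x - t * (y - a)))"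
        using ind by eventually_elim (simp add: restr_def sum_distrib_right)
    qed measurable
    also have "\<dots> = (LINT y|\<mu>. (\<Sum>s\<in>?S. cis (g * t * b s) * (restr (A s) w y * (cis (g * (t * u y)) * H m (x - t * v y)))))"
    proof (intro Bochner_Integration.integral_cong sum.cong refl)
      fix y s assume s: "s \<in> ?S"
      show "restr (A s) w y * cis (g * t * y) * H m (x - t * (y - a))
          = cis (g * t * b s) * (restr (A s) w y * (cis (g * (t * u y)) * H m (x - t * v y)))"
      proof (cases "y \<in> A s")
        case True
        have "y = b s + u y" using off[OF s True] by simp
        then have "g * t * y = g * t * b s + g * (t * u y)" by (metis distrib_left mult.assoc)
        then have "cis (g * t * y) = cis (g * t * b s) * cis (g * (t * u y))" by (simp add: cis_mult)
        then show ?thesis using off(2)[OF s True] by simp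
      qed (simp add: restr_def)
    qed
    also have "\<dots> = (\<Sum>s\<in>?S. cis (g * t * b s) * K x s t)"
      unfolding K_def integral_mult_right_zero[symmetric]
    proof (rule Bochner_Integration.integral_sum)
      fix s
      show "integrable \<mu> (\<lambda>y. cis (g * t * b s) * (restr (A s) w y * (cis (g * (t * u y)) * H m (x - t * v y))))"
      proof (rule integrable_bounded)
        fix y
        have "norm (restr (A s) w y) * norm (H m (x - t * v y)) \<le> 1 * B"
          by (intro mult_mono norm_restr_le w1 B) auto
        then show "norm (cis (g * t * b s) * (restr (A s) w y * (cis (g * (t * u y)) * H m (x - t * v y)))) \<le> B"
          by (simp add: norm_mult)
      qed measurable
    qed
    finally show ?thesis .
  qed
  have n1: "?o (cell j a) w m x t
      = norm (\<Sum>s\<in>?S. cis (2 * pi * \<kappa> * real s * t) * K x s t)" for x t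
  proof -
    have "cis (g * t * b s) = cis (g * t * a) * cis (2 * pi * \<kappa> * real s * t)" for s
    proof -
      have "g * t * b s = g * t * a + 2 * pi * \<kappa> * real s * t"
        unfolding g_def b_def child_def \<kappa>_def using NS(1) by (simp add: field_simps)
      then show ?thesis by (simp add: cis_mult)
    qed
    then have "osc \<mu> \<beta> (restr (cell j a) w) (H m) (x + t * a) t
        = cis (g * t * a) * (\<Sum>s\<in>?S. cis (2 * pi * \<kappa> * real s * t) * K x s t)"
      unfolding split sum_distrib_left by (simp add: mult.assoc)
    then show ?thesis by (simp add: norm_mult)
  qed
  have oA: "cis (g * t * b s) * (LINT y|\<mu>. restr (A s) w' y * (cis (g * (t * u y)) * h (x - t * v y)))
      = osc \<mu> \<beta> (restr (A s) w') h (x + t * a) t" if s: "s \<in> ?S" for x s t w' h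
    unfolding o integral_mult_right_zero[symmetric]
  proof (intro Bochner_Integration.integral_cong refl)
    fix y
    show "cis (g * t * b s) * (restr (A s) w' y * (cis (g * (t * u y)) * h (x - t * v y)))
        = restr (A s) w' y * cis (g * t * y) * h (x - t * (y - a))"
    proof (cases "y \<in> A s")
      case True
      have "y = b s + u y" using off[OF s True] by simp
      then have "g * t * y = g * t * b s + g * (t * u y)" by (metis distrib_left mult.assoc)
      then have "cis (g * t * y) = cis (g * t * b s) * cis (g * (t * u y))" by (simp add: cis_mult)
      then show ?thesis using off(2)[OF s True] by simp
    qed (simp add: restr_def)
  qed
  have n2: "norm (K x s t) = ?o (A s) w m x t" if s: "s \<in> ?S" for x s t
    unfolding K_def oA[OF s, symmetric] by (simp add: norm_mult)
  have n3: "norm (K' x s t) \<le> 2 * pi * \<bar>\<kappa>\<bar> * ?o (A s) w1 m x t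
      + 1 / real N ^ j * ?o (A s) w2 (Suc m) x t" if s: "s \<in> ?S" for x s t
  proof -
    let ?I1 = "LINT y|\<mu>. restr (A s) w1 y * (cis (g * (t * u y)) * H m (x - t * v y))"
    let ?I2 = "LINT y|\<mu>. restr (A s) w2 y * (cis (g * (t * u y)) * H (Suc m) (x - t * v y))"
    have nw: "norm (w1 y) \<le> 1" "norm (w2 y) \<le> 1" for y
      unfolding w1_def w2_def norm_mult using w1[of y] fr
      by (simp_all add: mult_le_one)
    have i1: "integrable \<mu> (\<lambda>y. restr (A s) w1 y * (cis (g * (t * u y)) * H m (x - t * v y)))"
    proof (rule integrable_bounded)
      fix y
      have "norm (restr (A s) w1 y) * norm (H m (x - t * v y)) \<le> 1 * B"
        by (intro mult_mono norm_restr_le nw B) auto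
      then show "norm (restr (A s) w1 y * (cis (g * (t * u y)) * H m (x - t * v y))) \<le> B"
        by (simp add: norm_mult)
    qed measurable
    have i2: "integrable \<mu> (\<lambda>y. restr (A s) w2 y * (cis (g * (t * u y)) * H (Suc m) (x - t * v y)))"
    proof (rule integrable_bounded)
      fix y
      have "norm (restr (A s) w2 y) * norm (H (Suc m) (x - t * v y)) \<le> 1 * B'"
        by (intro mult_mono norm_restr_le nw B') auto
      then show "norm (restr (A s) w2 y * (cis (g * (t * u y)) * H (Suc m) (x - t * v y))) \<le> B'"
        by (simp add: norm_mult)
    qed measurable
    have "K' x s t = (LINT y|\<mu>. (\<i> * g / real N ^ Suc j) * (restr (A s) w1 y * (cis (g * (t * u y)) * H m (x - t * v y)))
        - (1 / real N ^ j) * (restr (A s) w2 y * (cis (g * (t * u y)) * H (Suc m) (x - t * v y))))"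
      unfolding K'_def
    proof (intro Bochner_Integration.integral_cong refl)
      fix y
      have alg: "\<iota> * W * (\<i> * g' * (fu / r) * c * h - fv / q * c * h')
          = (\<i> * g' / r) * (\<iota> * (W * fu) * (c * h)) - (1 / q) * (\<iota> * (W * fv) * (c * h'))"
        for \<iota> W g' fu r c h fv q h' :: complex
        by (simp add: divide_inverse algebra_simps)
      have u': "complex_of_real (u y) = of_real (frac (real N ^ Suc j * y)) / of_real (real N ^ Suc j)"
        by (simp add: u_def del: power_Suc)
      have v': "complex_of_real (v y) = of_real (frac (real N ^ j * y)) / of_real (real N ^ j)"
        by (simp add: v_def)
      have one: "complex_of_real (1 / real N ^ j) = 1 / of_real (real N ^ j)" by simp
      show "restr (A s) w y * (\<i> * g * u y * cis (g * (t * u y)) * H m (x - t * v y)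
          - v y * cis (g * (t * u y)) * H (Suc m) (x - t * v y))
        = (\<i> * g / real N ^ Suc j) * (restr (A s) w1 y * (cis (g * (t * u y)) * H m (x - t * v y)))
        - (1 / real N ^ j) * (restr (A s) w2 y * (cis (g * (t * u y)) * H (Suc m) (x - t * v y)))"
        unfolding restr_def w1_def w2_def
        unfolding u' v' one by (rule alg)
    qed
    also have "\<dots> = (\<i> * g / real N ^ Suc j) * ?I1 - (1 / real N ^ j) * ?I2"
      using i1 i2 by simp
    finally have Keq: "K' x s t = (\<i> * g / real N ^ Suc j) * ?I1 - (1 / real N ^ j) * ?I2" .
    have "norm (K' x s t) \<le> norm ((\<i> * g / real N ^ Suc j) * ?I1) + norm ((1 / real N ^ j) * ?I2)"
      unfolding Keq by (rule norm_triangle_ineq4)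
    also have "\<dots> = \<bar>g\<bar> / real N ^ Suc j * norm ?I1 + 1 / real N ^ j * norm ?I2"
      by (simp add: norm_mult norm_divide norm_power del: power_Suc)
    also have "\<bar>g\<bar> / real N ^ Suc j = 2 * pi * \<bar>\<kappa>\<bar>"
      unfolding g_def \<kappa>_def using NS(1) by (simp add: abs_mult abs_divide del: power_Suc)
    also have "norm ?I1 = ?o (A s) w1 m x t"
      unfolding oA[OF s, symmetric] by (simp add: norm_mult)
    also have "norm ?I2 = ?o (A s) w2 (Suc m) x t"
      unfolding oA[OF s, symmetric] by (simp add: norm_mult)
    finally show ?thesis .
  qed
  have k1: "1 \<le> \<bar>\<kappa>\<bar>" using \<beta> NS(1) by (simp add: \<kappa>_def abs_divide le_divide_eq del: power_Suc)
  have pw: "norm (K x s t) powr p + \<bar>\<kappa>\<bar> powr - p * norm (K' x s t) powr p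
      \<le> ?o (A s) w m x t powr p
        + ?c1 * ?o (A s) w1 m x t powr p
        + ?c2 * ?o (A s) w2 (Suc m) x t powr p" if s: "s \<in> ?S" for x s t
  proof -
    let ?o1 = "?o (A s) w1 m x t"
    let ?o2 = "?o (A s) w2 (Suc m) x t"
    have "norm (K' x s t) powr p \<le> (2 * pi * \<bar>\<kappa>\<bar> * ?o1 + 1 / real N ^ j * ?o2) powr p"
      using n3[OF s] p by (intro powr_mono2) auto
    also have "\<dots> \<le> 2 powr p * ((2 * pi * \<bar>\<kappa>\<bar> * ?o1) powr p + (1 / real N ^ j * ?o2) powr p)"
      using p NS by (intro norm_add_powr_le) auto
    finally have "\<bar>\<kappa>\<bar> powr - p * norm (K' x s t) powr p
        \<le> \<bar>\<kappa>\<bar> powr - p * (2 powr p * ((2 * pi * \<bar>\<kappa>\<bar> * ?o1) powr p + (1 / real N ^ j * ?o2) powr p))"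
      by (intro mult_left_mono) auto
    also have "\<dots> = (inverse \<bar>\<kappa>\<bar> * (2 * (2 * pi * \<bar>\<kappa>\<bar> * ?o1))) powr p + (inverse \<bar>\<kappa>\<bar> * (2 * (1 / real N ^ j * ?o2))) powr p"
    proof -
      have "\<bar>\<kappa>\<bar> powr - p = inverse \<bar>\<kappa>\<bar> powr p" by (simp add: powr_minus inverse_powr)
      then show ?thesis using NS by (simp only: powr_mult distrib_left)
    qed
    also have "inverse \<bar>\<kappa>\<bar> * (2 * (2 * pi * \<bar>\<kappa>\<bar> * ?o1)) = (4 * pi) * ?o1" using k1 by (simp add: field_simps)
    also have "inverse \<bar>\<kappa>\<bar> * (2 * (1 / real N ^ j * ?o2)) = (2 * real N / \<bar>\<beta>\<bar>) * ?o2"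
      using NS by (simp add: \<kappa>_def abs_divide field_simps)
    finally have "\<bar>\<kappa>\<bar> powr - p * norm (K' x s t) powr p \<le> ?c1 * ?o1 powr p + ?c2 * ?o2 powr p"
      by (simp only: powr_mult)
    then show ?thesis using n2[OF s, of x t] by simp
  qed
  have inner: "?T (\<lambda>t. ?o (cell j a) w m x t)
    \<le> ennreal ?D * (\<Sum>s\<in>?S. ?T (\<lambda>t. ?o (A s) w m x t)
      + ennreal ?c1 * ?T (\<lambda>t. ?o (A s) w1 m x t)
      + ennreal ?c2 * ?T (\<lambda>t. ?o (A s) w2 (Suc m) x t))" for x
  proof -
    have "?T (\<lambda>t. ?o (cell j a) w m x t)
       \<le> ennreal (2 powr (2 * p + 1) * C powr p * real (card ?S) powr (p / 2 - 1)) *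
       (\<Sum>s\<in>?S. \<integral>\<^sup>+t\<in>{1..2}. ennreal (norm (K x s t) powr p + \<bar>\<kappa>\<bar> powr - p * norm (K' x s t) powr p) \<partial>lborel)"
      unfolding n1 using ftc(1) ftc(2,3)[OF order_refl] finite_digits[OF a] by (intro Lambda_step[OF Lam p C _ k1]) auto
    also have "\<dots> \<le> ennreal ?D * (\<Sum>s\<in>?S. \<integral>\<^sup>+t\<in>{1..2}. ennreal (?o (A s) w m x t powr p
        + ?c1 * ?o (A s) w1 m x t powr p
        + ?c2 * ?o (A s) w2 (Suc m) x t powr p) \<partial>lborel)"
      using digits[OF a] by (intro mult_mono sum_mono nn_integral_mono ennreal_leI mult_right_mono pw) auto
    also have "\<dots> = ennreal ?D * (\<Sum>s\<in>?S. ?T (\<lambda>t. ?o (A s) w m x t)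
      + ennreal ?c1 * ?T (\<lambda>t. ?o (A s) w1 m x t)
      + ennreal ?c2 * ?T (\<lambda>t. ?o (A s) w2 (Suc m) x t))"
      by (simp add: ennreal_mult distrib_right nn_integral_add nn_integral_cmult mult.assoc)
    finally show ?thesis .
  qed
  have "energy \<mu> p \<beta> (restr (cell j a) w) (H m) \<le> (\<integral>\<^sup>+x. ennreal ?D * (\<Sum>s\<in>?S. ?T (\<lambda>t. ?o (A s) w m x t)
      + ennreal ?c1 * ?T (\<lambda>t. ?o (A s) w1 m x t)
      + ennreal ?c2 * ?T (\<lambda>t. ?o (A s) w2 (Suc m) x t)) \<partial>lborel)"
    by (subst energy_shift[of _ _ _ _ a], measurable, intro nn_integral_mono inner)
  also have "\<dots> = ennreal ?D * (\<Sum>s\<in>?S. energy \<mu> p \<beta> (restr (A s) w) (H m)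
      + ennreal ?c1 * energy \<mu> p \<beta> (restr (A s) w1) (H m) + ennreal ?c2 * energy \<mu> p \<beta> (restr (A s) w2) (H (Suc m)))"
    by (simp add: nn_integral_add nn_integral_cmult nn_integral_sum energy_shift[of _ _ _ _ a])
  finally show ?thesis unfolding w1_def w2_def .
qed

lemma energy_restr_cell_0:
  assumes [measurable]: "w \<in> borel_measurable borel" "h \<in> borel_measurable borel"
  shows "energy \<mu> p \<beta> (restr (cell 0 1) w) h = energy \<mu> p \<beta> w h"
proof -
  have "osc \<mu> \<beta> (restr (cell 0 1) w) h x t = osc \<mu> \<beta> w h x t" for x t
    unfolding osc_def
  proof (rule integral_cong_AE)
    show "AE y in \<mu>. restr (cell 0 1) w y * cis (- (2 * pi * \<beta> * t * y)) * h (x - t * y)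
        = w y * cis (- (2 * pi * \<beta> * t * y)) * h (x - t * y)"
      using AE_cell[of 0] by eventually_elim (simp add: restr_def)
  qed measurable
  then show ?thesis by (simp add: energy_def)
qed

text \<open>
Going down one generation multiplies the total energy by the constant of \<open>energy_step\<close>, and
the terms with one more derivative of H cost a factor R, which the assumption on c compensates.  The
induction is therefore carried out for all weights w and all orders m simultaneously.
\<close>

lemma energy_iterate:
  fixes H :: "nat \<Rightarrow> real \<Rightarrow> complex"
  assumes p: "2 \<le> p" and C: "0 \<le> C"
    and Lam: "\<And>j a. a \<in> pts j \<Longrightarrow> Lambda_set p C (S (Suc j) a)"
    and der: "\<And>m x. (H m has_vector_derivative H (Suc m) x) (at x)"
    and bnd: "\<And>m. \<exists>B. \<forall>x. norm (H m x) \<le> B"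
    and R: "0 \<le> R" and Hb: "\<And>m. (\<integral>\<^sup>+x. ennreal (norm (H m x) powr p) \<partial>lborel) \<le> ennreal (R ^ m) * Q"
    and c: "0 \<le> c" and \<beta>: "k = 0 \<or> (real N ^ k \<le> \<bar>\<beta>\<bar> \<and> (2 * real N / \<bar>\<beta>\<bar>) powr p * R \<le> c)"
    and w[measurable]: "w \<in> borel_measurable borel" and w1: "\<And>y. norm (w y) \<le> 1"
  shows "energy \<mu> p \<beta> w (H m)
    \<le> ennreal ((2 powr (2 * p + 1) * C powr p * (1 + (4 * pi) powr p + c) * real N0 powr (p / 2 - 1)) ^ k
        * (real N0 ^ k * (5 / real N0 ^ k) powr p) * R ^ m) * Q"
proof -
  define D where "D = 2 powr (2 * p + 1) * C powr p * real N0 powr (p / 2 - 1)"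
  define c1 where "c1 = (4 * pi) powr p"
  define c2 where "c2 = (2 * real N / \<bar>\<beta>\<bar>) powr p"
  define G where "G = D * (1 + c1 + c)"
  define V where "V = real N0 ^ k * (5 / real N0 ^ k) powr p"
  have nn: "0 \<le> D" "0 \<le> c1" "0 \<le> c2" "0 \<le> G" "0 \<le> V"
    using c by (auto simp: D_def c1_def c2_def G_def V_def)
  note [measurable] = has_derivative_family_props(2)[of H, OF der]
  have claim: "(\<Sum>a\<in>pts (k - i). energy \<mu> p \<beta> (restr (cell (k - i) a) w) (H m)) \<le> ennreal (G ^ i * V * R ^ m) * Q"
    if "i \<le> k" "w \<in> borel_measurable borel" "\<And>y. norm (w y) \<le> 1" for i w m
    using that
  proof (induction i arbitrary: w m)
    case 0
    note [measurable] = 0(2)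
    have one: "energy \<mu> p \<beta> (restr (cell k a) w) (H m) \<le> ennreal ((5 / real N0 ^ k) powr p) * (ennreal (R ^ m) * Q)"
      if a: "a \<in> pts k" for a
    proof -
      have "energy \<mu> p \<beta> (restr (cell k a) w) (H m)
          \<le> ennreal (prob (cell k a) powr p) * (\<integral>\<^sup>+x. ennreal (norm (H m x) powr p) \<partial>lborel)"
        using p 0 by (intro energy_restr_le) auto
      also have "\<dots> \<le> ennreal ((5 / real N0 ^ k) powr p) * (ennreal (R ^ m) * Q)"
        using p measure_cell[OF a] by (intro mult_mono ennreal_leI powr_mono2 Hb) auto
      finally show ?thesis .
    qed
    have "(\<Sum>a\<in>pts k. energy \<mu> p \<beta> (restr (cell k a) w) (H m))
        \<le> of_nat (card (pts k)) * (ennreal ((5 / real N0 ^ k) powr p) * (ennreal (R ^ m) * Q))"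
      by (intro sum_bounded_above one)
    also have "\<dots> = ennreal (V * R ^ m) * Q"
      using R unfolding V_def
      by (simp add: card_pts ennreal_of_nat_eq_real_of_nat ennreal_mult mult.assoc)
    finally show ?case by simp
  next
    case (Suc i)
    note [measurable] = Suc.prems(2)
    define j where "j = k - Suc i"
    have j: "k - i = Suc j" "Suc j \<le> k" "k \<noteq> 0" using Suc.prems(1) by (auto simp: j_def)
    have \<beta>': "real N ^ Suc j \<le> \<bar>\<beta>\<bar>" "c2 * R \<le> c"
      using \<beta> j power_increasing[OF j(2), of "real N"] N unfolding c2_def by auto
    define w1 where "w1 y = w y * frac (real N ^ Suc j * y)" for y
    define w2 where "w2 y = w y * frac (real N ^ j * y)" for y
    have [measurable]: "w1 \<in> borel_measurable borel" "w2 \<in> borel_measurable borel"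
      unfolding w1_def w2_def frac_def by measurable
    have fr: "0 \<le> frac z" "frac z \<le> 1" for z :: real using frac_lt_1[of z] by auto
    have nw: "norm (w1 y) \<le> 1" "norm (w2 y) \<le> 1" for y
      unfolding w1_def w2_def norm_mult using Suc.prems(3)[of y] fr
      by (simp_all add: mult_le_one)
    define X where "X = G ^ i * V * R ^ m"
    have X: "0 \<le> X" using nn R by (simp add: X_def)
    let ?e = "\<lambda>w m b. energy \<mu> p \<beta> (restr (cell (Suc j) b) w) (H m)"
    have Y: "(\<Sum>b\<in>pts (Suc j). ?e w' m' b) \<le> ennreal (G ^ i * V * R ^ m') * Q"
      if "w' \<in> borel_measurable borel" "\<And>y. norm (w' y) \<le> 1" for w' m'
      using Suc.IH[of w' m'] that Suc.prems(1) j(1) by simp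
    have Y1: "(\<Sum>b\<in>pts (Suc j). ?e w m b) \<le> ennreal X * Q"
      "(\<Sum>b\<in>pts (Suc j). ?e w1 m b) \<le> ennreal X * Q"
      using Y[of w m] Y[of w1 m] nw Suc.prems(3) unfolding X_def by auto
    have Y2: "ennreal c2 * (\<Sum>b\<in>pts (Suc j). ?e w2 (Suc m) b) \<le> ennreal (c * X) * Q"
    proof -
      have "ennreal c2 * (\<Sum>b\<in>pts (Suc j). ?e w2 (Suc m) b) \<le> ennreal c2 * (ennreal (X * R) * Q)"
        using Y[of w2 "Suc m"] nw unfolding X_def by (intro mult_left_mono) (auto simp: mult_ac)
      also have "\<dots> = ennreal (c2 * (X * R)) * Q" using nn X R by (intro ennreal_mult_assoc) auto
      also have "\<dots> \<le> ennreal (c * X) * Q"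
      proof (intro mult_right_mono ennreal_leI)
        have "(c2 * R) * X \<le> c * X" using \<beta>'(2) X by (intro mult_right_mono)
        then show "c2 * (X * R) \<le> c * X" by (simp add: mult_ac)
      qed auto
      finally show ?thesis .
    qed
    have "(\<Sum>a\<in>pts j. energy \<mu> p \<beta> (restr (cell j a) w) (H m))
        \<le> (\<Sum>a\<in>pts j. ennreal D * (\<Sum>s\<in>S (Suc j) a. ?e w m (child j a s)
            + ennreal c1 * ?e w1 m (child j a s) + ennreal c2 * ?e w2 (Suc m) (child j a s)))"
      unfolding D_def c1_def c2_def w1_def w2_def
      by (rule sum_mono, rule energy_step[where H = H, OF p C _ Lam \<beta>'(1) der bnd Suc.prems(2,3)])
    also have "\<dots> = ennreal D * (\<Sum>b\<in>pts (Suc j). ?e w m b + ennreal c1 * ?e w1 m b + ennreal c2 * ?e w2 (Suc m) b)"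
      unfolding sum_pts_Suc sum_distrib_left ..
    also have "\<dots> = ennreal D * ((\<Sum>b\<in>pts (Suc j). ?e w m b) + ennreal c1 * (\<Sum>b\<in>pts (Suc j). ?e w1 m b)
        + ennreal c2 * (\<Sum>b\<in>pts (Suc j). ?e w2 (Suc m) b))"
      unfolding sum.distrib sum_distrib_left[symmetric] ..
    also have "\<dots> \<le> ennreal D * (ennreal X * Q + ennreal c1 * (ennreal X * Q) + ennreal (c * X) * Q)"
      by (intro mult_left_mono add_mono Y1 Y2) auto
    also have "\<dots> = ennreal D * (ennreal (X + c1 * X + c * X) * Q)"
      using X nn c by (simp add: distrib_right ennreal_mult_assoc)
    also have "\<dots> = ennreal (D * (X + c1 * X + c * X)) * Q"
      using X nn c by (intro ennreal_mult_assoc) auto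
    also have "D * (X + c1 * X + c * X) = G ^ Suc i * V * R ^ m"
      unfolding G_def X_def by (simp add: algebra_simps)
    finally show ?case by (simp add: j_def)
  qed
  have "energy \<mu> p \<beta> w (H m) \<le> ennreal (G ^ k * V * R ^ m) * Q"
    using claim[of k w m] w w1 by (simp add: energy_restr_cell_0)
  then show ?thesis unfolding G_def D_def V_def c1_def by (simp add: mult_ac)
qed

end

section \<open>Mixed norms\<close>

context cantor_system
begin

text \<open>
The weight that a t-derivative produces, normalised to have modulus at most 1; the
measure lives on [1,2).
\<close>

definition half_point :: "real \<Rightarrow> complex" where
  "half_point y = indicator {1..<2} y * of_real (y / 2)"

lemma half_point_weight: "half_point \<in> borel_measurable borel" "norm (half_point y) \<le> 1"
proof -
  show "half_point \<in> borel_measurable borel" unfolding half_point_def by measurable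
  show "norm (half_point y) \<le> 1" by (auto simp: half_point_def split: split_indicator)
qed

text \<open>
Sobolev embedding in t.  The p-th power of the supremum over t is at most b V x, where V collects the p-th powers of
the L^p norms in t of the function and of its derivative divided by b; interpolating
between the supremum and the L^p norm gives the factor b powr (1 - p / r).
\<close>

lemma mixed_norm_le:
  assumes p: "1 \<le> p" "p \<le> r" and b: "1 \<le> b" "\<bar>\<beta>\<bar> \<le> b"
    and der: "\<And>x. (h has_vector_derivative h' x) (at x)" and cont: "continuous_on UNIV h'"
    and h: "\<And>x. norm (h x) \<le> B" and h': "\<And>x. norm (h' x) \<le> B'"
  shows "(\<integral>\<^sup>+x. enn_powr (\<integral>\<^sup>+t\<in>{1..2}. ennreal (norm (osc \<mu> \<beta> (\<lambda>_. 1) h x t) powr r) \<partial>lborel) (p / r) \<partial>lborel)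
    \<le> ennreal (b powr (1 - p / r) * 2 powr p) * (energy \<mu> p \<beta> (\<lambda>_. 1) h
      + ennreal ((8 * pi) powr p) * energy \<mu> p \<beta> half_point h
      + ennreal ((4 / b) powr p) * energy \<mu> p \<beta> half_point h')"
proof -
  have contH: "continuous_on UNIV h"
    using der by (meson continuous_at_imp_continuous_on has_vector_derivative_continuous)
  note [measurable] = borel_measurable_continuous_onI[OF contH] borel_measurable_continuous_onI[OF cont] half_point_weight(1)
  define l where "l = 1 / b"
  have l: "0 < l" "l \<le> 1" using b by (auto simp: l_def)
  define g where "g = - (2 * pi * \<beta>)"
  define u where "u y = indicator {1..<2} y * y" for y :: real
  have [measurable]: "u \<in> borel_measurable borel" unfolding u_def by measurable
  have u2: "\<bar>u y\<bar> \<le> 2" for y by (auto simp: u_def split: split_indicator)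
  define K where "K x t = (LINT y|\<mu>. 1 * (cis (g * (t * u y)) * h (x - t * u y)))" for x t
  define K' where "K' x t = (LINT y|\<mu>. 1 * (\<i> * g * u y * cis (g * (t * u y)) * h (x - t * u y)
        - u y * cis (g * (t * u y)) * h' (x - t * u y)))" for x t
  have AEu: "AE y in \<mu>. u y = y \<and> half_point y = of_real (y / 2)"
    using AE_cell[of 0] by eventually_elim (auto simp: u_def half_point_def cell_def)
  have Ko: "osc \<mu> \<beta> (\<lambda>_. 1) h x t = K x t" for x t
    unfolding osc_def K_def
  proof (rule integral_cong_AE)
    show "AE y in \<mu>. 1 * cis (- (2 * pi * \<beta> * t * y)) * h (x - t * y) = 1 * (cis (g * (t * u y)) * h (x - t * u y))"
      using AEu by eventually_elim (auto simp: g_def mult_ac)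
  qed measurable
  have ftc: "set_integrable lborel {s..t} (K' x) \<and> K x t - K x s = (LINT t:{s..t}|lborel. K' x t)"
    "K x \<in> borel_measurable borel" "K' x \<in> borel_measurable borel" if "s \<le> t" for x s t
  proof -
    have m: "(\<lambda>_. 1 :: complex) \<in> borel_measurable borel" "u \<in> borel_measurable borel" by measurable
    have K: "K x = (\<lambda>t. LINT y|\<mu>. 1 * (cis (g * (t * u y)) * h (x - t * u y)))"
      "K' x = (\<lambda>t. LINT y|\<mu>. 1 * (\<i> * g * u y * cis (g * (t * u y)) * h (x - t * u y)
        - u y * cis (g * (t * u y)) * h' (x - t * u y)))"
      by (simp_all add: K_def K'_def fun_eq_iff)
    note * = FTC_osc[where g = g and x = x, OF m(1) m(2) m(2) _ u2 u2 der cont h h' that]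
    show "set_integrable lborel {s..t} (K' x) \<and> K x t - K x s = (LINT t:{s..t}|lborel. K' x t)"
      using *(1) by (simp only: K norm_one order_refl)
    show "K x \<in> borel_measurable borel" using *(2) by (simp only: K norm_one order_refl)
    show "K' x \<in> borel_measurable borel" using *(3) by (simp only: K norm_one order_refl)
  qed
  have K'le: "norm (K' x t) \<le> 4 * pi * b * norm (osc \<mu> \<beta> half_point h x t) + 2 * norm (osc \<mu> \<beta> half_point h' x t)" for x t
  proof -
    have int: "integrable \<mu> (\<lambda>y. half_point y * cis (- (2 * pi * \<beta> * t * y)) * k (x - t * y))"
      if [measurable]: "k \<in> borel_measurable borel" and k: "\<And>x. norm (k x) \<le> Q" for k Q
    proof (rule integrable_bounded)
      fix y
      have "norm (half_point y) * norm (k (x - t * y)) \<le> 1 * Q"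
        by (intro mult_mono half_point_weight k) auto
      then show "norm (half_point y * cis (- (2 * pi * \<beta> * t * y)) * k (x - t * y)) \<le> Q"
        by (simp add: norm_mult)
    qed measurable
    have "K' x t = (LINT y|\<mu>. 2 * \<i> * g * (half_point y * cis (- (2 * pi * \<beta> * t * y)) * h (x - t * y))
        - 2 * (half_point y * cis (- (2 * pi * \<beta> * t * y)) * h' (x - t * y)))"
      unfolding K'_def
    proof (rule integral_cong_AE)
      show "AE y in \<mu>. 1 * (\<i> * g * u y * cis (g * (t * u y)) * h (x - t * u y)
          - u y * cis (g * (t * u y)) * h' (x - t * u y))
        = 2 * \<i> * g * (half_point y * cis (- (2 * pi * \<beta> * t * y)) * h (x - t * y))
          - 2 * (half_point y * cis (- (2 * pi * \<beta> * t * y)) * h' (x - t * y))"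
        using AEu
      proof eventually_elim
        case (elim y)
        then have 1: "u y = y" and 2: "complex_of_real y = half_point y * 2" by auto
        have 3: "- (2 * pi * \<beta> * t * y) = g * (t * y)" by (simp add: g_def)
        show ?case unfolding 1 2 3 by (simp add: algebra_simps)
      qed
    qed measurable
    also have "\<dots> = 2 * \<i> * g * osc \<mu> \<beta> half_point h x t - 2 * osc \<mu> \<beta> half_point h' x t"
      unfolding osc_def by (subst Bochner_Integration.integral_diff)
        (auto intro!: integrable_mult_right int[OF _ h] int[OF _ h'])
    finally have eq: "K' x t = 2 * \<i> * g * osc \<mu> \<beta> half_point h x t - 2 * osc \<mu> \<beta> half_point h' x t" .
    have "norm (K' x t) \<le> norm (2 * \<i> * g * osc \<mu> \<beta> half_point h x t) + norm (2 * osc \<mu> \<beta> half_point h' x t)"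
      unfolding eq by (rule norm_triangle_ineq4)
    also have "\<dots> = 2 * \<bar>g\<bar> * norm (osc \<mu> \<beta> half_point h x t) + 2 * norm (osc \<mu> \<beta> half_point h' x t)"
      by (simp add: norm_mult)
    also have "\<dots> \<le> 4 * pi * b * norm (osc \<mu> \<beta> half_point h x t) + 2 * norm (osc \<mu> \<beta> half_point h' x t)"
      using b by (intro add_right_mono mult_right_mono) (auto simp: g_def abs_mult)
    finally show ?thesis .
  qed
  define U where "U w k x = (\<integral>\<^sup>+t\<in>{1..2}. ennreal (norm (osc \<mu> \<beta> w k x t) powr p) \<partial>lborel)" for w k x
  have [measurable]: "U w k \<in> borel_measurable borel"
    if [measurable]: "w \<in> borel_measurable borel" "k \<in> borel_measurable borel" for w k
    unfolding U_def by measurable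
  have enU: "(\<integral>\<^sup>+x. U w k x \<partial>lborel) = energy \<mu> p \<beta> w k"
    if "w \<in> borel_measurable borel" "k \<in> borel_measurable borel" for w k
    unfolding U_def using energy_shift[OF that, of p \<beta> 0] by simp
  define V where "V x = ennreal (2 powr p) * (U (\<lambda>_. 1) h x
      + ennreal ((8 * pi) powr p) * U half_point h x + ennreal ((4 / b) powr p) * U half_point h' x)" for x
  have dU: "ennreal (l powr p) * (\<integral>\<^sup>+t\<in>{1..2}. ennreal (norm (K' x t) powr p) \<partial>lborel)
      \<le> ennreal ((8 * pi) powr p) * U half_point h x + ennreal ((4 / b) powr p) * U half_point h' x" for x
  proof -
    have pt: "l powr p * norm (K' x t) powr p
      \<le> (8 * pi) powr p * norm (osc \<mu> \<beta> half_point h x t) powr p + (4 / b) powr p * norm (osc \<mu> \<beta> half_point h' x t) powr p" for t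
    proof -
      let ?A = "4 * pi * b * norm (osc \<mu> \<beta> half_point h x t)" and ?B = "2 * norm (osc \<mu> \<beta> half_point h' x t)"
      have "norm (K' x t) powr p \<le> (?A + ?B) powr p" using K'le p by (intro powr_mono2) auto
      also have "\<dots> \<le> 2 powr p * (?A powr p + ?B powr p)" using p b by (intro norm_add_powr_le) auto
      finally have "l powr p * norm (K' x t) powr p \<le> l powr p * (2 powr p * (?A powr p + ?B powr p))"
        by (intro mult_left_mono) auto
      also have "\<dots> = (l * (2 * ?A)) powr p + (l * (2 * ?B)) powr p" by (simp only: powr_mult distrib_left)
      also have "l * (2 * ?A) = (8 * pi) * norm (osc \<mu> \<beta> half_point h x t)" using b by (simp add: l_def)
      also have "l * (2 * ?B) = (4 / b) * norm (osc \<mu> \<beta> half_point h' x t)" by (simp add: l_def)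
      finally show ?thesis by (simp only: powr_mult)
    qed
    note [measurable] = ftc(3)[OF order_refl, of x]
    have "ennreal (l powr p) * (\<integral>\<^sup>+t\<in>{1..2}. ennreal (norm (K' x t) powr p) \<partial>lborel)
        = (\<integral>\<^sup>+t\<in>{1..2}. ennreal (l powr p * norm (K' x t) powr p) \<partial>lborel)"
      by (simp add: nn_integral_cmult[symmetric] ennreal_mult mult.assoc)
    also have "\<dots> \<le> (\<integral>\<^sup>+t\<in>{1..2}. ennreal ((8 * pi) powr p * norm (osc \<mu> \<beta> half_point h x t) powr p
        + (4 / b) powr p * norm (osc \<mu> \<beta> half_point h' x t) powr p) \<partial>lborel)"
      by (intro nn_integral_mono mult_right_mono ennreal_leI pt) auto
    also have "\<dots> = ennreal ((8 * pi) powr p) * U half_point h x + ennreal ((4 / b) powr p) * U half_point h' x"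
      unfolding U_def by (simp add: ennreal_mult distrib_right nn_integral_add nn_integral_cmult mult.assoc)
    finally show ?thesis .
  qed
  have sup: "ennreal (l * norm (osc \<mu> \<beta> (\<lambda>_. 1) h x t) powr p) \<le> V x" if t: "t \<in> {1..2}" for x t
  proof -
    obtain a where a: "1 \<le> a" "a + l \<le> 2" "t \<in> {a..a + l}"
    proof (cases "t + l \<le> 2")
      case True then show ?thesis using t l by (intro that[of t]) auto
    next
      case False then show ?thesis using t l by (intro that[of "2 - l"]) auto
    qed
    have "ennreal (l * norm (K x t) powr p) \<le> ennreal (2 powr p) *
      ((\<integral>\<^sup>+v\<in>{a..a + l}. ennreal (norm (K x v) powr p) \<partial>lborel)
       + ennreal (l powr p) * (\<integral>\<^sup>+v\<in>{a..a + l}. ennreal (norm (K' x v) powr p) \<partial>lborel))"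
      using ftc(1) ftc(2,3)[OF order_refl] by (intro sobolev_interval l p a) auto
    also have "\<dots> \<le> ennreal (2 powr p) * (U (\<lambda>_. 1) h x
       + ennreal (l powr p) * (\<integral>\<^sup>+v\<in>{1..2}. ennreal (norm (K' x v) powr p) \<partial>lborel))"
      unfolding U_def Ko using a
      by (intro mult_left_mono add_mono nn_integral_mono) (auto split: split_indicator)
    also have "\<dots> \<le> V x"
      unfolding V_def add.assoc by (intro mult_left_mono add_left_mono dU) auto
    finally show ?thesis unfolding Ko .
  qed
  have UV: "U (\<lambda>_. 1) h x \<le> V x" for x
  proof -
    have "1 \<le> 2 powr p" using p by (simp add: ge_one_powr_ge_zero)
    then have "ennreal 1 * U (\<lambda>_. 1) h x \<le> ennreal (2 powr p) * U (\<lambda>_. 1) h x"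
      by (intro mult_right_mono ennreal_leI) auto
    also have "\<dots> \<le> V x" unfolding V_def add.assoc by (intro mult_left_mono) (auto simp: add_increasing2)
    finally show ?thesis by simp
  qed
  have main: "enn_powr (\<integral>\<^sup>+t\<in>{1..2}. ennreal (norm (osc \<mu> \<beta> (\<lambda>_. 1) h x t) powr r) \<partial>lborel) (p / r)
      \<le> ennreal (b powr (1 - p / r)) * V x" for x
  proof (cases "V x")
    case top
    then show ?thesis using b by (simp add: ennreal_mult_top)
  next
    case (real v)
    have pt: "norm (osc \<mu> \<beta> (\<lambda>_. 1) h x t) powr r \<le> (b * v) powr ((r - p) / p) * norm (osc \<mu> \<beta> (\<lambda>_. 1) h x t) powr p"
      if t: "t \<in> {1..2}" for t
    proof -
      let ?n = "norm (osc \<mu> \<beta> (\<lambda>_. 1) h x t)"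
      have "l * ?n powr p \<le> v" using sup[OF t, of x] real by simp
      then have "?n powr p \<le> b * v" using b by (simp add: l_def field_simps)
      then have "(?n powr p) powr ((r - p) / p) \<le> (b * v) powr ((r - p) / p)" using p by (intro powr_mono2) auto
      then have "?n powr (r - p) \<le> (b * v) powr ((r - p) / p)" using p by (simp add: powr_powr)
      then have "?n powr (r - p) * ?n powr p \<le> (b * v) powr ((r - p) / p) * ?n powr p" by (intro mult_right_mono) auto
      then show ?thesis by (simp add: powr_add[symmetric])
    qed
    have "(\<integral>\<^sup>+t\<in>{1..2}. ennreal (norm (osc \<mu> \<beta> (\<lambda>_. 1) h x t) powr r) \<partial>lborel)
        \<le> (\<integral>\<^sup>+t. ennreal ((b * v) powr ((r - p) / p)) * (ennreal (norm (osc \<mu> \<beta> (\<lambda>_. 1) h x t) powr p) * indicator {1..2} t) \<partial>lborel)"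
      using pt by (intro nn_integral_mono) (auto simp: ennreal_mult[symmetric] intro!: ennreal_leI split: split_indicator)
    also have "\<dots> = ennreal ((b * v) powr ((r - p) / p)) * U (\<lambda>_. 1) h x"
      unfolding U_def by (rule nn_integral_cmult) measurable
    also have "\<dots> \<le> ennreal ((b * v) powr ((r - p) / p)) * ennreal v"
      using UV[of x] real by (intro mult_left_mono) auto
    also have "\<dots> = ennreal ((b * v) powr ((r - p) / p) * v)" using real by (simp add: ennreal_mult)
    finally have "enn_powr (\<integral>\<^sup>+t\<in>{1..2}. ennreal (norm (osc \<mu> \<beta> (\<lambda>_. 1) h x t) powr r) \<partial>lborel) (p / r)
        \<le> enn_powr (ennreal ((b * v) powr ((r - p) / p) * v)) (p / r)"
      using p by (intro enn_powr_mono) auto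
    also have "\<dots> = ennreal (((b * v) powr ((r - p) / p) * v) powr (p / r))"
      using real by (simp add: enn_powr_ennreal)
    also have "((b * v) powr ((r - p) / p) * v) powr (p / r) = b powr (1 - p / r) * v"
    proof (cases "v = 0")
      case False
      then have v: "0 < v" using real by simp
      have e: "(r - p) / p * (p / r) = 1 - p / r" using p by (simp add: field_simps)
      have "((b * v) powr ((r - p) / p) * v) powr (p / r) = (b * v) powr (1 - p / r) * v powr (p / r)"
        unfolding powr_mult powr_powr e ..
      also have "\<dots> = b powr (1 - p / r) * (v powr (1 - p / r) * v powr (p / r))"
        by (simp add: powr_mult)
      also have "v powr (1 - p / r) * v powr (p / r) = v" using v by (simp add: powr_add[symmetric])
      finally show ?thesis .
    qed (use p in auto)
    finally show ?thesis using real b by (simp add: ennreal_mult)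
  qed
  have "(\<integral>\<^sup>+x. enn_powr (\<integral>\<^sup>+t\<in>{1..2}. ennreal (norm (osc \<mu> \<beta> (\<lambda>_. 1) h x t) powr r) \<partial>lborel) (p / r) \<partial>lborel)
      \<le> (\<integral>\<^sup>+x. ennreal (b powr (1 - p / r)) * V x \<partial>lborel)"
    by (intro nn_integral_mono main)
  also have "\<dots> = ennreal (b powr (1 - p / r)) * (ennreal (2 powr p) * (energy \<mu> p \<beta> (\<lambda>_. 1) h
      + ennreal ((8 * pi) powr p) * energy \<mu> p \<beta> half_point h
      + ennreal ((4 / b) powr p) * energy \<mu> p \<beta> half_point h'))"
    unfolding V_def by (simp add: nn_integral_cmult nn_integral_add enU)
  finally show ?thesis by (simp add: ennreal_mult mult.assoc)
qed

end

section \<open>Frequency windows\<close>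

definition ramp :: "real \<Rightarrow> real \<Rightarrow> real \<Rightarrow> real" where
  "ramp a b \<xi> = max 0 (min 1 ((\<xi> - a) / (b - a)))"

text \<open>
A difference of two ramps is a tent with vertex b and feet a and c.  Written like this, tents on
consecutive grid points telescope.
\<close>

definition tent :: "real \<Rightarrow> real \<Rightarrow> real \<Rightarrow> real \<Rightarrow> real" where
  "tent a b c \<xi> = ramp a b \<xi> - ramp b c \<xi>"

definition bessel_weight :: "real \<Rightarrow> real \<Rightarrow> real" where
  "bessel_weight g \<xi> = (1 + \<xi>\<^sup>2) powr (g / 2)"

lemma ramp_simps:
  assumes "a < b"
  shows "\<xi> \<le> a \<Longrightarrow> ramp a b \<xi> = 0" "b \<le> \<xi> \<Longrightarrow> ramp a b \<xi> = 1"
    "a \<le> \<xi> \<Longrightarrow> \<xi> \<le> b \<Longrightarrow> ramp a b \<xi> = (\<xi> - a) / (b - a)"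
  using assms by (auto simp: ramp_def field_simps max_def min_def)

lemma tent_simps:
  assumes "a < b" "b < c"
  shows "\<xi> \<le> a \<Longrightarrow> tent a b c \<xi> = 0" "c \<le> \<xi> \<Longrightarrow> tent a b c \<xi> = 0"
    "a \<le> \<xi> \<Longrightarrow> \<xi> \<le> b \<Longrightarrow> tent a b c \<xi> = (\<xi> - a) / (b - a)"
    "b \<le> \<xi> \<Longrightarrow> \<xi> \<le> c \<Longrightarrow> tent a b c \<xi> = (c - \<xi>) / (c - b)"
  using assms by (auto simp: tent_def ramp_simps field_simps)

lemma tent_bounds:
  assumes "a < b" "b < c"
  shows "0 \<le> tent a b c \<xi>" "tent a b c \<xi> \<le> 1"
proof -
  consider "\<xi> \<le> a" | "a \<le> \<xi>" "\<xi> \<le> b" | "b \<le> \<xi>" "\<xi> \<le> c" | "c \<le> \<xi>" by linarith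
  then have "0 \<le> tent a b c \<xi> \<and> tent a b c \<xi> \<le> 1"
    by cases (use assms in \<open>auto simp: tent_simps divide_le_eq\<close>)
  then show "0 \<le> tent a b c \<xi>" "tent a b c \<xi> \<le> 1" by auto
qed

lemma continuous_tent [continuous_intros]: "continuous_on S f \<Longrightarrow> continuous_on S (\<lambda>x. tent a b c (f x))"
  unfolding tent_def ramp_def divide_inverse by (intro continuous_intros)

lemma measurable_tent [measurable (raw)]:
  assumes [measurable]: "f \<in> borel_measurable M"
  shows "(\<lambda>x. tent a b c (f x)) \<in> borel_measurable M"
  unfolding tent_def ramp_def by measurable

lemma tent_shift: "tent (a + d) (b + d) (c + d) (\<xi> + d) = tent a b c \<xi>"
  by (simp add: tent_def ramp_def)

lemma tent_minus:
  assumes "a < b" "b < c" shows "tent a b c (- \<xi>) = tent (- c) (- b) (- a) \<xi>"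
proof -
  consider "-\<xi> \<le> a" | "a \<le> -\<xi>" "-\<xi> \<le> b" | "b \<le> -\<xi>" "-\<xi> \<le> c" | "c \<le> -\<xi>" by linarith
  then show ?thesis
    by cases (use assms in \<open>auto simp: tent_simps tent_simps[of "-c" "-b" "-a"] field_simps\<close>)
qed

lemma bessel_weight_pos: "0 < bessel_weight g \<xi>"
  by (simp add: bessel_weight_def) (use zero_le_power2[of \<xi>] in linarith)

lemma bessel_weight_derivative:
  "(bessel_weight g has_real_derivative g * \<xi> * (1 + \<xi>\<^sup>2) powr (g / 2 - 1)) (at \<xi>)"
proof -
  have p: "0 < 1 + \<xi>\<^sup>2" by (simp add: add_pos_nonneg)
  have "((\<lambda>\<xi>. (1 + \<xi>\<^sup>2) powr (g / 2)) has_real_derivative (g / 2) * (1 + \<xi>\<^sup>2) powr (g / 2 - 1) * (2 * \<xi>)) (at \<xi>)"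
    using DERIV_fun_powr[where g = "\<lambda>x. 1 + x\<^sup>2" and x = \<xi> and m = "2 * \<xi>" and r = "g / 2"] p by (auto intro!: derivative_eq_intros)
  then show ?thesis by (simp add: bessel_weight_def[abs_def] mult_ac)
qed

lemma bessel_weight_derivative2:
  "((\<lambda>\<xi>. g * \<xi> * (1 + \<xi>\<^sup>2) powr (g / 2 - 1)) has_real_derivative
     g * (1 + \<xi>\<^sup>2) powr (g / 2 - 1) + g * (g - 2) * \<xi>\<^sup>2 * (1 + \<xi>\<^sup>2) powr (g / 2 - 2)) (at \<xi>)"
proof -
  have p: "0 < 1 + \<xi>\<^sup>2" by (simp add: add_pos_nonneg)
  have "((\<lambda>\<xi>. (1 + \<xi>\<^sup>2) powr (g / 2 - 1)) has_real_derivative (g / 2 - 1) * (1 + \<xi>\<^sup>2) powr (g / 2 - 1 - 1) * (2 * \<xi>)) (at \<xi>)"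
    using DERIV_fun_powr[where g = "\<lambda>x. 1 + x\<^sup>2" and x = \<xi> and m = "2 * \<xi>" and r = "g / 2 - 1"] p by (auto intro!: derivative_eq_intros)
  from DERIV_mult[OF DERIV_cmult_Id[of g] this]
  show ?thesis by (rule DERIV_cong) (simp add: power2_eq_square field_simps)
qed

text \<open>
The weight satisfies symbol estimates: each derivative gains the inverse of sqrt (1 + \<xi>^2), which is
comparable to 1 / b, hence at most 2 / \<rho>.
\<close>

lemma bessel_weight_bounds:
  fixes g b \<xi> \<rho> :: real
  assumes lo: "b\<^sup>2 / 4 \<le> 1 + \<xi>\<^sup>2" and hi: "1 + \<xi>\<^sup>2 \<le> 5 * b\<^sup>2" and \<rho>: "0 < \<rho>" "\<rho> \<le> b"
  defines "W \<equiv> 5 powr (\<bar>g\<bar> / 2) * b powr g"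
  shows "bessel_weight g \<xi> \<le> W"
    and "\<bar>g * \<xi> * (1 + \<xi>\<^sup>2) powr (g / 2 - 1)\<bar> \<le> 2 * \<bar>g\<bar> * W / \<rho>"
    and "\<bar>g * (1 + \<xi>\<^sup>2) powr (g / 2 - 1) + g * (g - 2) * \<xi>\<^sup>2 * (1 + \<xi>\<^sup>2) powr (g / 2 - 2)\<bar>
      \<le> 4 * (\<bar>g\<bar> + \<bar>g * (g - 2)\<bar>) * W / \<rho>\<^sup>2"
proof -
  let ?w = "1 + \<xi>\<^sup>2"
  have w: "0 < ?w" by (simp add: add_pos_nonneg)
  have b: "0 < b" using \<rho> by linarith
  show W: "bessel_weight g \<xi> \<le> W"
  proof (cases "0 \<le> g")
    case True
    have "?w powr (g / 2) \<le> (5 * b\<^sup>2) powr (g / 2)" using True hi w by (intro powr_mono2) auto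
    also have "\<dots> = W" using True b unfolding W_def
      by (simp add: powr_mult powr_powr flip: powr_numeral)
    finally show ?thesis by (simp add: bessel_weight_def)
  next
    case False
    have "?w powr (g / 2) \<le> (b\<^sup>2 / 4) powr (g / 2)" using False lo b by (intro powr_mono2') auto
    also have "\<dots> = 4 powr (- (g / 2)) * b powr g" using b
      by (simp add: powr_divide powr_powr powr_minus divide_simps flip: powr_numeral)
    also have "\<dots> \<le> 5 powr (- (g / 2)) * b powr g" using False by (intro mult_right_mono powr_mono2) auto
    also have "\<dots> = W" unfolding W_def using False by simp
    finally show ?thesis by (simp add: bessel_weight_def)
  qed
  have W0: "0 \<le> W" by (simp add: W_def)
  have e1: "?w powr (g / 2 - 1) = bessel_weight g \<xi> / ?w"
    unfolding bessel_weight_def using w by (simp add: powr_diff)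
  have e2: "?w powr (g / 2 - 2) = bessel_weight g \<xi> / ?w\<^sup>2"
    unfolding bessel_weight_def using w by (simp add: powr_diff)
  have s0: "0 \<le> bessel_weight g \<xi>" using bessel_weight_pos less_imp_le by blast
  have inv: "1 / ?w \<le> 4 / \<rho>\<^sup>2"
  proof -
    have "\<rho>\<^sup>2 \<le> b\<^sup>2" using \<rho> by (intro power_mono) auto
    then have "\<rho>\<^sup>2 \<le> 4 * ?w" using lo by simp
    then show ?thesis using \<rho> w by (simp add: field_simps)
  qed
  have inv1: "\<bar>\<xi>\<bar> / ?w \<le> 2 / \<rho>"
  proof -
    have "(\<bar>\<xi>\<bar> / ?w)\<^sup>2 = \<xi>\<^sup>2 / ?w * (1 / ?w)"
      by (simp add: power_divide power2_eq_square)
    also have "\<dots> \<le> 1 * (1 / ?w)" using w by (intro mult_right_mono) auto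
    finally have "(\<bar>\<xi>\<bar> / ?w)\<^sup>2 \<le> 1 / ?w" by simp
    also have "\<dots> \<le> (2 / \<rho>)\<^sup>2" using inv by (simp add: power_divide)
    finally have "(\<bar>\<xi>\<bar> / ?w)\<^sup>2 \<le> (2 / \<rho>)\<^sup>2" .
    then show ?thesis by (rule power2_le_imp_le) (use \<rho> in auto)
  qed
  have "\<bar>g * \<xi> * ?w powr (g / 2 - 1)\<bar> = \<bar>g\<bar> * (bessel_weight g \<xi> * (\<bar>\<xi>\<bar> / ?w))"
    unfolding e1 using w s0 by (simp add: abs_mult)
  also have "\<dots> \<le> \<bar>g\<bar> * (W * (2 / \<rho>))"
    using W inv1 s0 W0 w by (intro mult_left_mono mult_mono) auto
  finally show "\<bar>g * \<xi> * ?w powr (g / 2 - 1)\<bar> \<le> 2 * \<bar>g\<bar> * W / \<rho>" by (simp add: mult_ac)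
  have q: "\<xi>\<^sup>2 / ?w \<le> 1" "0 \<le> \<xi>\<^sup>2 / ?w" using w by simp_all
  have "\<bar>g * ?w powr (g / 2 - 1) + g * (g - 2) * \<xi>\<^sup>2 * ?w powr (g / 2 - 2)\<bar>
      \<le> \<bar>g * ?w powr (g / 2 - 1)\<bar> + \<bar>g * (g - 2) * \<xi>\<^sup>2 * ?w powr (g / 2 - 2)\<bar>"
    by (rule abs_triangle_ineq)
  also have "\<dots> = (\<bar>g\<bar> + \<bar>g * (g - 2)\<bar> * (\<xi>\<^sup>2 / ?w)) * (bessel_weight g \<xi> * (1 / ?w))"
  proof -
    have "g * (g - 2) * \<xi>\<^sup>2 * (bessel_weight g \<xi> / ?w\<^sup>2) = (g * (g - 2)) * (\<xi>\<^sup>2 / ?w * (bessel_weight g \<xi> * (1 / ?w)))"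
      by (simp add: power2_eq_square)
    moreover have "\<bar>(g * (g - 2)) * (\<xi>\<^sup>2 / ?w * (bessel_weight g \<xi> * (1 / ?w)))\<bar>
        = \<bar>g * (g - 2)\<bar> * (\<xi>\<^sup>2 / ?w * (bessel_weight g \<xi> * (1 / ?w)))"
      unfolding abs_mult[of "g * (g - 2)"] using w s0 by simp
    moreover have "\<bar>g * (bessel_weight g \<xi> / ?w)\<bar> = \<bar>g\<bar> * (bessel_weight g \<xi> * (1 / ?w))"
      unfolding abs_mult[of g] using w s0 by simp
    ultimately show ?thesis unfolding e1 e2 by (simp only: distrib_right mult.assoc)
  qed
  also have "\<dots> \<le> (\<bar>g\<bar> + \<bar>g * (g - 2)\<bar> * 1) * (W * (4 / \<rho>\<^sup>2))"
    using q W inv s0 W0 w by (intro mult_mono add_left_mono mult_left_mono) auto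
  finally show "\<bar>g * ?w powr (g / 2 - 1) + g * (g - 2) * \<xi>\<^sup>2 * ?w powr (g / 2 - 2)\<bar>
      \<le> 4 * (\<bar>g\<bar> + \<bar>g * (g - 2)\<bar>) * W / \<rho>\<^sup>2" by (simp add: mult_ac)
qed

subsection \<open>Kernel bounds\<close>

lemma cis_has_vector_derivative:
  "((\<lambda>\<eta>. cis (k * \<eta>)) has_vector_derivative \<i> * k * cis (k * \<eta>)) (at \<eta> within S)"
proof -
  have "((\<lambda>t. iexp t) \<circ> (\<lambda>t. k * t) has_vector_derivative k *\<^sub>R (\<i> * iexp (k * \<eta>))) (at \<eta> within S)"
    by (rule vector_diff_chain_within) (auto intro!: derivative_eq_intros)
  then show ?thesis by (simp add: o_def cis_conv_exp scaleR_conv_of_real mult_ac)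
qed

lemma continuous_on_cis_mult [continuous_intros]: "continuous_on S f \<Longrightarrow> continuous_on S (\<lambda>x. cis (f x))"
  unfolding cis_conv_exp by (intro continuous_intros)

text \<open>
The function cis (k x) (i k Q - Q1) is a primitive of cis (k x) ((i k)^2 Q - Q2).  This form
needs no division and so includes k = 0.
\<close>

lemma integration_by_parts_twice:
  fixes Q Q1 Q2 :: "real \<Rightarrow> complex"
  assumes ab: "a \<le> b"
    and d1: "\<And>x. (Q has_vector_derivative Q1 x) (at x)"
    and d2: "\<And>x. (Q1 has_vector_derivative Q2 x) (at x)"
    and c: "continuous_on UNIV Q2"
  shows "(\<i> * k)\<^sup>2 * (LINT x|lborel. indicator {a..b} x *\<^sub>R (cis (k * x) * Q x))
    = cis (k * b) * (\<i> * k * Q b - Q1 b) - cis (k * a) * (\<i> * k * Q a - Q1 a)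
      + (LINT x|lborel. indicator {a..b} x *\<^sub>R (cis (k * x) * Q2 x))"
proof -
  have cQ: "continuous_on S Q" "continuous_on S Q1" "continuous_on S Q2" for S
    using d1 d2 c by (auto intro: continuous_on_subset
        continuous_at_imp_continuous_on has_vector_derivative_continuous)
  have int: "integrable lborel (\<lambda>x. indicator {a..b} x *\<^sub>R (cis (k * x) * F x))"
    if "continuous_on {a..b} F" for F :: "real \<Rightarrow> complex"
    using that by (intro borel_integrable_compact continuous_intros) auto
  have 1: "(LINT x|lborel. indicator {a..b} x *\<^sub>R (cis (k * x) * ((\<i> * k)\<^sup>2 * Q x - Q2 x)))
      = cis (k * b) * (\<i> * k * Q b - Q1 b) - cis (k * a) * (\<i> * k * Q a - Q1 a)"
  proof (rule integral_FTC_Icc[OF ab])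
    fix x
    have "((\<lambda>x. cis (k * x) * (\<i> * k * Q x - Q1 x)) has_vector_derivative
        cis (k * x) * (\<i> * k * Q1 x - Q2 x) + (\<i> * k * cis (k * x)) * (\<i> * k * Q x - Q1 x)) (at x within {a..b})"
      by (intro has_vector_derivative_mult cis_has_vector_derivative has_vector_derivative_diff
          has_vector_derivative_mult_right has_vector_derivative_at_within[OF d1] has_vector_derivative_at_within[OF d2])
    then show "((\<lambda>x. cis (k * x) * (\<i> * k * Q x - Q1 x)) has_vector_derivative
        cis (k * x) * ((\<i> * k)\<^sup>2 * Q x - Q2 x)) (at x within {a..b})"
      by (rule has_vector_derivative_eq_rhs) (simp add: algebra_simps power2_eq_square)
  qed (intro continuous_intros cQ)
  have 2: "(LINT x|lborel. indicator {a..b} x *\<^sub>R (cis (k * x) * ((\<i> * k)\<^sup>2 * Q x - Q2 x)))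
      = (LINT x|lborel. (\<i> * k)\<^sup>2 * (indicator {a..b} x *\<^sub>R (cis (k * x) * Q x)) - indicator {a..b} x *\<^sub>R (cis (k * x) * Q2 x))"
    by (intro Bochner_Integration.integral_cong) (auto simp: scaleR_conv_of_real algebra_simps)
  also have "\<dots> = (\<i> * k)\<^sup>2 * (LINT x|lborel. indicator {a..b} x *\<^sub>R (cis (k * x) * Q x))
      - (LINT x|lborel. indicator {a..b} x *\<^sub>R (cis (k * x) * Q2 x))"
    by (simp only: Bochner_Integration.integral_diff[OF integrable_mult_right[OF int[OF cQ(1)]] int[OF cQ(3)]]
        integral_mult_right_zero)
  finally show ?thesis unfolding 1 by (simp only: eq_diff_eq)
qed

text \<open>
Integrate by parts twice on either side of the vertex of the tent, where the symbol is the product of \<phi> with a linear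
factor 1 + q x.  The symbol is continuous and vanishes at the feet, so the boundary terms of first
order cancel and only jumps of the derivative remain.  Together with the trivial bound by the
length of the support, this dominates the kernel by a multiple of the Cauchy kernel of width 1 / \<rho>.
\<close>

lemma kernel_decay:
  fixes \<phi> \<phi>1 \<phi>2 :: "real \<Rightarrow> complex"
  assumes lr: "0 < l" "0 < r" "l \<le> \<rho>" "r \<le> \<rho>" "\<rho> \<le> D * l" "\<rho> \<le> D * r"
    and d1: "\<And>x. (\<phi> has_vector_derivative \<phi>1 x) (at x)"
    and d2: "\<And>x. (\<phi>1 has_vector_derivative \<phi>2 x) (at x)"
    and c: "continuous_on UNIV \<phi>2"
    and b0: "\<And>x. x \<in> {- l..r} \<Longrightarrow> norm (\<phi> x) \<le> P"
    and b1: "\<And>x. x \<in> {- l..r} \<Longrightarrow> norm (\<phi>1 x) \<le> P * A / \<rho>"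
    and b2: "\<And>x. x \<in> {- l..r} \<Longrightarrow> norm (\<phi>2 x) \<le> P * A' / \<rho>\<^sup>2"
  shows "(1 + (\<rho> * u)\<^sup>2) * norm (LINT x|lborel. cis (2 * pi * u * x) * (tent (- l) 0 r x * \<phi> x))
    \<le> \<rho> * P * (2 + 4 * D + 8 * A + 2 * A')"
proof -
  have \<rho>: "0 < \<rho>" using lr by linarith
  have P: "0 \<le> P" using b0[of 0] lr norm_ge_zero[of "\<phi> 0"] by (auto simp del: norm_ge_zero)
  have PA: "0 \<le> P * A / \<rho>" using b1[of 0] lr norm_ge_zero[of "\<phi>1 0"] by (auto simp del: norm_ge_zero)
  have PA2: "0 \<le> P * A' / \<rho>\<^sup>2" using b2[of 0] lr norm_ge_zero[of "\<phi>2 0"] by (auto simp del: norm_ge_zero)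
  define k where "k = 2 * pi * u"
  define \<psi> where "\<psi> = (LINT x|lborel. cis (k * x) * (tent (- l) 0 r x * \<phi> x))"
  have cphi: "continuous_on S \<phi>" "continuous_on S \<phi>1" "continuous_on S \<phi>2" for S
    using d1 d2 c by (auto intro: continuous_on_subset
        continuous_at_imp_continuous_on has_vector_derivative_continuous)
  have int: "integrable lborel (\<lambda>x. indicator {a..b} x *\<^sub>R (cis (k * x) * F x))"
    if "continuous_on {a..b} F" for F :: "real \<Rightarrow> complex" and a b
    using that by (intro borel_integrable_compact continuous_intros) auto
  have zero: "tent (- l) 0 r x = 0" if "x \<notin> {- l..r}" for x
    using that lr by (auto simp: tent_simps not_le)
  define M where "M q x = of_real (1 + q * x) * \<phi> x" for q x :: real
  define M1 where "M1 q x = of_real q * \<phi> x + of_real (1 + q * x) * \<phi>1 x" for q x :: real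
  define M2 where "M2 q x = of_real (2 * q) * \<phi>1 x + of_real (1 + q * x) * \<phi>2 x" for q x :: real
  have v: "((\<lambda>x. complex_of_real (1 + q * x)) has_vector_derivative of_real q) (at x)" for q x :: real
    by (rule has_vector_derivative_of_real) (auto intro!: derivative_eq_intros)
  have dM: "(M q has_vector_derivative M1 q x) (at x)" "(M1 q has_vector_derivative M2 q x) (at x)" for q x
  proof -
    show "(M q has_vector_derivative M1 q x) (at x)"
      unfolding M_def[abs_def] M1_def
      by (rule has_vector_derivative_eq_rhs[OF has_vector_derivative_mult[OF v d1]]) simp
    have "((\<lambda>x. complex_of_real q * \<phi> x) has_vector_derivative of_real q * \<phi>1 x) (at x)"
      by (intro has_vector_derivative_mult_right d1)
    from has_vector_derivative_add[OF this has_vector_derivative_mult[OF v d2]]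
    show "(M1 q has_vector_derivative M2 q x) (at x)"
      unfolding M1_def[abs_def] M2_def
      by (rule has_vector_derivative_eq_rhs) (simp add: algebra_simps)
  qed
  have cM: "continuous_on S (M q)" "continuous_on S (M2 q)" for S q
    unfolding M2_def[abs_def] M_def[abs_def] by (intro continuous_intros cphi)+
  define L where "L = M (1 / l)"
  define L1 where "L1 = M1 (1 / l)"
  define L2 where "L2 = M2 (1 / l)"
  define R where "R = M (- 1 / r)"
  define R1 where "R1 = M1 (- 1 / r)"
  define R2 where "R2 = M2 (- 1 / r)"
  note dL = dM[of "1 / l", folded L_def L1_def L2_def]
  note dR = dM[of "- 1 / r", folded R_def R1_def R2_def]
  have cLR: "continuous_on S L2" "continuous_on S R2" "continuous_on S L" "continuous_on S R" for S
    unfolding L2_def R2_def L_def R_def by (intro cM)+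
  let ?IL = "\<lambda>F. LINT x|lborel. indicator {- l..0} x *\<^sub>R (cis (k * x) * F x)"
  let ?IR = "\<lambda>F. LINT x|lborel. indicator {0..r} x *\<^sub>R (cis (k * x) * F x)"
  have split: "\<psi> = ?IL L + ?IR R"
  proof -
    have "\<psi> = (LINT x|lborel. indicator {- l..0} x *\<^sub>R (cis (k * x) * L x) + indicator {0..r} x *\<^sub>R (cis (k * x) * R x))"
      unfolding \<psi>_def
    proof (rule integral_cong_AE)
      show "AE x in lborel. cis (k * x) * (tent (- l) 0 r x * \<phi> x)
          = indicator {- l..0} x *\<^sub>R (cis (k * x) * L x) + indicator {0..r} x *\<^sub>R (cis (k * x) * R x)"
        using AE_lborel_singleton[of 0]
      proof eventually_elim
        case (elim x)
        consider "x < - l" | "- l \<le> x" "x < 0" | "0 < x" "x \<le> r" | "r < x" using elim by linarith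
        then show ?case
          by cases (use lr zero[of x] in \<open>auto simp: tent_simps L_def R_def M_def indicator_def field_simps\<close>)
      qed
      show "(\<lambda>x. cis (k * x) * (tent (- l) 0 r x * \<phi> x)) \<in> borel_measurable lborel"
        using cphi(1)[of UNIV] by (simp add: borel_measurable_continuous_onI continuous_intros)
      show "(\<lambda>x. indicator {- l..0} x *\<^sub>R (cis (k * x) * L x) + indicator {0..r} x *\<^sub>R (cis (k * x) * R x)) \<in> borel_measurable lborel"
        by (intro borel_measurable_add borel_measurable_integrable[OF int] cLR)
    qed
    also have "\<dots> = ?IL L + ?IR R" by (intro Bochner_Integration.integral_add int cLR)
    finally show ?thesis .
  qed
  have nM: "norm (M q x) \<le> P" "norm (M1 q x) \<le> P * D / \<rho> + P * A / \<rho>"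
    "norm (M2 q x) \<le> 2 * (P * A / \<rho>) * \<bar>q\<bar> + P * A' / \<rho>\<^sup>2"
    if x: "x \<in> {- l..r}" and w: "\<bar>1 + q * x\<bar> \<le> 1" and dq: "\<bar>q\<bar> \<le> D / \<rho>" for q x
  proof -
    have "norm (M q x) \<le> 1 * P" unfolding M_def norm_mult norm_of_real
      by (rule mult_mono[OF w b0[OF x]]) auto
    then show "norm (M q x) \<le> P" by simp
    have D0: "0 \<le> D / \<rho>" using dq by linarith
    have "norm (M1 q x) \<le> norm (of_real q * \<phi> x) + norm (of_real (1 + q * x) * \<phi>1 x)"
      unfolding M1_def by (rule norm_triangle_ineq)
    also have "\<dots> \<le> D / \<rho> * P + 1 * (P * A / \<rho>)" unfolding norm_mult norm_of_real
      by (rule add_mono[OF mult_mono[OF dq b0[OF x] D0] mult_mono[OF w b1[OF x]]]) auto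
    finally show "norm (M1 q x) \<le> P * D / \<rho> + P * A / \<rho>" by (simp add: mult_ac)
    have "norm (M2 q x) \<le> norm (of_real (2 * q) * \<phi>1 x) + norm (of_real (1 + q * x) * \<phi>2 x)"
      unfolding M2_def by (rule norm_triangle_ineq)
    also have "\<dots> \<le> (2 * \<bar>q\<bar>) * (P * A / \<rho>) + 1 * (P * A' / \<rho>\<^sup>2)" unfolding norm_mult norm_of_real
      by (rule add_mono[OF mult_mono[OF _ b1[OF x]] mult_mono[OF w b2[OF x]]]) (auto simp: abs_mult)
    finally show "norm (M2 q x) \<le> 2 * (P * A / \<rho>) * \<bar>q\<bar> + P * A' / \<rho>\<^sup>2" by (simp add: mult_ac)
  qed
  have nL: "norm (L x) \<le> P" "norm (L1 x) \<le> P * D / \<rho> + P * A / \<rho>"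
    "norm (L2 x) \<le> 2 * (P * A / \<rho>) / l + P * A' / \<rho>\<^sup>2" if x: "x \<in> {- l..0}" for x
  proof -
    have "x \<in> {- l..r}" "\<bar>1 + 1 / l * x\<bar> \<le> 1" "\<bar>1 / l\<bar> \<le> D / \<rho>"
      using x lr \<rho> by (auto simp: abs_le_iff field_simps)
    from nM[OF this] show "norm (L x) \<le> P" "norm (L1 x) \<le> P * D / \<rho> + P * A / \<rho>"
      "norm (L2 x) \<le> 2 * (P * A / \<rho>) / l + P * A' / \<rho>\<^sup>2"
      using lr by (simp_all add: L_def L1_def L2_def)
  qed
  have nR: "norm (R x) \<le> P" "norm (R1 x) \<le> P * D / \<rho> + P * A / \<rho>"
    "norm (R2 x) \<le> 2 * (P * A / \<rho>) / r + P * A' / \<rho>\<^sup>2" if x: "x \<in> {0..r}" for x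
  proof -
    have "x \<in> {- l..r}" "\<bar>1 + - 1 / r * x\<bar> \<le> 1" "\<bar>- 1 / r\<bar> \<le> D / \<rho>"
      using x lr \<rho> by (auto simp: abs_le_iff field_simps)
    from nM[OF this] show "norm (R x) \<le> P" "norm (R1 x) \<le> P * D / \<rho> + P * A / \<rho>"
      "norm (R2 x) \<le> 2 * (P * A / \<rho>) / r + P * A' / \<rho>\<^sup>2"
      using lr by (simp_all add: R_def R1_def R2_def)
  qed
  have bnd: "norm (LINT x|lborel. indicator {a..b} x *\<^sub>R (cis (k * x) * F x)) \<le> (b - a) * B"
    if "a \<le> b" "continuous_on {a..b} F" "\<And>x. x \<in> {a..b} \<Longrightarrow> norm (F x) \<le> B" for a b B and F :: "real \<Rightarrow> complex"
  proof -
    have "norm (LINT x|lborel. indicator {a..b} x *\<^sub>R (cis (k * x) * F x)) \<le> (LINT x|lborel. indicator {a..b} x *\<^sub>R B)"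
    proof (rule Bochner_Integration.integral_norm_bound_integral[OF int[OF that(2)]])
      show "integrable lborel (\<lambda>x. indicator {a..b} x *\<^sub>R B)" by (intro borel_integrable_compact continuous_intros) auto
    qed (use that in \<open>auto simp: norm_mult split: split_indicator\<close>)
    also have "\<dots> = (b - a) * B" using that(1) by simp
    finally show ?thesis .
  qed
  have n0: "norm \<psi> \<le> 2 * \<rho> * P"
  proof -
    have "norm \<psi> \<le> norm (?IL L) + norm (?IR R)" unfolding split by (rule norm_triangle_ineq)
    also have "\<dots> \<le> (0 - - l) * P + (r - 0) * P"
      using lr nL nR by (intro add_mono bnd cLR) auto
    also have "\<dots> \<le> \<rho> * P + \<rho> * P" using lr P by (intro add_mono mult_right_mono) auto
    finally show ?thesis by (simp add: mult_ac)
  qed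
  have "(\<i> * k)\<^sup>2 * \<psi> = (cis (k * 0) * (\<i> * k * L 0 - L1 0) - cis (k * - l) * (\<i> * k * L (- l) - L1 (- l)) + ?IL L2)
     + (cis (k * r) * (\<i> * k * R r - R1 r) - cis (k * 0) * (\<i> * k * R 0 - R1 0) + ?IR R2)"
    unfolding split distrib_left using lr
    by (subst (1 2) integration_by_parts_twice) (auto intro: dL dR cLR)
  also have "\<dots> = (R1 0 - L1 0) + cis (k * - l) * L1 (- l) - cis (k * r) * R1 r + ?IL L2 + ?IR R2"
    using lr by (simp add: L_def R_def M_def algebra_simps)
  finally have eq: "(\<i> * k)\<^sup>2 * \<psi> = (R1 0 - L1 0) + cis (k * - l) * L1 (- l) - cis (k * r) * R1 r + ?IL L2 + ?IR R2" .
  let ?E = "P * D / \<rho> + P * A / \<rho>"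
  have "norm ((\<i> * k)\<^sup>2 * \<psi>) \<le> norm (R1 0) + norm (L1 0) + norm (cis (k * - l) * L1 (- l)) + norm (cis (k * r) * R1 r)
      + norm (?IL L2) + norm (?IR R2)"
    unfolding eq by (meson add_mono norm_triangle_ineq norm_triangle_ineq4 order_refl order_trans)
  also have "\<dots> \<le> ?E + ?E + ?E + ?E + (0 - - l) * (2 * (P * A / \<rho>) / l + P * A' / \<rho>\<^sup>2)
      + (r - 0) * (2 * (P * A / \<rho>) / r + P * A' / \<rho>\<^sup>2)"
    using lr nL(2)[of 0] nL(2)[of "- l"] nR(2)[of 0] nR(2)[of r]
    by (intro add_mono bnd nL(3) nR(3) cLR(1,2)) (auto simp: norm_mult)
  also have "\<dots> = 4 * ?E + 4 * (P * A / \<rho>) + (l + r) * (P * A' / \<rho>\<^sup>2)"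
    using lr by (simp add: field_simps)
  also have "\<dots> \<le> 4 * ?E + 4 * (P * A / \<rho>) + (\<rho> + \<rho>) * (P * A' / \<rho>\<^sup>2)"
    using lr PA2 by (intro add_left_mono mult_right_mono) auto
  also have "\<dots> = P * (4 * D + 8 * A + 2 * A') / \<rho>"
    using \<rho> by (simp add: power2_eq_square field_simps)
  finally have n2: "k\<^sup>2 * norm \<psi> \<le> P * (4 * D + 8 * A + 2 * A') / \<rho>"
    by (simp add: norm_mult norm_power power_mult_distrib)
  have "u\<^sup>2 \<le> k\<^sup>2"
  proof -
    have "1 \<le> (2 * pi)\<^sup>2" using pi_ge_two by (intro one_le_power) linarith
    then have "1 * u\<^sup>2 \<le> (2 * pi)\<^sup>2 * u\<^sup>2" by (intro mult_right_mono) auto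
    then show ?thesis by (simp add: k_def power_mult_distrib)
  qed
  then have "u\<^sup>2 * norm \<psi> \<le> k\<^sup>2 * norm \<psi>" by (intro mult_right_mono) auto
  with n2 have "u\<^sup>2 * norm \<psi> \<le> P * (4 * D + 8 * A + 2 * A') / \<rho>" by linarith
  then have "\<rho>\<^sup>2 * (u\<^sup>2 * norm \<psi>) \<le> \<rho>\<^sup>2 * (P * (4 * D + 8 * A + 2 * A') / \<rho>)" by (intro mult_left_mono) auto
  then have "\<rho>\<^sup>2 * (u\<^sup>2 * norm \<psi>) \<le> \<rho> * P * (4 * D + 8 * A + 2 * A')"
    using \<rho> by (simp add: power2_eq_square mult_ac)
  with n0 have "norm \<psi> + \<rho>\<^sup>2 * (u\<^sup>2 * norm \<psi>) \<le> 2 * \<rho> * P + \<rho> * P * (4 * D + 8 * A + 2 * A')" by linarith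
  then show ?thesis unfolding \<psi>_def k_def by (simp add: algebra_simps power_mult_distrib)
qed

text \<open>
The factor (2 pi i x)^m stands for m derivatives of the window piece.  Differentiating it twice costs only
(1 + m)^2 \<le> 4^m, so the bound grows geometrically in m; faster growth could not be afforded by the
iteration over the generations.
\<close>

lemma window_kernel_bound:
  fixes g b \<beta> l r \<rho> D u :: real
  assumes lr: "0 < l" "0 < r" "l \<le> \<rho>" "r \<le> \<rho>" "\<rho> \<le> D * l" "\<rho> \<le> D * r"
    and b: "\<rho> \<le> b" and nb: "\<And>\<eta>. \<eta> \<in> {- l..r} \<Longrightarrow> b\<^sup>2 / 4 \<le> 1 + (\<beta> + \<eta>)\<^sup>2 \<and> 1 + (\<beta> + \<eta>)\<^sup>2 \<le> 5 * b\<^sup>2"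
  shows "(1 + (\<rho> * u)\<^sup>2) * norm (LINT x|lborel. cis (2 * pi * u * x) *
      (tent (- l) 0 r x * ((2 * pi * \<i> * x) ^ m * bessel_weight g (\<beta> + x))))
    \<le> 5 powr (\<bar>g\<bar> / 2) * b powr g * (4 + 4 * D + 24 * \<bar>g\<bar> + 8 * \<bar>g * (g - 2)\<bar>) * \<rho> * (8 * pi * \<rho>) ^ m"
proof -
  have \<rho>: "0 < \<rho>" using lr by linarith
  have "0 < D * l" using \<rho> lr by linarith
  then have D: "0 < D" using lr by (simp add: zero_less_mult_iff)
  define W where "W = 5 powr (\<bar>g\<bar> / 2) * b powr g"
  have W: "0 \<le> W" by (simp add: W_def)
  define s where "s \<eta> = bessel_weight g (\<beta> + \<eta>)" for \<eta>
  define s1 where "s1 \<eta> = g * (\<beta> + \<eta>) * (1 + (\<beta> + \<eta>)\<^sup>2) powr (g / 2 - 1)" for \<eta>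
  define s2 where "s2 \<eta> = g * (1 + (\<beta> + \<eta>)\<^sup>2) powr (g / 2 - 1)
      + g * (g - 2) * (\<beta> + \<eta>)\<^sup>2 * (1 + (\<beta> + \<eta>)\<^sup>2) powr (g / 2 - 2)" for \<eta>
  have ds: "(s has_real_derivative s1 x) (at x)" "(s1 has_real_derivative s2 x) (at x)" for x
  proof -
    have sh: "((\<lambda>x. \<beta> + x) has_real_derivative 1) (at x)" by (auto intro!: derivative_eq_intros)
    show "(s has_real_derivative s1 x) (at x)"
      using DERIV_chain2[OF bessel_weight_derivative sh, of g] unfolding s_def[abs_def] s1_def by simp
    show "(s1 has_real_derivative s2 x) (at x)"
      using DERIV_chain2[OF bessel_weight_derivative2 sh, of g] unfolding s1_def[abs_def] s2_def by simp
  qed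
  have bs: "\<bar>s x\<bar> \<le> W" "\<bar>s1 x\<bar> \<le> 2 * \<bar>g\<bar> * W / \<rho>" "\<bar>s2 x\<bar> \<le> 4 * (\<bar>g\<bar> + \<bar>g * (g - 2)\<bar>) * W / \<rho>\<^sup>2"
    if x: "x \<in> {- l..r}" for x
    using bessel_weight_bounds[of b "\<beta> + x" \<rho> g] nb[OF x] \<rho> b bessel_weight_pos[of g "\<beta> + x"]
    unfolding W_def s_def s1_def s2_def by auto
  define z where "z x = x ^ m * s x" for x
  define z1 where "z1 x = real m * x ^ (m - 1) * s x + x ^ m * s1 x" for x
  define z2 where "z2 x = real m * real (m - 1) * x ^ (m - 2) * s x + 2 * (real m * x ^ (m - 1)) * s1 x + x ^ m * s2 x" for x
  have dz: "(z has_real_derivative z1 x) (at x)" "(z1 has_real_derivative z2 x) (at x)" for x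
  proof -
    show "(z has_real_derivative z1 x) (at x)"
      unfolding z_def[abs_def] z1_def
      by (rule DERIV_cong[OF DERIV_mult[OF DERIV_pow ds(1)]]) simp
    have "((\<lambda>x. real m * x ^ (m - 1)) has_real_derivative real m * (real (m - 1) * x ^ (m - 1 - 1))) (at x)"
      using DERIV_cmult[OF DERIV_pow[of "m - 1" x], of "real m"] by simp
    from DERIV_add[OF DERIV_mult[OF this ds(1)] DERIV_mult[OF DERIV_pow[of m] ds(2)]]
    show "(z1 has_real_derivative z2 x) (at x)"
      unfolding z1_def[abs_def] z2_def
      by (rule DERIV_cong) (simp add: algebra_simps numeral_2_eq_2)
  qed
  have pw: "\<bar>x ^ m\<bar> \<le> \<rho> ^ m" "\<bar>real m * x ^ (m - 1)\<bar> \<le> real m * \<rho> ^ m / \<rho>"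
    "\<bar>real m * real (m - 1) * x ^ (m - 2)\<bar> \<le> (real m)\<^sup>2 * \<rho> ^ m / \<rho>\<^sup>2" if x: "x \<in> {- l..r}" for x
  proof -
    have ax: "\<bar>x\<bar> \<le> \<rho>" using x lr by auto
    then have pn: "\<bar>x ^ n\<bar> \<le> \<rho> ^ n" for n by (simp add: power_abs power_mono)
    then show "\<bar>x ^ m\<bar> \<le> \<rho> ^ m" .
    show "\<bar>real m * x ^ (m - 1)\<bar> \<le> real m * \<rho> ^ m / \<rho>"
    proof (cases m)
      case (Suc n)
      have "real m * \<bar>x ^ n\<bar> \<le> real m * \<rho> ^ n" using pn by (intro mult_left_mono) auto
      then show ?thesis using \<rho> by (simp add: Suc abs_mult)
    qed simp
    show "\<bar>real m * real (m - 1) * x ^ (m - 2)\<bar> \<le> (real m)\<^sup>2 * \<rho> ^ m / \<rho>\<^sup>2"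
    proof (cases "m < 2")
      case True
      then have "m = 0 \<or> m = 1" by auto
      then show ?thesis using \<rho> by auto
    next
      case False
      then obtain n where n: "m = Suc (Suc n)" by (metis add_2_eq_Suc le_add_diff_inverse not_less)
      have "real m * real (m - 1) * \<bar>x ^ n\<bar> \<le> (real m)\<^sup>2 * \<rho> ^ n"
        using pn \<rho> unfolding power2_eq_square by (intro mult_mono) auto
      moreover have "(real m)\<^sup>2 * \<rho> ^ m / \<rho>\<^sup>2 = (real m)\<^sup>2 * \<rho> ^ n"
        using \<rho> by (simp add: n power2_eq_square)
      moreover have "\<bar>real m * real (m - 1) * x ^ (m - 2)\<bar> = real m * real (m - 1) * \<bar>x ^ n\<bar>"
        by (simp add: n abs_mult)
      ultimately show ?thesis by linarith
    qed
  qed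
  define A where "A = real m + 2 * \<bar>g\<bar>"
  define A' where "A' = (real m)\<^sup>2 + 4 * real m * \<bar>g\<bar> + 4 * (\<bar>g\<bar> + \<bar>g * (g - 2)\<bar>)"
  have bz: "\<bar>z x\<bar> \<le> \<rho> ^ m * W" "\<bar>z1 x\<bar> \<le> \<rho> ^ m * W * A / \<rho>" "\<bar>z2 x\<bar> \<le> \<rho> ^ m * W * A' / \<rho>\<^sup>2"
    if x: "x \<in> {- l..r}" for x
  proof -
    note p = pw[OF x] and q = bs[OF x]
    have rm: "0 \<le> \<rho> ^ m" using \<rho> by simp
    have r1: "0 \<le> real m * \<rho> ^ m / \<rho>" "0 \<le> (real m)\<^sup>2 * \<rho> ^ m / \<rho>\<^sup>2" using \<rho> by simp_all
    show "\<bar>z x\<bar> \<le> \<rho> ^ m * W" unfolding z_def abs_mult by (rule mult_mono[OF p(1) q(1) rm abs_ge_zero])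
    have "\<bar>z1 x\<bar> \<le> \<bar>real m * x ^ (m - 1)\<bar> * \<bar>s x\<bar> + \<bar>x ^ m\<bar> * \<bar>s1 x\<bar>"
      unfolding z1_def by (rule order_trans[OF abs_triangle_ineq]) (simp add: abs_mult)
    also have "\<dots> \<le> (real m * \<rho> ^ m / \<rho>) * W + \<rho> ^ m * (2 * \<bar>g\<bar> * W / \<rho>)"
      by (rule add_mono[OF mult_mono[OF p(2) q(1) r1(1) abs_ge_zero] mult_mono[OF p(1) q(2) rm abs_ge_zero]])
    also have "\<dots> = \<rho> ^ m * W * A / \<rho>" unfolding A_def by (simp add: add_divide_distrib distrib_left mult_ac)
    finally show "\<bar>z1 x\<bar> \<le> \<rho> ^ m * W * A / \<rho>" .
    have "\<bar>z2 x\<bar> \<le> \<bar>real m * real (m - 1) * x ^ (m - 2)\<bar> * \<bar>s x\<bar> + 2 * (\<bar>real m * x ^ (m - 1)\<bar> * \<bar>s1 x\<bar>) + \<bar>x ^ m\<bar> * \<bar>s2 x\<bar>"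
      unfolding z2_def
      by (rule order_trans[OF abs_triangle_ineq], rule add_mono, rule order_trans[OF abs_triangle_ineq])
        (simp_all add: abs_mult)
    also have "\<dots> \<le> ((real m)\<^sup>2 * \<rho> ^ m / \<rho>\<^sup>2) * W + 2 * ((real m * \<rho> ^ m / \<rho>) * (2 * \<bar>g\<bar> * W / \<rho>))
        + \<rho> ^ m * (4 * (\<bar>g\<bar> + \<bar>g * (g - 2)\<bar>) * W / \<rho>\<^sup>2)"
      by (intro add_mono mult_mono[OF p(3) q(1) r1(2) abs_ge_zero] mult_mono[OF p(1) q(3) rm abs_ge_zero]
          mult_left_mono[OF mult_mono[OF p(2) q(2) r1(1) abs_ge_zero]]) simp
    also have "\<dots> = \<rho> ^ m * W * A' / \<rho>\<^sup>2" unfolding A'_def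
      by (simp add: add_divide_distrib distrib_left mult_ac power2_eq_square)
    finally show "\<bar>z2 x\<bar> \<le> \<rho> ^ m * W * A' / \<rho>\<^sup>2" .
  qed
  define c where "c = (2 * pi * \<i>) ^ m"
  have nc: "norm c = (2 * pi) ^ m" by (simp add: c_def norm_power norm_mult)
  define P where "P = (2 * pi) ^ m * (\<rho> ^ m * W)"
  have vd: "((\<lambda>x. c * of_real (f x)) has_vector_derivative c * of_real f') (at x)"
    if "(f has_real_derivative f') (at x)" for f f' x
    using that by (intro has_vector_derivative_mult_right has_vector_derivative_of_real)
      (simp add: has_real_derivative_iff_has_vector_derivative)
  have cont: "continuous_on UNIV (\<lambda>x. c * of_real (z2 x))"
  proof -
    have p: "1 + (\<beta> + x)\<^sup>2 \<noteq> 0" for x using zero_le_power2[of "\<beta> + x"] by linarith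
    have "continuous_on UNIV s" "continuous_on UNIV s1"
      using ds by (meson DERIV_continuous_on has_field_derivative_at_within)+
    moreover have "continuous_on UNIV s2" unfolding s2_def[abs_def]
      using p by (intro continuous_intros) auto
    ultimately show ?thesis unfolding z2_def by (intro continuous_intros)
  qed
  have "(1 + (\<rho> * u)\<^sup>2) * norm (LINT x|lborel. cis (2 * pi * u * x) * (tent (- l) 0 r x * (c * of_real (z x))))
    \<le> \<rho> * P * (2 + 4 * D + 8 * A + 2 * A')"
  proof (rule kernel_decay[OF lr vd[OF dz(1)] vd[OF dz(2)] cont])
    fix x assume x: "x \<in> {- l..r}"
    show "norm (c * of_real (z x)) \<le> P" unfolding P_def norm_mult nc norm_of_real
      using bz[OF x] by (intro mult_left_mono) auto
    show "norm (c * of_real (z1 x)) \<le> P * A / \<rho>" unfolding P_def norm_mult nc norm_of_real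
      using mult_left_mono[OF bz(2)[OF x], of "(2 * pi) ^ m"] by (simp add: mult.assoc)
    show "norm (c * of_real (z2 x)) \<le> P * A' / \<rho>\<^sup>2" unfolding P_def norm_mult nc norm_of_real
      using mult_left_mono[OF bz(3)[OF x], of "(2 * pi) ^ m"] by (simp add: mult.assoc)
  qed
  also have "\<dots> \<le> \<rho> * P * ((4 + 4 * D + 24 * \<bar>g\<bar> + 8 * \<bar>g * (g - 2)\<bar>) * 4 ^ m)"
  proof (rule mult_left_mono)
    define E where "E = 4 + 4 * D + 24 * \<bar>g\<bar> + 8 * \<bar>g * (g - 2)\<bar>"
    have E: "4 + 24 * \<bar>g\<bar> \<le> E" using D by (simp add: E_def)
    have E2: "2 + 4 * D + 24 * \<bar>g\<bar> + 8 * \<bar>g * (g - 2)\<bar> \<le> E" by (simp add: E_def)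
    have "2 + 4 * D + 8 * A + 2 * A' = (2 + 4 * D + 24 * \<bar>g\<bar> + 8 * \<bar>g * (g - 2)\<bar>) + real m * (8 + 8 * \<bar>g\<bar>) + 2 * (real m)\<^sup>2"
      unfolding A_def A'_def by (simp add: algebra_simps)
    also have "\<dots> \<le> E + real m * (2 * E) + E * (real m)\<^sup>2"
      using E E2 by (intro add_mono mult_left_mono mult_right_mono) auto
    also have "\<dots> = E * (1 + real m)\<^sup>2" by (simp add: power2_eq_square algebra_simps)
    also have "\<dots> \<le> E * 4 ^ m"
    proof (rule mult_left_mono)
      have "1 + real m \<le> 2 ^ m" by (induction m) auto
      then have "(1 + real m)\<^sup>2 \<le> (2 ^ m)\<^sup>2" by (intro power_mono) auto
      also have "((2::real) ^ m)\<^sup>2 = 4 ^ m" by (simp add: power2_eq_square power_mult_distrib[symmetric])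
      finally show "(1 + real m)\<^sup>2 \<le> 4 ^ m" .
    qed (use E in auto)
    finally show "2 + 4 * D + 8 * A + 2 * A' \<le> (4 + 4 * D + 24 * \<bar>g\<bar> + 8 * \<bar>g * (g - 2)\<bar>) * 4 ^ m"
      by (simp add: E_def)
    show "0 \<le> \<rho> * P" using \<rho> W by (simp add: P_def)
  qed
  also have "\<dots> = W * (4 + 4 * D + 24 * \<bar>g\<bar> + 8 * \<bar>g * (g - 2)\<bar>) * \<rho> * (8 * pi * \<rho>) ^ m"
  proof -
    have "8 * pi * \<rho> = 4 * ((2 * pi) * \<rho>)" by simp
    then have "(8 * pi * \<rho>) ^ m = 4 ^ m * ((2 * pi) ^ m * \<rho> ^ m)" by (simp only: power_mult_distrib)
    then show ?thesis by (simp add: P_def mult_ac)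
  qed
  also have "(\<lambda>x. cis (2 * pi * u * x) * (tent (- l) 0 r x * (c * of_real (z x))))
      = (\<lambda>x. cis (2 * pi * u * x) * (tent (- l) 0 r x * ((2 * pi * \<i> * x) ^ m * bessel_weight g (\<beta> + x))))"
    by (simp add: c_def z_def s_def power_mult_distrib mult_ac)
  finally show ?thesis unfolding W_def .
qed

subsection \<open>Young's inequality for the Cauchy kernel\<close>

lemma nn_integral_cauchy: "(\<integral>\<^sup>+x. ennreal (inverse (1 + x\<^sup>2)) \<partial>lborel) = ennreal pi"
proof -
  have e: "einterval (-\<infinity>) \<infinity> = UNIV" by auto
  have "integrable lborel (\<lambda>x::real. inverse (1 + x\<^sup>2))"
    using integrable_inverse_1_plus_square by (simp add: e set_integrable_def)
  moreover have "(LINT x|lborel. inverse (1 + x\<^sup>2)) = pi"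
    using LBINT_inverse_1_plus_square by (simp add: interval_lebesgue_integral_def e set_lebesgue_integral_def)
  ultimately show ?thesis by (subst nn_integral_eq_integral) auto
qed

lemma integrable_cauchy: "integrable lborel (\<lambda>x::real. inverse (1 + x\<^sup>2))"
  by (rule integrableI_nonneg) (auto simp: nn_integral_cauchy)

lemma nn_integral_cauchy_scaled:
  assumes \<rho>: "0 < \<rho>"
  shows "(\<integral>\<^sup>+z. ennreal (\<rho> * inverse (1 + (\<rho> * (x - z))\<^sup>2)) \<partial>lborel) = ennreal pi"
proof -
  have "(\<integral>\<^sup>+z. ennreal (\<rho> * inverse (1 + (\<rho> * (x - z))\<^sup>2)) \<partial>lborel)
      = ennreal (1 / \<rho>) * (\<integral>\<^sup>+z. ennreal (\<rho> * inverse (1 + (\<rho> * (x - (x + (- 1 / \<rho>) * z)))\<^sup>2)) \<partial>lborel)"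
    using nn_integral_real_affine[of "\<lambda>z. ennreal (\<rho> * inverse (1 + (\<rho> * (x - z))\<^sup>2))" "- 1 / \<rho>" x] \<rho>
    by simp
  also have "\<dots> = ennreal (1 / \<rho>) * (\<integral>\<^sup>+z. ennreal \<rho> * ennreal (inverse (1 + z\<^sup>2)) \<partial>lborel)"
    using \<rho> by (simp add: ennreal_mult)
  also have "\<dots> = ennreal (1 / \<rho>) * (ennreal \<rho> * ennreal pi)"
    by (subst nn_integral_cmult) (auto simp: nn_integral_cauchy)
  also have "\<dots> = ennreal pi" using \<rho> by (simp add: mult.assoc[symmetric] ennreal_mult[symmetric])
  finally show ?thesis .
qed

text \<open>
Young's inequality: convolution with the Cauchy kernel, whose mass is pi for every width.
\<close>

lemma cauchy_kernel_Lp: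
  assumes \<rho>: "0 < \<rho>" and \<kappa>: "0 \<le> \<kappa>" and p: "1 \<le> p" and [measurable]: "f \<in> borel_measurable borel"
    and h: "\<And>x. ennreal (norm (h x)) \<le> (\<integral>\<^sup>+z. ennreal (\<kappa> * (\<rho> * inverse (1 + (\<rho> * (x - z))\<^sup>2))) * ennreal (norm (f z)) \<partial>lborel)"
  shows "(\<integral>\<^sup>+x. ennreal (norm (h x) powr p) \<partial>lborel) \<le> ennreal ((pi * \<kappa>) powr p) * (\<integral>\<^sup>+z. ennreal (norm (f z) powr p) \<partial>lborel)"
proof -
  define \<omega> where "\<omega> x z = ennreal (\<kappa> * (\<rho> * inverse (1 + (\<rho> * (x - z))\<^sup>2)))" for x z
  have [measurable (raw)]: "(\<lambda>z. \<omega> (f z) (g z)) \<in> borel_measurable M"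
    if [measurable]: "f \<in> borel_measurable M" "g \<in> borel_measurable M" for f g and M :: "'x measure"
    unfolding \<omega>_def by measurable
  have m1[measurable]: "\<omega> x \<in> borel_measurable borel" for x unfolding \<omega>_def by measurable
  have tot: "(\<integral>\<^sup>+z. \<omega> x z \<partial>lborel) = ennreal (pi * \<kappa>)" for x
    unfolding \<omega>_def using nn_integral_cauchy_scaled[OF \<rho>, of x] \<kappa> \<rho>
    by (simp add: ennreal_mult nn_integral_cmult mult.commute)
  have tot': "(\<integral>\<^sup>+x. \<omega> x z \<partial>lborel) = ennreal (pi * \<kappa>)" for z
  proof -
    have "\<omega> x z = \<omega> z x" for x unfolding \<omega>_def by (simp add: power2_commute right_diff_distrib)
    then show ?thesis using tot by simp
  qed
  have pt: "ennreal (norm (h x) powr p)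
      \<le> ennreal ((pi * \<kappa>) powr (p - 1)) * (\<integral>\<^sup>+z. \<omega> x z * ennreal (norm (f z) powr p) \<partial>lborel)" for x
  proof -
    have sp: "emeasure (density lborel (\<omega> x)) (space (density lborel (\<omega> x))) = ennreal (pi * \<kappa>)"
      by (simp add: emeasure_density tot)
    then have fm: "finite_measure (density lborel (\<omega> x))" by (intro finite_measureI) auto
    have me: "measure (density lborel (\<omega> x)) (space (density lborel (\<omega> x))) = pi * \<kappa>"
      using \<kappa> by (simp only: measure_def sp) simp
    have "enn_powr (ennreal (norm (h x))) p \<le> enn_powr (\<integral>\<^sup>+z. ennreal (norm (f z)) \<partial>density lborel (\<omega> x)) p"
      using p h[of x] by (intro enn_powr_mono) (auto simp: nn_integral_density \<omega>_def)
    also have "\<dots> \<le> ennreal ((pi * \<kappa>) powr (p - 1)) * (\<integral>\<^sup>+z. enn_powr (ennreal (norm (f z))) p \<partial>density lborel (\<omega> x))"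
      using jensen_nn_integral[OF fm _ p, of "\<lambda>z. ennreal (norm (f z))"] unfolding me by simp
    finally show ?thesis by (simp add: enn_powr_ennreal nn_integral_density)
  qed
  have "(\<integral>\<^sup>+x. ennreal (norm (h x) powr p) \<partial>lborel)
      \<le> (\<integral>\<^sup>+x. ennreal ((pi * \<kappa>) powr (p - 1)) * (\<integral>\<^sup>+z. \<omega> x z * ennreal (norm (f z) powr p) \<partial>lborel) \<partial>lborel)"
    by (intro nn_integral_mono pt)
  also have "\<dots> = ennreal ((pi * \<kappa>) powr (p - 1)) * (\<integral>\<^sup>+x. (\<integral>\<^sup>+z. \<omega> x z * ennreal (norm (f z) powr p) \<partial>lborel) \<partial>lborel)"
    by (rule nn_integral_cmult) measurable
  also have "(\<integral>\<^sup>+x. (\<integral>\<^sup>+z. \<omega> x z * ennreal (norm (f z) powr p) \<partial>lborel) \<partial>lborel)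
      = (\<integral>\<^sup>+z. (\<integral>\<^sup>+x. \<omega> x z * ennreal (norm (f z) powr p) \<partial>lborel) \<partial>lborel)"
    by (rule lborel_pair.Fubini'[symmetric]) measurable
  also have "\<dots> = (\<integral>\<^sup>+z. ennreal (pi * \<kappa>) * ennreal (norm (f z) powr p) \<partial>lborel)"
    by (intro nn_integral_cong) (simp add: nn_integral_multc tot')
  also have "\<dots> = ennreal (pi * \<kappa>) * (\<integral>\<^sup>+z. ennreal (norm (f z) powr p) \<partial>lborel)"
    by (rule nn_integral_cmult) measurable
  also have "ennreal ((pi * \<kappa>) powr (p - 1)) * \<dots> = ennreal ((pi * \<kappa>) powr p) * (\<integral>\<^sup>+z. ennreal (norm (f z) powr p) \<partial>lborel)"
  proof -
    have "(pi * \<kappa>) powr (p - 1) * (pi * \<kappa>) = (pi * \<kappa>) powr p"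
      using \<kappa> by (cases "\<kappa> = 0") (auto simp: powr_diff)
    then show ?thesis using \<kappa> by (simp add: mult.assoc[symmetric] ennreal_mult[symmetric])
  qed
  finally show ?thesis .
qed

section \<open>Schwartz functions on the Fourier side\<close>

lemma integrable_cauchy_bound:
  fixes f :: "real \<Rightarrow> complex"
  assumes "f \<in> borel_measurable borel" "\<And>x. (1 + x\<^sup>2) * norm (f x) \<le> c"
  shows "integrable lborel f"
proof (rule Bochner_Integration.integrable_bound[OF integrable_mult_right[OF integrable_cauchy, of c]])
  show "AE x in lborel. norm (f x) \<le> norm (c * inverse (1 + x\<^sup>2))"
  proof (rule AE_I2)
    fix x :: real
    have p: "0 < 1 + x\<^sup>2" by (simp add: add_pos_nonneg)
    then have "norm (f x) \<le> c / (1 + x\<^sup>2)" using assms(2)[of x] by (simp add: field_simps)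
    then show "norm (f x) \<le> norm (c * inverse (1 + x\<^sup>2))" by (simp add: divide_inverse)
  qed
qed (use assms in auto)

lemma schwartzE:
  assumes "schwartz f"
  obtains D c where "D 0 = f" "\<And>n x. (D n has_vector_derivative D (Suc n) x) (at x)"
    "\<And>n x. (1 + x\<^sup>2) * norm (D n x) \<le> c n" "\<And>n. continuous_on UNIV (D n)" "\<And>n. integrable lborel (D n)"
proof -
  obtain D where D: "D 0 = f" "\<And>n x. (D n has_vector_derivative D (Suc n) x) (at x)"
    "\<And>m n. bounded (range (\<lambda>x. x ^ m *\<^sub>R D n x))"
    using assms unfolding schwartz_def by auto
  have "\<exists>c. \<forall>x. (1 + x\<^sup>2) * norm (D n x) \<le> c" for n
  proof -
    obtain B0 where B0: "\<And>x. norm (D n x) \<le> B0" using D(3)[of 0 n] by (auto simp: bounded_iff)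
    obtain B2 where B2: "\<And>x. x\<^sup>2 * norm (D n x) \<le> B2" using D(3)[of 2 n] by (auto simp: bounded_iff)
    have "(1 + x\<^sup>2) * norm (D n x) \<le> B0 + B2" for x
      using B0[of x] B2[of x] by (simp add: algebra_simps)
    then show ?thesis by blast
  qed
  then obtain c where c: "\<And>n x. (1 + x\<^sup>2) * norm (D n x) \<le> c n" by metis
  have cont: "continuous_on UNIV (D n)" for n
    using D(2) by (meson continuous_at_imp_continuous_on has_vector_derivative_continuous)
  then have "integrable lborel (D n)" for n
    by (intro integrable_cauchy_bound[of _ "c n"] borel_measurable_continuous_onI c)
  with D c cont show ?thesis by (intro that)
qed

lemma integrable_cis_mult:
  fixes f :: "real \<Rightarrow> complex"
  assumes "integrable M f" "a \<in> borel_measurable M"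
  shows "integrable M (\<lambda>x. cis (a x) * f x)"
  using assms by (subst integrable_norm_iff[symmetric]) (auto simp: norm_mult)

lemma fourier_cis: "fourier f \<xi> = (LINT x|lborel. cis (- (2 * pi * x * \<xi>)) * f x)"
  by (simp add: fourier_def cis_conv_exp)

lemma norm_fourier_le: "norm (fourier f \<xi>) \<le> (LINT x|lborel. norm (f x))"
  unfolding fourier_cis by (rule order_trans[OF integral_norm_bound]) (simp add: norm_mult)

lemma continuous_fourier:
  assumes f: "integrable lborel f"
  shows "continuous_on UNIV (fourier f)"
proof (rule continuous_on_sequentiallyI)
  fix u :: "nat \<Rightarrow> real" and a :: real assume u: "u \<longlonglongrightarrow> a"
  note [measurable] = borel_measurable_integrable[OF f]
  show "(\<lambda>n. fourier f (u n)) \<longlonglongrightarrow> fourier f a"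
    unfolding fourier_cis
  proof (rule integral_dominated_convergence[where w = "\<lambda>x. norm (f x)"])
    show "AE x in lborel. (\<lambda>n. cis (- (2 * pi * x * u n)) * f x) \<longlonglongrightarrow> cis (- (2 * pi * x * a)) * f x"
      unfolding cis_conv_exp by (intro AE_I2 tendsto_intros u)
  qed (use f in \<open>auto simp: norm_mult\<close>)
qed

text \<open>
The product of the function with the character decays, so its derivative has integral 0.
\<close>

lemma fourier_derivative:
  assumes d: "\<And>x. (f has_vector_derivative f' x) (at x)" and c: "continuous_on UNIV f'"
    and i: "integrable lborel f" "integrable lborel f'"
    and b: "\<And>x. (1 + x\<^sup>2) * norm (f x) \<le> B"
  shows "fourier f' \<xi> = 2 * pi * \<i> * \<xi> * fourier f \<xi>"
proof -
  define k where "k = - (2 * pi * \<xi>)"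
  define F where "F x = cis (k * x) * f x" for x
  define F' where "F' x = cis (k * x) * f' x + \<i> * k * cis (k * x) * f x" for x
  have cf: "continuous_on UNIV f"
    using d by (meson continuous_at_imp_continuous_on has_vector_derivative_continuous)
  have dF: "(F has_vector_derivative F' x) (at x)" for x
  proof -
    have "((\<lambda>t. cis (k * t)) has_vector_derivative \<i> * k * cis (k * x)) (at x)"
      by (rule cis_has_vector_derivative)
    from has_vector_derivative_mult[OF this d]
    show ?thesis unfolding F_def[abs_def] F'_def by (rule has_vector_derivative_eq_rhs) (simp add: algebra_simps)
  qed
  have cF: "continuous_on UNIV F'"
    unfolding F'_def[abs_def] cis_conv_exp by (intro continuous_intros cf c)
  have iF: "integrable lborel (\<lambda>x. cis (k * x) * f' x)" "integrable lborel (\<lambda>x. cis (k * x) * f x)"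
    by (intro integrable_cis_mult i; measurable)+
  then have iF': "integrable lborel F'" unfolding F'_def[abs_def]
    by (simp add: mult.assoc)
  have nF: "norm (F x) \<le> \<bar>B\<bar> * inverse (1 + x\<^sup>2)" for x
  proof -
    have p: "0 < 1 + x\<^sup>2" by (simp add: add_pos_nonneg)
    then have "norm (f x) \<le> B / (1 + x\<^sup>2)" using b[of x] by (simp add: field_simps)
    also have "\<dots> \<le> \<bar>B\<bar> / (1 + x\<^sup>2)" using p by (intro divide_right_mono) auto
    finally show ?thesis by (simp add: F_def norm_mult divide_inverse)
  qed
  have l0: "((\<lambda>x::real. \<bar>B\<bar> * inverse (1 + x\<^sup>2)) \<longlongrightarrow> 0) at_top" "((\<lambda>x::real. \<bar>B\<bar> * inverse (1 + x\<^sup>2)) \<longlongrightarrow> 0) at_bot"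
    by real_asymp+
  have lim: "(F \<longlongrightarrow> 0) at_top" "(F \<longlongrightarrow> 0) at_bot"
    by (rule Lim_null_comparison[OF _ l0(1)], use nF in simp, rule Lim_null_comparison[OF _ l0(2)], use nF in simp)
  have e: "einterval (-\<infinity>) \<infinity> = UNIV" by auto
  have "(LBINT x=-\<infinity>..\<infinity>. F' x) = 0 - 0"
  proof (rule interval_integral_FTC_integrable[where F = F])
    show "((F \<circ> real_of_ereal) \<longlongrightarrow> 0) (at_right (-\<infinity>))" "((F \<circ> real_of_ereal) \<longlongrightarrow> 0) (at_left \<infinity>)"
      using lim by (simp_all add: ereal_tendsto_simps)
    show "isCont F' x" for x using cF by (simp add: continuous_on_eq_continuous_at)
    show "set_integrable lborel (einterval (- \<infinity>) \<infinity>) F'"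
      unfolding e using iF' by (simp add: set_integrable_def)
  qed (use dF in auto)
  then have "(LINT x|lborel. F' x) = 0"
    by (simp add: interval_lebesgue_integral_def e set_lebesgue_integral_def)
  also have "(LINT x|lborel. F' x) = (LINT x|lborel. cis (k * x) * f' x) + \<i> * k * (LINT x|lborel. cis (k * x) * f x)"
    unfolding F'_def using iF by (simp add: mult.assoc)
  finally have "(LINT x|lborel. cis (k * x) * f' x) = - \<i> * k * (LINT x|lborel. cis (k * x) * f x)"
    by (simp add: eq_neg_iff_add_eq_0)
  then show ?thesis
    unfolding fourier_cis k_def by (simp add: mult_ac)
qed

lemma schwartz_fourier_decay:
  assumes "schwartz f"
  shows "\<exists>c. \<forall>\<xi>. (1 + \<xi>\<^sup>2)\<^sup>2 * norm (fourier f \<xi>) \<le> c"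
proof -
  obtain D c where D: "D 0 = f" "\<And>n x. (D n has_vector_derivative D (Suc n) x) (at x)"
    "\<And>n x. (1 + x\<^sup>2) * norm (D n x) \<le> c n" "\<And>n. continuous_on UNIV (D n)" "\<And>n. integrable lborel (D n)"
    using schwartzE[OF assms] by blast
  have step: "fourier (D (Suc n)) \<xi> = 2 * pi * \<i> * \<xi> * fourier (D n) \<xi>" for n \<xi>
    by (rule fourier_derivative[OF D(2) D(4) D(5) D(5) D(3)])
  define I where "I n = (LINT x|lborel. norm (D n x))" for n
  have pwr: "\<bar>\<xi>\<bar> ^ n * norm (fourier f \<xi>) \<le> I n" for n \<xi>
  proof -
    have "fourier (D n) \<xi> = (2 * pi * \<i> * \<xi>) ^ n * fourier f \<xi>"
      by (induction n) (simp_all add: D(1) step)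
    then have "norm (fourier (D n) \<xi>) = (2 * pi * \<bar>\<xi>\<bar>) ^ n * norm (fourier f \<xi>)"
      by (simp add: norm_mult norm_power)
    moreover have "norm (fourier (D n) \<xi>) \<le> I n" unfolding I_def by (rule norm_fourier_le)
    moreover have "\<bar>\<xi>\<bar> \<le> 2 * pi * \<bar>\<xi>\<bar>"
    proof -
      have "1 \<le> 2 * pi" using pi_ge_two by linarith
      then have "1 * \<bar>\<xi>\<bar> \<le> 2 * pi * \<bar>\<xi>\<bar>" by (intro mult_right_mono) auto
      then show ?thesis by simp
    qed
    then have "\<bar>\<xi>\<bar> ^ n \<le> (2 * pi * \<bar>\<xi>\<bar>) ^ n" by (intro power_mono) auto
    then have "\<bar>\<xi>\<bar> ^ n * norm (fourier f \<xi>) \<le> (2 * pi * \<bar>\<xi>\<bar>) ^ n * norm (fourier f \<xi>)"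
      by (intro mult_right_mono) auto
    ultimately show ?thesis by linarith
  qed
  have "(1 + \<xi>\<^sup>2)\<^sup>2 * norm (fourier f \<xi>) \<le> I 0 + 2 * I 2 + I 4" for \<xi>
  proof -
    have "(1 + \<xi>\<^sup>2)\<^sup>2 * norm (fourier f \<xi>) = \<bar>\<xi>\<bar> ^ 0 * norm (fourier f \<xi>) + 2 * (\<bar>\<xi>\<bar> ^ 2 * norm (fourier f \<xi>)) + \<bar>\<xi>\<bar> ^ 4 * norm (fourier f \<xi>)"
      by (simp add: power2_eq_square power4_eq_xxxx algebra_simps)
    then show ?thesis using pwr[of \<xi> 0] pwr[of \<xi> 2] pwr[of \<xi> 4] by linarith
  qed
  then show ?thesis by blast
qed

lemma gaussian_fourier:
  fixes a u :: real assumes a: "0 < a"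
  shows "(LINT \<xi>|lborel. cis (u * \<xi>) * of_real (exp (- (a * \<xi>)\<^sup>2 / 2)))
    = of_real (sqrt (2 * pi) / a * exp (- (u / a)\<^sup>2 / 2))"
proof -
  have "char std_normal_distribution (u / a) = of_real (exp (- (u / a)\<^sup>2 / 2))"
    by (simp add: char_std_normal_distribution)
  moreover have "char std_normal_distribution (u / a)
      = (LINT x|lborel. std_normal_density x *\<^sub>R cis (u / a * x))"
    unfolding char_def by (subst integral_density) (auto simp: cis_conv_exp)
  ultimately have 1: "(LINT x|lborel. std_normal_density x *\<^sub>R cis (u / a * x)) = of_real (exp (- (u / a)\<^sup>2 / 2))"
    by simp
  have "(LINT x|lborel. std_normal_density x *\<^sub>R cis (u / a * x))
      = \<bar>a\<bar> *\<^sub>R (LINT x|lborel. std_normal_density (0 + a * x) *\<^sub>R cis (u / a * (0 + a * x)))"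
    using a by (intro lborel_integral_real_affine) auto
  also have "(LINT x|lborel. std_normal_density (0 + a * x) *\<^sub>R cis (u / a * (0 + a * x)))
      = (LINT x|lborel. of_real (1 / sqrt (2 * pi)) * (cis (u * x) * of_real (exp (- (a * x)\<^sup>2 / 2))))"
    using a by (intro Bochner_Integration.integral_cong) (auto simp: normal_density_def scaleR_conv_of_real)
  also have "\<dots> = of_real (1 / sqrt (2 * pi)) * (LINT x|lborel. cis (u * x) * of_real (exp (- (a * x)\<^sup>2 / 2)))"
    by (rule integral_mult_right_zero)
  finally have "of_real (exp (- (u / a)\<^sup>2 / 2))
      = complex_of_real (a / sqrt (2 * pi)) * (LINT x|lborel. cis (u * x) * of_real (exp (- (a * x)\<^sup>2 / 2)))"
    using 1 a by (simp add: scaleR_conv_of_real)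
  then have "of_real (sqrt (2 * pi) / a) * complex_of_real (exp (- (u / a)\<^sup>2 / 2))
      = (of_real (sqrt (2 * pi) / a) * complex_of_real (a / sqrt (2 * pi))) * (LINT x|lborel. cis (u * x) * of_real (exp (- (a * x)\<^sup>2 / 2)))"
    by (simp only: mult.assoc)
  moreover have "of_real (sqrt (2 * pi) / a) * complex_of_real (a / sqrt (2 * pi)) = 1"
    using a by (simp flip: of_real_mult)
  ultimately show ?thesis by simp
qed

lemma integrable_gaussian:
  fixes a :: real assumes "0 < a"
  shows "integrable lborel (\<lambda>\<xi>. exp (- (a * \<xi>)\<^sup>2 / 2))"
proof -
  have "integrable lborel (\<lambda>x. normal_density 0 (1 / a) x)" using assms by (intro integrable_normal_density) auto
  then have "integrable lborel (\<lambda>x. sqrt (2 * pi * (1 / a)\<^sup>2) * normal_density 0 (1 / a) x)" by simp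
  moreover have "sqrt (2 * pi * (1 / a)\<^sup>2) * normal_density 0 (1 / a) x = exp (- (a * x)\<^sup>2 / 2)" for x
    using assms by (simp add: normal_density_def power_divide power_mult_distrib field_simps)
  ultimately show ?thesis by simp
qed

lemma integrable_pair_mult:
  fixes f g :: "real \<Rightarrow> complex"
  assumes "integrable lborel f" "integrable lborel g" "k \<in> borel_measurable (lborel \<Otimes>\<^sub>M lborel)" "\<And>z. norm (k z :: complex) \<le> 1"
  shows "integrable (lborel \<Otimes>\<^sub>M lborel) (\<lambda>(x, y). k (x, y) * (f x * g y))"
proof -
  note [measurable] = assms(3) borel_measurable_integrable[OF assms(1)] borel_measurable_integrable[OF assms(2)]
  have "integrable (lborel \<Otimes>\<^sub>M lborel) (\<lambda>(x, y). f x * g y)"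
  proof (rule lborel_pair.Fubini_integrable)
    show "integrable lborel (\<lambda>x. LINT y|lborel. norm (case (x, y) of (x, y) \<Rightarrow> f x * g y))"
      using assms(1) by (simp add: norm_mult)
    show "AE x in lborel. integrable lborel (\<lambda>y. case (x, y) of (x, y) \<Rightarrow> f x * g y)"
      using assms(2) by simp
  qed measurable
  then show ?thesis
  proof (rule Bochner_Integration.integrable_bound)
    show "AE z in lborel \<Otimes>\<^sub>M lborel. norm (case z of (x, y) \<Rightarrow> k (x, y) * (f x * g y)) \<le> norm (case z of (x, y) \<Rightarrow> f x * g y)"
      using assms(4) by (intro AE_I2) (auto simp: norm_mult split: prod.split intro: mult_left_le_one_le)
  qed measurable
qed

text \<open>
Insert a Gaussian factor of width 1 / a n.  By Fubini's theorem and the Fourier transform of the Gaussian, the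
regularised integral is the mean of f (x - a n Z / (2 pi)) for a standard normal Z; both sides
converge as a n tends to 0.
\<close>

lemma fourier_inversion:
  assumes f: "integrable lborel f" "continuous_on UNIV f" "\<And>x. norm (f x) \<le> B"
    and F: "integrable lborel (fourier f)"
  shows "(LINT \<xi>|lborel. cis (2 * pi * x * \<xi>) * fourier f \<xi>) = f x"
proof -
  have [measurable]: "f \<in> borel_measurable borel" using f(2) by (rule borel_measurable_continuous_onI)
  have [measurable]: "fourier f \<in> borel_measurable borel"
    using continuous_fourier[OF f(1)] by (rule borel_measurable_continuous_onI)
  define a where "a n = 1 / real (Suc n)" for n
  have a: "0 < a n" for n by (simp add: a_def)
  have a0: "a \<longlonglongrightarrow> 0" unfolding a_def by (rule LIMSEQ_Suc[OF lim_1_over_n])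
  define G where "G n = (LINT \<xi>|lborel. cis (2 * pi * x * \<xi>) * fourier f \<xi> * of_real (exp (- (a n * \<xi>)\<^sup>2 / 2)))" for n
  have lim1: "G \<longlonglongrightarrow> (LINT \<xi>|lborel. cis (2 * pi * x * \<xi>) * fourier f \<xi>)"
    unfolding G_def
  proof (rule integral_dominated_convergence[where w = "\<lambda>\<xi>. norm (fourier f \<xi>)"])
    show "AE \<xi> in lborel. (\<lambda>n. cis (2 * pi * x * \<xi>) * fourier f \<xi> * of_real (exp (- (a n * \<xi>)\<^sup>2 / 2)))
        \<longlonglongrightarrow> cis (2 * pi * x * \<xi>) * fourier f \<xi>"
    proof (rule AE_I2)
      fix \<xi>
      have "(\<lambda>n. cis (2 * pi * x * \<xi>) * fourier f \<xi> * of_real (exp (- (a n * \<xi>)\<^sup>2 / 2)))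
          \<longlonglongrightarrow> cis (2 * pi * x * \<xi>) * fourier f \<xi> * of_real (exp (- (0 * \<xi>)\<^sup>2 / 2))"
        by (intro tendsto_intros a0) simp
      then show "(\<lambda>n. cis (2 * pi * x * \<xi>) * fourier f \<xi> * of_real (exp (- (a n * \<xi>)\<^sup>2 / 2)))
          \<longlonglongrightarrow> cis (2 * pi * x * \<xi>) * fourier f \<xi>" by simp
    qed
    show "AE \<xi> in lborel. norm (cis (2 * pi * x * \<xi>) * fourier f \<xi> * of_real (exp (- (a n * \<xi>)\<^sup>2 / 2))) \<le> norm (fourier f \<xi>)" for n
      by (intro AE_I2) (simp add: norm_mult mult_right_le_one_le)
  qed (use F in auto)
  have Geq: "G n = (LINT z|lborel. of_real (std_normal_density z) * f (x - a n / (2 * pi) * z))" for n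
  proof -
    let ?e = "\<lambda>\<xi>. complex_of_real (exp (- (a n * \<xi>)\<^sup>2 / 2))"
    let ?k = "\<lambda>(\<xi>, y). cis (2 * pi * (x - y) * \<xi>)"
    have ie: "integrable lborel ?e" using integrable_gaussian[OF a] by (rule integrable_of_real)
    have int: "integrable (lborel \<Otimes>\<^sub>M lborel) (\<lambda>(\<xi>, y). ?k (\<xi>, y) * (?e \<xi> * f y))"
      using f(1) by (intro integrable_pair_mult ie) auto
    have "G n = (LINT \<xi>|lborel. LINT y|lborel. ?k (\<xi>, y) * (?e \<xi> * f y))"
      unfolding G_def fourier_cis
    proof (intro Bochner_Integration.integral_cong refl)
      fix \<xi>
      have "cis (2 * pi * x * \<xi>) * (LINT y|lborel. cis (- (2 * pi * y * \<xi>)) * f y) * ?e \<xi>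
          = (LINT y|lborel. (cis (2 * pi * x * \<xi>) * ?e \<xi>) * (cis (- (2 * pi * y * \<xi>)) * f y))"
        unfolding integral_mult_right_zero by simp
      also have "\<dots> = (LINT y|lborel. ?k (\<xi>, y) * (?e \<xi> * f y))"
      proof (intro Bochner_Integration.integral_cong refl)
        fix y
        have "cis (2 * pi * (x - y) * \<xi>) = cis (2 * pi * x * \<xi>) * cis (- (2 * pi * y * \<xi>))"
          by (simp add: cis_mult algebra_simps)
        then show "(cis (2 * pi * x * \<xi>) * ?e \<xi>) * (cis (- (2 * pi * y * \<xi>)) * f y) = ?k (\<xi>, y) * (?e \<xi> * f y)"
          by (simp add: mult_ac)
      qed
      finally show "cis (2 * pi * x * \<xi>) * (LINT y|lborel. cis (- (2 * pi * y * \<xi>)) * f y) * ?e \<xi>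
          = (LINT y|lborel. ?k (\<xi>, y) * (?e \<xi> * f y))" .
    qed
    also have "\<dots> = (LINT y|lborel. LINT \<xi>|lborel. ?k (\<xi>, y) * (?e \<xi> * f y))"
      using lborel_pair.Fubini_integral[of "\<lambda>\<xi> y. ?k (\<xi>, y) * (?e \<xi> * f y)"] int by simp
    also have "\<dots> = (LINT y|lborel. of_real (sqrt (2 * pi) / a n * exp (- (2 * pi * (x - y) / a n)\<^sup>2 / 2)) * f y)"
    proof (intro Bochner_Integration.integral_cong refl)
      fix y
      have "(LINT \<xi>|lborel. ?k (\<xi>, y) * (?e \<xi> * f y)) = (LINT \<xi>|lborel. (cis (2 * pi * (x - y) * \<xi>) * ?e \<xi>) * f y)"
        by (simp add: mult.assoc)
      also have "\<dots> = of_real (sqrt (2 * pi) / a n * exp (- (2 * pi * (x - y) / a n)\<^sup>2 / 2)) * f y"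
        unfolding integral_mult_left_zero gaussian_fourier[OF a] ..
      finally show "(LINT \<xi>|lborel. ?k (\<xi>, y) * (?e \<xi> * f y))
          = of_real (sqrt (2 * pi) / a n * exp (- (2 * pi * (x - y) / a n)\<^sup>2 / 2)) * f y" .
    qed
    also have "\<dots> = \<bar>- a n / (2 * pi)\<bar> *\<^sub>R (LINT z|lborel. of_real (sqrt (2 * pi) / a n
        * exp (- (2 * pi * (x - (x + (- a n / (2 * pi)) * z)) / a n)\<^sup>2 / 2)) * f (x + (- a n / (2 * pi)) * z))"
      using a[of n] by (intro lborel_integral_real_affine) auto
    also have "\<dots> = (LINT z|lborel. of_real (\<bar>- a n / (2 * pi)\<bar>) * (of_real (sqrt (2 * pi) / a n
        * exp (- (2 * pi * (x - (x + (- a n / (2 * pi)) * z)) / a n)\<^sup>2 / 2)) * f (x + (- a n / (2 * pi)) * z)))"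
      unfolding integral_mult_right_zero scaleR_conv_of_real ..
    also have "\<dots> = (LINT z|lborel. of_real (std_normal_density z) * f (x - a n / (2 * pi) * z))"
    proof (intro Bochner_Integration.integral_cong refl)
      fix z
      have 1: "2 * pi * (x - (x - a n / (2 * pi) * z)) / a n = z" using a[of n] by simp
      have 2: "x + (- a n / (2 * pi)) * z = x - a n / (2 * pi) * z" by simp
      have 3: "\<bar>- a n / (2 * pi)\<bar> * (sqrt (2 * pi) / a n) = 1 / sqrt (2 * pi)"
      proof -
        have "\<bar>- a n / (2 * pi)\<bar> * (sqrt (2 * pi) / a n) = sqrt (2 * pi) / (2 * pi)" using a[of n] by simp
        also have "\<dots> = 1 / sqrt (2 * pi)" by (simp add: real_div_sqrt field_simps)
        finally show ?thesis .
      qed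
      have 4: "\<bar>- a n / (2 * pi)\<bar> * (sqrt (2 * pi) / a n * exp (- z\<^sup>2 / 2)) = std_normal_density z"
        unfolding mult.assoc[symmetric] 3 by (simp add: normal_density_def)
      show "of_real \<bar>- a n / (2 * pi)\<bar> * (of_real (sqrt (2 * pi) / a n
        * exp (- (2 * pi * (x - (x + (- a n / (2 * pi)) * z)) / a n)\<^sup>2 / 2)) * f (x + (- a n / (2 * pi)) * z))
        = of_real (std_normal_density z) * f (x - a n / (2 * pi) * z)"
        unfolding 2 1 by (subst mult.assoc[symmetric], subst of_real_mult[symmetric], subst 4, rule refl)
    qed
    finally show ?thesis .
  qed
  have iphi: "integrable lborel (\<lambda>z. complex_of_real (std_normal_density z))"
    using integrable_normal_density[of 1 0] by simp
  have "(\<lambda>n. LINT z|lborel. of_real (std_normal_density z) * f (x - a n / (2 * pi) * z))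
      \<longlonglongrightarrow> (LINT z|lborel. of_real (std_normal_density z) * f x)"
  proof (rule integral_dominated_convergence[where w = "\<lambda>z. std_normal_density z * B"])
    show "AE z in lborel. (\<lambda>n. of_real (std_normal_density z) * f (x - a n / (2 * pi) * z)) \<longlonglongrightarrow> of_real (std_normal_density z) * f x"
    proof (rule AE_I2)
      fix z
      have "(\<lambda>n. x - a n * (z / (2 * pi))) \<longlonglongrightarrow> x - 0 * (z / (2 * pi))" by (intro tendsto_intros a0)
      moreover have "isCont f x" using f(2) by (simp add: continuous_on_eq_continuous_at)
      ultimately have "(\<lambda>n. f (x - a n / (2 * pi) * z)) \<longlonglongrightarrow> f x" by (intro isCont_tendsto_compose[of x f]) auto
      then show "(\<lambda>n. of_real (std_normal_density z) * f (x - a n / (2 * pi) * z)) \<longlonglongrightarrow> of_real (std_normal_density z) * f x"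
        by (intro tendsto_intros)
    qed
    show "AE z in lborel. norm (of_real (std_normal_density z) * f (x - a n / (2 * pi) * z)) \<le> std_normal_density z * B" for n
      using f(3) by (intro AE_I2) (simp add: norm_mult mult_left_mono)
  qed (use integrable_normal_density[of 1 0] in auto)
  moreover have "(LINT z|lborel. of_real (std_normal_density z) * f x) = f x"
    unfolding integral_mult_left_zero using integral_normal_density[of 1 0] by simp
  ultimately have "G \<longlonglongrightarrow> f x" unfolding Geq by simp
  with lim1 show ?thesis by (rule LIMSEQ_unique)
qed

section \<open>Frequency pieces\<close>

text \<open>
The m-th derivative of the piece of the function with Fourier transform F that belongs to the window with
vertex \<beta>, after its frequencies have been translated from \<beta> to 0 and the weight has been applied.
\<close>

definition piece :: "nat \<Rightarrow> real \<Rightarrow> real \<Rightarrow> real \<Rightarrow> real \<Rightarrow> (real \<Rightarrow> complex) \<Rightarrow> real \<Rightarrow> complex" where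
  "piece m \<beta> l r g F x = (LINT \<eta>|lborel. cis (2 * pi * x * \<eta>) *
     (tent (- l) 0 r \<eta> * ((2 * pi * \<i> * \<eta>) ^ m * bessel_weight g (\<beta> + \<eta>))) * F (\<beta> + \<eta>))"

lemma continuous_bessel_weight [continuous_intros]:
  "continuous_on S f \<Longrightarrow> continuous_on S (\<lambda>x. bessel_weight g (f x))"
proof -
  assume f: "continuous_on S f"
  have "1 + (f x)\<^sup>2 \<noteq> 0" for x using zero_le_power2[of "f x"] by linarith
  then show ?thesis unfolding bessel_weight_def by (intro continuous_intros f) auto
qed

lemma measurable_bessel_weight [measurable (raw)]:
  assumes [measurable]: "f \<in> borel_measurable M"
  shows "(\<lambda>x. bessel_weight g (f x)) \<in> borel_measurable M"
  unfolding bessel_weight_def by measurable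

lemma integral_tent_cutoff:
  fixes h :: "real \<Rightarrow> complex"
  assumes lr: "0 < l" "0 < r" and h: "continuous_on UNIV h"
  shows "integrable lborel (\<lambda>\<eta>. tent (- l) 0 r \<eta> * h \<eta>)"
    and "(LINT \<eta>|lborel. tent (- l) 0 r \<eta> * h \<eta>) = integral (cbox (- l) r) (\<lambda>\<eta>. tent (- l) 0 r \<eta> * h \<eta>)"
proof -
  have z: "tent (- l) 0 r \<eta> = 0" if "\<eta> \<notin> {- l..r}" for \<eta>
    using that lr by (auto simp: tent_simps not_le)
  have e: "tent (- l) 0 r \<eta> * h \<eta> = indicator {- l..r} \<eta> *\<^sub>R (tent (- l) 0 r \<eta> * h \<eta>)" for \<eta>
    using z[of \<eta>] by (auto split: split_indicator)
  have i: "set_integrable lborel {- l..r} (\<lambda>\<eta>. tent (- l) 0 r \<eta> * h \<eta>)"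
    unfolding set_integrable_def
    by (intro borel_integrable_compact continuous_intros continuous_on_subset[OF h]) auto
  then show "integrable lborel (\<lambda>\<eta>. tent (- l) 0 r \<eta> * h \<eta>)"
    unfolding set_integrable_def e[symmetric] .
  show "(LINT \<eta>|lborel. tent (- l) 0 r \<eta> * h \<eta>) = integral (cbox (- l) r) (\<lambda>\<eta>. tent (- l) 0 r \<eta> * h \<eta>)"
    using set_borel_integral_eq_integral(2)[OF i] unfolding set_lebesgue_integral_def e[symmetric] by simp
qed

lemma piece_alt:
  fixes F :: "real \<Rightarrow> complex"
  shows "piece m \<beta> l r g F x = (LINT \<eta>|lborel. tent (- l) 0 r \<eta> *
    (cis (2 * pi * x * \<eta>) * ((2 * pi * \<i> * \<eta>) ^ m * (bessel_weight g (\<beta> + \<eta>) * F (\<beta> + \<eta>)))))"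
  unfolding piece_def by (simp add: mult_ac)

text \<open>
The integrand is supported in a compact interval, where the integral may be differentiated.
\<close>

lemma piece_derivative:
  fixes F :: "real \<Rightarrow> complex"
  assumes lr: "0 < l" "0 < r" and F: "continuous_on UNIV F"
  shows "(piece m \<beta> l r g F has_vector_derivative piece (Suc m) \<beta> l r g F x) (at x)"
proof -
  have cF: "continuous_on S (\<lambda>\<eta>. F (\<beta> + \<eta>))" for S
    by (intro continuous_on_compose2[OF F] continuous_intros) auto
  define T where "T m x \<eta> = cis (2 * pi * x * \<eta>) * ((2 * pi * \<i> * \<eta>) ^ m * (bessel_weight g (\<beta> + \<eta>) * F (\<beta> + \<eta>)))"
    for m x \<eta>
  have cT: "continuous_on S (T m x)" for S m x
    unfolding T_def by (intro continuous_intros cF)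
  have p: "piece m \<beta> l r g F x = integral (cbox (- l) r) (\<lambda>\<eta>. tent (- l) 0 r \<eta> * T m x \<eta>)" for m x
    unfolding piece_alt T_def[symmetric] by (rule integral_tent_cutoff(2)[OF lr cT])
  have "((\<lambda>x. integral (cbox (- l) r) (\<lambda>\<eta>. tent (- l) 0 r \<eta> * T m x \<eta>)) has_vector_derivative
      integral (cbox (- l) r) (\<lambda>\<eta>. tent (- l) 0 r \<eta> * T (Suc m) x \<eta>)) (at x within UNIV)"
  proof (rule leibniz_rule_vector_derivative)
    fix x \<eta>
    have "((\<lambda>x. cis ((2 * pi * \<eta>) * x)) has_vector_derivative \<i> * of_real (2 * pi * \<eta>) * cis ((2 * pi * \<eta>) * x)) (at x)"
      by (rule cis_has_vector_derivative)
    from has_vector_derivative_mult_right[OF has_vector_derivative_mult_left[OF this,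
        of "(2 * pi * \<i> * \<eta>) ^ m * (bessel_weight g (\<beta> + \<eta>) * F (\<beta> + \<eta>))"], of "tent (- l) 0 r \<eta>"]
    show "((\<lambda>x. tent (- l) 0 r \<eta> * T m x \<eta>) has_vector_derivative tent (- l) 0 r \<eta> * T (Suc m) x \<eta>) (at x within UNIV)"
      unfolding T_def by (simp add: mult_ac)
  next
    show "(\<lambda>\<eta>. tent (- l) 0 r \<eta> * T m x \<eta>) integrable_on cbox (- l) r" for x
      by (intro integrable_continuous continuous_intros cT)
    show "continuous_on (UNIV \<times> cbox (- l) r) (\<lambda>(x, \<eta>). tent (- l) 0 r \<eta> * T (Suc m) x \<eta>)"
      unfolding T_def split_beta
      by (intro continuous_intros continuous_on_compose2[OF F]) auto
  qed auto
  then show ?thesis unfolding p[abs_def] p by simp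
qed

lemma piece_bounded:
  fixes F :: "real \<Rightarrow> complex"
  assumes lr: "0 < l" "0 < r" and F: "continuous_on UNIV F"
  shows "\<exists>B. \<forall>x. norm (piece m \<beta> l r g F x) \<le> B"
proof -
  have cF: "continuous_on S (\<lambda>\<eta>. F (\<beta> + \<eta>))" for S
    by (intro continuous_on_compose2[OF F] continuous_intros) auto
  have "norm (piece m \<beta> l r g F x)
      \<le> (LINT \<eta>|lborel. norm (tent (- l) 0 r \<eta> * ((2 * pi * \<i> * \<eta>) ^ m * (bessel_weight g (\<beta> + \<eta>) * F (\<beta> + \<eta>)))))" for x
    unfolding piece_alt by (rule order_trans[OF integral_norm_bound]) (simp add: norm_mult)
  then show ?thesis by blast
qed

text \<open>
By Fubini's theorem the piece is a convolution of the modulated function f with the window kernel.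
\<close>

lemma piece_Lp:
  assumes lr: "0 < l" "0 < r" "l \<le> \<rho>" "r \<le> \<rho>" "\<rho> \<le> D * l" "\<rho> \<le> D * r"
    and b: "\<rho> \<le> b" and nb: "\<And>\<eta>. \<eta> \<in> {- l..r} \<Longrightarrow> b\<^sup>2 / 4 \<le> 1 + (\<beta> + \<eta>)\<^sup>2 \<and> 1 + (\<beta> + \<eta>)\<^sup>2 \<le> 5 * b\<^sup>2"
    and p: "1 \<le> p" and f: "integrable lborel f" "f \<in> borel_measurable borel"
  shows "(\<integral>\<^sup>+x. ennreal (norm (piece m \<beta> l r g (fourier f) x) powr p) \<partial>lborel)
    \<le> ennreal ((pi * (5 powr (\<bar>g\<bar> / 2) * b powr g * (4 + 4 * D + 24 * \<bar>g\<bar> + 8 * \<bar>g * (g - 2)\<bar>) * (8 * pi * \<rho>) ^ m)) powr p)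
      * (\<integral>\<^sup>+x. ennreal (norm (f x) powr p) \<partial>lborel)"
proof -
  have \<rho>: "0 < \<rho>" using lr by linarith
  have "0 < D * l" using \<rho> lr by linarith
  then have D: "0 < D" using lr by (simp add: zero_less_mult_iff)
  define \<kappa> where "\<kappa> = 5 powr (\<bar>g\<bar> / 2) * b powr g * (4 + 4 * D + 24 * \<bar>g\<bar> + 8 * \<bar>g * (g - 2)\<bar>) * (8 * pi * \<rho>) ^ m"
  have \<kappa>: "0 \<le> \<kappa>" using D \<rho> by (simp add: \<kappa>_def)
  define A where "A \<eta> = tent (- l) 0 r \<eta> * ((2 * pi * \<i> * \<eta>) ^ m * bessel_weight g (\<beta> + \<eta>))" for \<eta> :: real
  define \<psi> where "\<psi> u = (LINT x|lborel. cis (2 * pi * u * x) * A x)" for u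
  have iA: "integrable lborel A"
    unfolding A_def by (intro integral_tent_cutoff lr continuous_intros)
  note [measurable] = f(2) borel_measurable_integrable[OF iA]
  have \<psi>: "norm (\<psi> u) \<le> \<kappa> * (\<rho> * inverse (1 + (\<rho> * u)\<^sup>2))" for u
  proof -
    have "(1 + (\<rho> * u)\<^sup>2) * norm (\<psi> u) \<le> \<kappa> * \<rho>"
      using window_kernel_bound[OF lr b nb, of u m g] unfolding \<psi>_def A_def \<kappa>_def by (simp add: mult_ac)
    moreover have "0 < 1 + (\<rho> * u)\<^sup>2" by (simp add: add_pos_nonneg)
    ultimately show ?thesis by (simp add: field_simps)
  qed
  have conv: "piece m \<beta> l r g (fourier f) x = (LINT z|lborel. cis (- (2 * pi * z * \<beta>)) * f z * \<psi> (x - z))" for x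
  proof -
    let ?k = "\<lambda>(\<eta>, z). cis (2 * pi * x * \<eta> - 2 * pi * z * (\<beta> + \<eta>))"
    have int: "integrable (lborel \<Otimes>\<^sub>M lborel) (\<lambda>(\<eta>, z). ?k (\<eta>, z) * (A \<eta> * f z))"
      using f(1) by (intro integrable_pair_mult iA) auto
    have "piece m \<beta> l r g (fourier f) x = (LINT \<eta>|lborel. LINT z|lborel. ?k (\<eta>, z) * (A \<eta> * f z))"
      unfolding piece_def A_def[symmetric] fourier_cis
    proof (intro Bochner_Integration.integral_cong refl)
      fix \<eta>
      have "cis (2 * pi * x * \<eta>) * A \<eta> * (LINT z|lborel. cis (- (2 * pi * z * (\<beta> + \<eta>))) * f z)
          = (LINT z|lborel. (cis (2 * pi * x * \<eta>) * A \<eta>) * (cis (- (2 * pi * z * (\<beta> + \<eta>))) * f z))"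
        unfolding integral_mult_right_zero ..
      also have "\<dots> = (LINT z|lborel. ?k (\<eta>, z) * (A \<eta> * f z))"
      proof (intro Bochner_Integration.integral_cong refl)
        fix z
        have "cis (2 * pi * x * \<eta> - 2 * pi * z * (\<beta> + \<eta>)) = cis (2 * pi * x * \<eta>) * cis (- (2 * pi * z * (\<beta> + \<eta>)))"
          by (simp add: cis_mult)
        then show "(cis (2 * pi * x * \<eta>) * A \<eta>) * (cis (- (2 * pi * z * (\<beta> + \<eta>))) * f z) = ?k (\<eta>, z) * (A \<eta> * f z)"
          by (simp add: mult_ac)
      qed
      finally show "cis (2 * pi * x * \<eta>) * A \<eta> * (LINT z|lborel. cis (- (2 * pi * z * (\<beta> + \<eta>))) * f z)
          = (LINT z|lborel. ?k (\<eta>, z) * (A \<eta> * f z))" .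
    qed
    also have "\<dots> = (LINT z|lborel. LINT \<eta>|lborel. ?k (\<eta>, z) * (A \<eta> * f z))"
      using lborel_pair.Fubini_integral[of "\<lambda>\<eta> z. ?k (\<eta>, z) * (A \<eta> * f z)"] int by simp
    also have "\<dots> = (LINT z|lborel. cis (- (2 * pi * z * \<beta>)) * f z * \<psi> (x - z))"
    proof (intro Bochner_Integration.integral_cong refl)
      fix z
      have "cis (2 * pi * x * \<eta> - 2 * pi * z * (\<beta> + \<eta>)) = cis (- (2 * pi * z * \<beta>)) * cis (2 * pi * (x - z) * \<eta>)" for \<eta>
        by (simp add: cis_mult algebra_simps)
      then have "(LINT \<eta>|lborel. ?k (\<eta>, z) * (A \<eta> * f z))
          = (LINT \<eta>|lborel. (cis (- (2 * pi * z * \<beta>)) * f z) * (cis (2 * pi * (x - z) * \<eta>) * A \<eta>))"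
        by (intro Bochner_Integration.integral_cong refl) (simp add: mult_ac)
      also have "\<dots> = cis (- (2 * pi * z * \<beta>)) * f z * \<psi> (x - z)"
        unfolding \<psi>_def integral_mult_right_zero ..
      finally show "(LINT \<eta>|lborel. ?k (\<eta>, z) * (A \<eta> * f z)) = cis (- (2 * pi * z * \<beta>)) * f z * \<psi> (x - z)" .
    qed
    finally show ?thesis .
  qed
  have "ennreal (norm (piece m \<beta> l r g (fourier f) x))
      \<le> (\<integral>\<^sup>+z. ennreal (\<kappa> * (\<rho> * inverse (1 + (\<rho> * (x - z))\<^sup>2))) * ennreal (norm (f z)) \<partial>lborel)" for x
  proof (cases "integrable lborel (\<lambda>z. cis (- (2 * pi * z * \<beta>)) * f z * \<psi> (x - z))")
    case True
    have "ennreal (norm (piece m \<beta> l r g (fourier f) x))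
        \<le> (\<integral>\<^sup>+z. ennreal (norm (cis (- (2 * pi * z * \<beta>)) * f z * \<psi> (x - z))) \<partial>lborel)"
      unfolding conv by (rule integral_norm_bound_ennreal[OF True])
    also have "\<dots> \<le> (\<integral>\<^sup>+z. ennreal (\<kappa> * (\<rho> * inverse (1 + (\<rho> * (x - z))\<^sup>2))) * ennreal (norm (f z)) \<partial>lborel)"
    proof (rule nn_integral_mono)
      fix z
      have "norm (cis (- (2 * pi * z * \<beta>)) * f z * \<psi> (x - z)) = norm (\<psi> (x - z)) * norm (f z)"
        by (simp add: norm_mult)
      also have "\<dots> \<le> \<kappa> * (\<rho> * inverse (1 + (\<rho> * (x - z))\<^sup>2)) * norm (f z)"
        by (intro mult_right_mono \<psi>) auto
      finally show "ennreal (norm (cis (- (2 * pi * z * \<beta>)) * f z * \<psi> (x - z)))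
          \<le> ennreal (\<kappa> * (\<rho> * inverse (1 + (\<rho> * (x - z))\<^sup>2))) * ennreal (norm (f z))"
        using \<kappa> \<rho> by (simp add: ennreal_mult[symmetric] ennreal_leI)
    qed
    finally show ?thesis .
  next
    case False
    then show ?thesis by (simp add: conv not_integrable_integral_eq)
  qed
  from cauchy_kernel_Lp[OF \<rho> \<kappa> p f(2) this]
  show ?thesis unfolding \<kappa>_def .
qed

text \<open>
Fubini's theorem moves the integral against the measure outside, and undoing the translation of the
frequencies produces the phase of \<open>osc\<close>.
\<close>

lemma (in real_distribution) piece_osc:
  fixes F :: "real \<Rightarrow> complex"
  assumes lr: "0 < l" "0 < r" and F: "continuous_on UNIV F"
  shows "(LINT \<xi>|lborel. cis (2 * pi * x * \<xi>) * (tent (\<beta> - l) \<beta> (\<beta> + r) \<xi> * (bessel_weight g \<xi> * F \<xi> * fourier_measure M (t * \<xi>))))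
    = cis (2 * pi * \<beta> * x) * osc M \<beta> (\<lambda>_. 1) (piece 0 \<beta> l r g F) x t"
proof -
  have cF: "continuous_on S (\<lambda>\<eta>. F (\<beta> + \<eta>))" for S
    by (intro continuous_on_compose2[OF F] continuous_intros) auto
  define A where "A \<eta> = tent (- l) 0 r \<eta> * (bessel_weight g (\<beta> + \<eta>) * F (\<beta> + \<eta>))" for \<eta> :: real
  have iA: "integrable lborel A"
    unfolding A_def by (intro integral_tent_cutoff lr continuous_intros cF)
  note [measurable] = borel_measurable_integrable[OF iA]
  interpret P: pair_sigma_finite lborel M ..
  let ?k = "\<lambda>\<eta> y. cis (2 * pi * (x - t * y) * (\<beta> + \<eta>))"
  have int: "integrable (lborel \<Otimes>\<^sub>M M) (\<lambda>(\<eta>, y). ?k \<eta> y * A \<eta>)"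
  proof (rule P.Fubini_integrable)
    show "integrable lborel (\<lambda>\<eta>. LINT y|M. norm (case (\<eta>, y) of (\<eta>, y) \<Rightarrow> ?k \<eta> y * A \<eta>))"
      using iA by (simp add: norm_mult prob_space[simplified])
    show "AE \<eta> in lborel. integrable M (\<lambda>y. case (\<eta>, y) of (\<eta>, y) \<Rightarrow> ?k \<eta> y * A \<eta>)"
    proof (intro AE_I2)
      fix \<eta>
      show "integrable M (\<lambda>y. case (\<eta>, y) of (\<eta>, y) \<Rightarrow> ?k \<eta> y * A \<eta>)"
        by (rule integrable_bounded[of _ "norm (A \<eta>)"]) (simp_all add: norm_mult)
    qed
  qed measurable
  have fm: "fourier_measure M (t * \<xi>) = (LINT y|M. cis (- (2 * pi * t * y * \<xi>)))" for \<xi>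
    unfolding fourier_measure_def char_def by (simp add: cis_conv_exp mult_ac)
  have "(LINT \<xi>|lborel. cis (2 * pi * x * \<xi>) * (tent (\<beta> - l) \<beta> (\<beta> + r) \<xi> * (bessel_weight g \<xi> * F \<xi> * fourier_measure M (t * \<xi>))))
      = \<bar>1\<bar> *\<^sub>R (LINT \<eta>|lborel. cis (2 * pi * x * (\<beta> + 1 * \<eta>)) * (tent (\<beta> - l) \<beta> (\<beta> + r) (\<beta> + 1 * \<eta>)
          * (bessel_weight g (\<beta> + 1 * \<eta>) * F (\<beta> + 1 * \<eta>) * fourier_measure M (t * (\<beta> + 1 * \<eta>)))))"
    by (rule lborel_integral_real_affine) simp
  also have "\<dots> = (LINT \<eta>|lborel. LINT y|M. ?k \<eta> y * A \<eta>)"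
  proof (simp only: abs_one scaleR_one mult_1, intro Bochner_Integration.integral_cong refl)
    fix \<eta>
    have ts: "tent (\<beta> - l) \<beta> (\<beta> + r) (\<beta> + \<eta>) = tent (- l) 0 r \<eta>"
      using tent_shift[of "- l" \<beta> 0 r \<eta>] by (simp add: add.commute)
    have "(LINT y|M. ?k \<eta> y * A \<eta>) = (LINT y|M. (cis (2 * pi * x * (\<beta> + \<eta>)) * A \<eta>) * cis (- (2 * pi * t * y * (\<beta> + \<eta>))))"
    proof (intro Bochner_Integration.integral_cong refl)
      fix y
      have "?k \<eta> y = cis (2 * pi * x * (\<beta> + \<eta>)) * cis (- (2 * pi * t * y * (\<beta> + \<eta>)))"
        by (simp add: cis_mult algebra_simps)
      then show "?k \<eta> y * A \<eta> = (cis (2 * pi * x * (\<beta> + \<eta>)) * A \<eta>) * cis (- (2 * pi * t * y * (\<beta> + \<eta>)))"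
        by (simp add: mult_ac)
    qed
    also have "\<dots> = (cis (2 * pi * x * (\<beta> + \<eta>)) * A \<eta>) * fourier_measure M (t * (\<beta> + \<eta>))"
      unfolding fm by (rule integral_mult_right_zero)
    finally have eq: "(LINT y|M. ?k \<eta> y * A \<eta>) = (cis (2 * pi * x * (\<beta> + \<eta>)) * A \<eta>) * fourier_measure M (t * (\<beta> + \<eta>))" .
    show "cis (2 * pi * x * (\<beta> + \<eta>)) * (tent (\<beta> - l) \<beta> (\<beta> + r) (\<beta> + \<eta>)
          * (bessel_weight g (\<beta> + \<eta>) * F (\<beta> + \<eta>) * fourier_measure M (t * (\<beta> + \<eta>)))) = (LINT y|M. ?k \<eta> y * A \<eta>)"
      unfolding ts eq unfolding A_def by (simp only: mult_ac)
  qed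
  also have "\<dots> = (LINT y|M. LINT \<eta>|lborel. ?k \<eta> y * A \<eta>)"
    by (rule P.Fubini_integral[OF int, symmetric])
  also have "\<dots> = (LINT y|M. cis (2 * pi * \<beta> * x) * (1 * cis (- (2 * pi * \<beta> * t * y)) * piece 0 \<beta> l r g F (x - t * y)))"
  proof (intro Bochner_Integration.integral_cong refl)
    fix y
    have "?k \<eta> y = cis (2 * pi * \<beta> * x) * cis (- (2 * pi * \<beta> * t * y)) * cis (2 * pi * (x - t * y) * \<eta>)" for \<eta>
      by (simp add: cis_mult algebra_simps)
    then have "(LINT \<eta>|lborel. ?k \<eta> y * A \<eta>)
        = (LINT \<eta>|lborel. (cis (2 * pi * \<beta> * x) * cis (- (2 * pi * \<beta> * t * y))) * (cis (2 * pi * (x - t * y) * \<eta>) * A \<eta>))"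
      by (simp add: mult.assoc)
    also have "\<dots> = (cis (2 * pi * \<beta> * x) * cis (- (2 * pi * \<beta> * t * y))) * piece 0 \<beta> l r g F (x - t * y)"
      unfolding integral_mult_right_zero piece_def A_def by (simp add: mult_ac)
    finally show "(LINT \<eta>|lborel. ?k \<eta> y * A \<eta>)
        = cis (2 * pi * \<beta> * x) * (1 * cis (- (2 * pi * \<beta> * t * y)) * piece 0 \<beta> l r g F (x - t * y))"
      by (simp add: mult.assoc)
  qed
  also have "\<dots> = cis (2 * pi * \<beta> * x) * osc M \<beta> (\<lambda>_. 1) (piece 0 \<beta> l r g F) x t"
    unfolding osc_def by (rule integral_mult_right_zero)
  finally show ?thesis .
qed

subsection \<open>The frequency grid\<close>

definition node :: "real \<Rightarrow> nat \<Rightarrow> real" where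
  "node \<theta> n = (if n = 0 then 0 else \<theta> ^ (n - 1))"

lemma node_simps [simp]: "node \<theta> 0 = 0" "node \<theta> (Suc n) = \<theta> ^ n"
  by (simp_all add: node_def)

lemma node_less: "1 < \<theta> \<Longrightarrow> node \<theta> n < node \<theta> (Suc n)"
  by (cases n) auto

lemma tent_partition_nonneg:
  assumes \<theta>: "1 < \<theta>" and \<xi>: "0 \<le> \<xi>"
  shows "(\<lambda>n. tent (node \<theta> n) (node \<theta> (Suc n)) (node \<theta> (Suc (Suc n))) \<xi>) sums (1 - tent (- 1) 0 1 \<xi>)"
    and "tent (- node \<theta> (Suc (Suc n))) (- node \<theta> (Suc n)) (- node \<theta> n) \<xi> = 0"
proof -
  define R where "R n = ramp (node \<theta> n) (node \<theta> (Suc n)) \<xi>" for n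
  have "R \<longlonglongrightarrow> 0"
  proof (rule tendsto_eventually)
    obtain K where K: "\<xi> < \<theta> ^ K" using real_arch_pow[OF \<theta>] by blast
    have "R n = 0" if n: "n \<ge> Suc K" for n
    proof -
      obtain m where m: "n = Suc m" "K \<le> m" using n by (cases n) auto
      have "\<theta> ^ K \<le> \<theta> ^ m" using \<theta> m by (intro power_increasing) auto
      then show ?thesis unfolding R_def using K node_less[OF \<theta>, of n] by (intro ramp_simps) (auto simp: m)
    qed
    then show "\<forall>\<^sub>F n in sequentially. R n = 0" by (auto simp: eventually_sequentially)
  qed
  from telescope_sums'[OF this] have "(\<lambda>n. R n - R (Suc n)) sums (R 0 - 0)" .
  moreover have "R 0 = 1 - tent (- 1) 0 1 \<xi>"
    unfolding R_def tent_def using \<xi> by (simp add: ramp_simps(2))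
  ultimately show "(\<lambda>n. tent (node \<theta> n) (node \<theta> (Suc n)) (node \<theta> (Suc (Suc n))) \<xi>) sums (1 - tent (- 1) 0 1 \<xi>)"
    unfolding R_def tent_def by simp
  show "tent (- node \<theta> (Suc (Suc n))) (- node \<theta> (Suc n)) (- node \<theta> n) \<xi> = 0"
  proof (rule tent_simps(2))
    have "0 \<le> node \<theta> n" using \<theta> by (auto simp: node_def)
    then show "- node \<theta> n \<le> \<xi>" using \<xi> by linarith
  qed (use node_less[OF \<theta>, of n] node_less[OF \<theta>, of "Suc n"] in linarith)+
qed

text \<open>
The sum telescopes on the half line that contains \<xi>, and the tents of the other half line vanish.
\<close>

lemma tent_partition:
  assumes \<theta>: "1 < \<theta>"
  shows "(\<lambda>n. tent (node \<theta> n) (node \<theta> (Suc n)) (node \<theta> (Suc (Suc n))) \<xi>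
      + tent (- node \<theta> (Suc (Suc n))) (- node \<theta> (Suc n)) (- node \<theta> n) \<xi>) sums (1 - tent (- 1) 0 1 \<xi>)"
proof (cases "0 \<le> \<xi>")
  case True
  then show ?thesis using tent_partition_nonneg[OF \<theta> True] by simp
next
  case False
  then have \<xi>: "0 \<le> - \<xi>" by simp
  have m: "tent (node \<theta> n) (node \<theta> (Suc n)) (node \<theta> (Suc (Suc n))) (- \<xi>)
      = tent (- node \<theta> (Suc (Suc n))) (- node \<theta> (Suc n)) (- node \<theta> n) \<xi>"
    "tent (- node \<theta> (Suc (Suc n))) (- node \<theta> (Suc n)) (- node \<theta> n) (- \<xi>)
      = tent (node \<theta> n) (node \<theta> (Suc n)) (node \<theta> (Suc (Suc n))) \<xi>" for n
    using tent_minus[of "node \<theta> n" "node \<theta> (Suc n)" "node \<theta> (Suc (Suc n))" \<xi>]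
      tent_minus[of "- node \<theta> (Suc (Suc n))" "- node \<theta> (Suc n)" "- node \<theta> n" \<xi>]
      node_less[OF \<theta>, of n] node_less[OF \<theta>, of "Suc n"] by auto
  have c: "tent (- 1) 0 1 (- \<xi>) = tent (- 1) 0 1 \<xi>" using tent_minus[of "- 1" 0 1 \<xi>] by simp
  show ?thesis using tent_partition_nonneg[OF \<theta> \<xi>] unfolding m c by simp
qed

section \<open>Summing the frequency pieces\<close>

lemma power_powr_commute: "(x ^ n) powr p = (x powr p) ^ n" for x p :: real
  by (induction n) (auto simp: powr_mult)

text \<open>
The p-th power of the mixed norm with exponent r in t over [1,2] and exponent p in x.
\<close>

definition mixed :: "real \<Rightarrow> real \<Rightarrow> (real \<Rightarrow> real \<Rightarrow> ennreal) \<Rightarrow> ennreal" where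
  "mixed p r a = (\<integral>\<^sup>+x. enn_powr (\<integral>\<^sup>+t\<in>{1..2}. enn_powr (a x t) r \<partial>lborel) (p / r) \<partial>lborel)"

lemma mixed_mono:
  assumes "0 < p" "0 < r" "\<And>x t. t \<in> {1..2} \<Longrightarrow> a x t \<le> b x t"
  shows "mixed p r a \<le> mixed p r b"
proof -
  have "enn_powr (a x t) r * indicator {1..2} t \<le> enn_powr (b x t) r * indicator {1..2} t" for x t
    using assms(2,3) by (cases "t \<in> {1..2}") (auto intro!: enn_powr_mono)
  then show ?thesis unfolding mixed_def using assms(1,2)
    by (intro nn_integral_mono enn_powr_mono[of "p / r"]) auto
qed

lemma mixed_add:
  assumes pr: "0 < p" "0 < r"
    and [measurable]: "case_prod a \<in> borel_measurable (borel \<Otimes>\<^sub>M borel)" "case_prod b \<in> borel_measurable (borel \<Otimes>\<^sub>M borel)"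
  shows "mixed p r (\<lambda>x t. a x t + b x t) \<le> ennreal (2 powr (p + p / r)) * (mixed p r a + mixed p r b)"
proof -
  define A where "A x = (\<integral>\<^sup>+t\<in>{1..2}. enn_powr (a x t) r \<partial>lborel)" for x
  define B where "B x = (\<integral>\<^sup>+t\<in>{1..2}. enn_powr (b x t) r \<partial>lborel)" for x
  have [measurable]: "A \<in> borel_measurable borel" "B \<in> borel_measurable borel"
    unfolding A_def B_def by measurable
  have "enn_powr (\<integral>\<^sup>+t\<in>{1..2}. enn_powr (a x t + b x t) r \<partial>lborel) (p / r)
      \<le> ennreal (2 powr (p + p / r)) * (enn_powr (A x) (p / r) + enn_powr (B x) (p / r))" for x
  proof -
    have "(\<integral>\<^sup>+t\<in>{1..2}. enn_powr (a x t + b x t) r \<partial>lborel)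
        \<le> (\<integral>\<^sup>+t\<in>{1..2}. ennreal (2 powr r) * (enn_powr (a x t) r + enn_powr (b x t) r) \<partial>lborel)"
      using pr by (intro nn_integral_mono mult_right_mono enn_powr_add_le) auto
    also have "\<dots> = ennreal (2 powr r) * (A x + B x)"
      unfolding A_def B_def by (simp add: distrib_left distrib_right nn_integral_add nn_integral_cmult mult.assoc)
    finally have "enn_powr (\<integral>\<^sup>+t\<in>{1..2}. enn_powr (a x t + b x t) r \<partial>lborel) (p / r)
        \<le> enn_powr (ennreal (2 powr r) * (A x + B x)) (p / r)"
      using pr by (intro enn_powr_mono) auto
    also have "\<dots> = ennreal (2 powr p) * enn_powr (A x + B x) (p / r)"
      using pr by (simp add: enn_powr_mult enn_powr_ennreal powr_powr)
    also have "\<dots> \<le> ennreal (2 powr p) * (ennreal (2 powr (p / r)) * (enn_powr (A x) (p / r) + enn_powr (B x) (p / r)))"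
      using pr by (intro mult_left_mono enn_powr_add_le) auto
    finally show ?thesis by (simp add: powr_add ennreal_mult mult.assoc)
  qed
  then have "mixed p r (\<lambda>x t. a x t + b x t)
      \<le> (\<integral>\<^sup>+x. ennreal (2 powr (p + p / r)) * (enn_powr (A x) (p / r) + enn_powr (B x) (p / r)) \<partial>lborel)"
    unfolding mixed_def by (intro nn_integral_mono)
  also have "\<dots> = ennreal (2 powr (p + p / r)) * (mixed p r a + mixed p r b)"
    unfolding mixed_def A_def[symmetric] B_def[symmetric] by (simp add: nn_integral_cmult nn_integral_add)
  finally show ?thesis .
qed

text \<open>
The bounds decay like q^n.  Half of the decay pays for the weights s^n in the summation over n, and the other
half makes the resulting series converge.
\<close>

lemma mixed_suminf:
  assumes pr: "0 < p" "p \<le> r" and q: "0 < q" "q < 1" and M: "0 \<le> M"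
    and [measurable]: "\<And>n. case_prod (a n) \<in> borel_measurable (borel \<Otimes>\<^sub>M borel)"
    and le: "\<And>n. mixed p r (a n) \<le> ennreal (M * q ^ n) * Q"
  shows "mixed p r (\<lambda>x t. \<Sum>n. a n x t)
    \<le> ennreal ((1 / (1 - q powr (1 / (2 * p)))) powr p * (M * (1 / (1 - q powr (1 / 2))))) * Q"
proof -
  have r: "0 < r" using pr by linarith
  define s where "s = q powr (1 / (2 * p))"
  have "s < 1 powr (1 / (2 * p))" unfolding s_def using q pr by (intro powr_less_mono2) auto
  then have s: "0 < s" "s < 1" using q by (auto simp: s_def)
  have "q powr (1 / 2) < 1 powr (1 / 2)" using q by (intro powr_less_mono2) auto
  then have q2: "0 < q powr (1 / 2)" "q powr (1 / 2) < 1" using q by simp_all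
  define C where "C = 1 / (1 - s)"
  have C: "0 < C" using s by (simp add: C_def)
  have geo: "(\<Sum>n. ennreal (z ^ n)) = ennreal (1 / (1 - z))" if "0 < z" "z < 1" for z :: real
    using that by (subst suminf_ennreal2) (auto simp: suminf_geometric summable_geometric)
  define X where "X n x = (\<integral>\<^sup>+t\<in>{1..2}. enn_powr (a n x t) r \<partial>lborel)" for n x
  have [measurable]: "X n \<in> borel_measurable borel" for n unfolding X_def by measurable
  have [measurable]: "a n x \<in> borel_measurable borel" for n x by measurable
  have pt: "enn_powr (\<integral>\<^sup>+t\<in>{1..2}. enn_powr (\<Sum>n. a n x t) r \<partial>lborel) (p / r)
      \<le> ennreal (C powr p) * (\<Sum>n. ennreal ((s ^ n) powr (- p)) * enn_powr (X n x) (p / r))" for x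
  proof -
    have cpos: "0 < s ^ n" for n using s by simp
    have le_C: "(\<Sum>n. ennreal (s ^ n)) \<le> ennreal C" unfolding geo[OF s] C_def ..
    have wsum: "enn_powr (\<Sum>n. a n x t) r
        \<le> ennreal (C powr r) * (\<Sum>n. ennreal ((s ^ n) powr (- r)) * enn_powr (a n x t) r)" for t
      by (rule enn_powr_suminf_weighted[OF r cpos le_C])
    have "(\<integral>\<^sup>+t\<in>{1..2}. enn_powr (\<Sum>n. a n x t) r \<partial>lborel)
        \<le> (\<integral>\<^sup>+t\<in>{1..2}. ennreal (C powr r) * (\<Sum>n. ennreal ((s ^ n) powr (- r)) * enn_powr (a n x t) r) \<partial>lborel)"
      by (intro nn_integral_mono mult_right_mono wsum) simp
    also have "\<dots> = (\<integral>\<^sup>+t. ennreal (C powr r) * (\<Sum>n. ennreal ((s ^ n) powr (- r)) * (enn_powr (a n x t) r * indicator {1..2} t)) \<partial>lborel)"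
      by (intro nn_integral_cong) (auto split: split_indicator)
    also have "\<dots> = ennreal (C powr r) * (\<Sum>n. ennreal ((s ^ n) powr (- r)) * X n x)"
      unfolding X_def by (subst nn_integral_cmult, measurable, subst nn_integral_suminf, measurable, subst nn_integral_cmult, measurable)
    finally have "enn_powr (\<integral>\<^sup>+t\<in>{1..2}. enn_powr (\<Sum>n. a n x t) r \<partial>lborel) (p / r)
        \<le> enn_powr (ennreal (C powr r) * (\<Sum>n. ennreal ((s ^ n) powr (- r)) * X n x)) (p / r)"
      using pr r by (intro enn_powr_mono) auto
    also have "\<dots> = ennreal (C powr p) * enn_powr (\<Sum>n. ennreal ((s ^ n) powr (- r)) * X n x) (p / r)"
      using pr r by (simp add: enn_powr_mult enn_powr_ennreal powr_powr)
    also have "\<dots> \<le> ennreal (C powr p) * (\<Sum>n. enn_powr (ennreal ((s ^ n) powr (- r)) * X n x) (p / r))"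
      using pr r by (intro mult_left_mono enn_powr_suminf_subadditive) auto
    also have "(\<lambda>n. enn_powr (ennreal ((s ^ n) powr (- r)) * X n x) (p / r))
        = (\<lambda>n. ennreal ((s ^ n) powr (- p)) * enn_powr (X n x) (p / r))"
      using pr r by (simp add: enn_powr_mult enn_powr_ennreal powr_powr)
    finally show ?thesis .
  qed
  have "mixed p r (\<lambda>x t. \<Sum>n. a n x t)
      \<le> (\<integral>\<^sup>+x. ennreal (C powr p) * (\<Sum>n. ennreal ((s ^ n) powr (- p)) * enn_powr (X n x) (p / r)) \<partial>lborel)"
    unfolding mixed_def by (intro nn_integral_mono pt)
  also have "\<dots> = ennreal (C powr p) * (\<Sum>n. ennreal ((s ^ n) powr (- p)) * mixed p r (a n))"
    unfolding mixed_def X_def[symmetric]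
    by (subst nn_integral_cmult, measurable, subst nn_integral_suminf, measurable, subst nn_integral_cmult, measurable)
  also have "\<dots> \<le> ennreal (C powr p) * (\<Sum>n. ennreal (M * (q powr (1 / 2)) ^ n) * Q)"
  proof (intro mult_left_mono suminf_le)
    fix n
    have "ennreal ((s ^ n) powr (- p)) * mixed p r (a n) \<le> ennreal ((s ^ n) powr (- p)) * (ennreal (M * q ^ n) * Q)"
      by (intro mult_left_mono le) auto
    also have "\<dots> = ennreal ((s ^ n) powr (- p) * (M * q ^ n)) * Q"
      using M q by (simp add: ennreal_mult mult.assoc)
    also have "(s ^ n) powr (- p) * (M * q ^ n) = M * (q powr (1 / 2)) ^ n"
    proof -
      have "(s ^ n) powr (- p) * q ^ n = (q powr (1 / 2)) ^ n"
      proof -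
        have "(s ^ n) powr (- p) = (s powr (- p)) ^ n" by (rule power_powr_commute)
        also have "s powr (- p) = q powr (- (1 / 2))" unfolding s_def using pr by (simp add: powr_powr)
        finally have "(s ^ n) powr (- p) * q ^ n = (q powr (- (1 / 2)) * q) ^ n" by (simp add: power_mult_distrib)
        also have "q powr (- (1 / 2)) * q = q powr (- (1 / 2)) * q powr 1" using q by simp
        also have "\<dots> = q powr (1 / 2)" by (simp only: powr_add[symmetric]) simp
        finally show ?thesis .
      qed
      then show ?thesis by (simp add: mult_ac)
    qed
    finally show "ennreal ((s ^ n) powr (- p)) * mixed p r (a n) \<le> ennreal (M * (q powr (1 / 2)) ^ n) * Q" .
  qed auto
  also have "\<dots> = ennreal (C powr p) * (ennreal M * ennreal (1 / (1 - q powr (1 / 2))) * Q)"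
    using M q2 geo[OF q2] by (simp add: ennreal_mult ennreal_suminf_multc[symmetric] ennreal_suminf_cmult[symmetric])
  also have "\<dots> = ennreal (C powr p * (M * (1 / (1 - q powr (1 / 2))))) * Q"
  proof -
    have "0 \<le> 1 / (1 - q powr (1 / 2))" using q2 by simp
    then show ?thesis using M
      by (simp only: mult.assoc ennreal_mult_assoc mult_nonneg_nonneg powr_ge_zero)
  qed
  finally show ?thesis unfolding C_def s_def .
qed

context cantor_system
begin

text \<open>
Choose k as the number of generations resolved at frequency b, so that N^k \<le> b < N^(k+1).  The
constant of the iteration is Bc \<le> c0^(p/2) N^e and N0^(p/2) \<ge> c0^(p/2) N, so each generation
contributes at most N^(e-1), which amounts to b^(e-1) in total.
\<close>

lemma piece_energy:
  assumes p: "2 \<le> p" and C: "0 \<le> C"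
    and Lam: "\<And>j a. a \<in> pts j \<Longrightarrow> Lambda_set p C (S (Suc j) a)"
    and f: "integrable lborel f" "f \<in> borel_measurable borel"
    and lr: "0 < l" "0 < r" "l \<le> \<rho>" "r \<le> \<rho>" "\<rho> \<le> real N * l" "\<rho> \<le> real N * r"
    and b: "1 \<le> b" and win: "(b = 1 \<and> \<rho> = 1 \<and> \<bar>\<beta>\<bar> \<le> 1) \<or> (\<bar>\<beta>\<bar> = b \<and> \<rho> = b / real N)"
    and w: "w \<in> borel_measurable borel" "\<And>y. norm (w y) \<le> 1"
    and c0: "0 < c0" "c0 * real N powr (2 / p) \<le> real N0" and e: "0 < e" "e < 1"
    and big: "2 powr (2 * p + 1) * C powr p * (1 + (4 * pi) powr p + (16 * pi) powr p) \<le> c0 powr (p / 2) * real N powr e"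
  shows "energy \<mu> p \<beta> w (piece m \<beta> l r g (fourier f))
    \<le> ennreal (5 powr p * real N powr (1 - e) * b powr (e - 1)
        * (pi * (5 powr (\<bar>g\<bar> / 2) * b powr g * (4 + 4 * real N + 24 * \<bar>g\<bar> + 8 * \<bar>g * (g - 2)\<bar>) * (8 * pi * \<rho>) ^ m)) powr p)
      * (\<integral>\<^sup>+x. ennreal (norm (f x) powr p) \<partial>lborel)"
proof -
  define k where "k = nat \<lfloor>log (real N) b\<rfloor>"
  have N1: "1 < real N" using N by simp
  have lb: "0 \<le> log (real N) b" using N1 b by simp
  have kk: "real k \<le> log (real N) b" "log (real N) b < real k + 1" using lb unfolding k_def by linarith+
  have k: "real N ^ k \<le> b" "b \<le> real N * real N ^ k"
  proof -
    have "real N powr real k \<le> b" using kk(1) N1 b by (simp add: le_log_iff)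
    then show "real N ^ k \<le> b" using N1 by (simp add: powr_realpow)
    have "b \<le> real N powr (real k + 1)" using kk(2) N1 b by (simp add: log_less_iff less_imp_le)
    then show "b \<le> real N * real N ^ k" using N1 by (simp add: powr_add powr_realpow mult.commute)
  qed
  have \<rho>: "0 < \<rho>" "\<rho> \<le> b"
  proof -
    show "0 < \<rho>" using lr by linarith
    have "b / real N \<le> b / 1" using N1 b by (intro divide_left_mono) auto
    then show "\<rho> \<le> b" using win by auto
  qed
  have nb: "b\<^sup>2 / 4 \<le> 1 + (\<beta> + \<eta>)\<^sup>2 \<and> 1 + (\<beta> + \<eta>)\<^sup>2 \<le> 5 * b\<^sup>2" if \<eta>: "\<eta> \<in> {- l..r}" for \<eta>
  proof -
    have ae: "\<bar>\<eta>\<bar> \<le> \<rho>" using \<eta> lr by auto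
    have b2: "1 \<le> b\<^sup>2" using b by simp
    from win show ?thesis
    proof
      assume *: "b = 1 \<and> \<rho> = 1 \<and> \<bar>\<beta>\<bar> \<le> 1"
      then have "\<bar>\<beta> + \<eta>\<bar> \<le> 2" using ae by linarith
      then have "(\<beta> + \<eta>)\<^sup>2 \<le> 2\<^sup>2" by (metis abs_ge_zero power2_abs power_mono)
      moreover have "0 \<le> (\<beta> + \<eta>)\<^sup>2" by simp
      ultimately show ?thesis using * by simp
    next
      assume *: "\<bar>\<beta>\<bar> = b \<and> \<rho> = b / real N"
      have "b / real N \<le> b / 2" using N b by (intro divide_left_mono) auto
      then have ae': "\<bar>\<eta>\<bar> \<le> b / 2" using ae * by linarith
      then have 1: "\<bar>\<beta> + \<eta>\<bar> \<le> 2 * b" "b / 2 \<le> \<bar>\<beta> + \<eta>\<bar>" using * b by linarith+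
      have "(\<beta> + \<eta>)\<^sup>2 \<le> (2 * b)\<^sup>2" using 1(1) by (metis abs_ge_zero power2_abs power_mono)
      moreover have "(b / 2)\<^sup>2 \<le> (\<beta> + \<eta>)\<^sup>2" using 1(2) b by (metis power2_abs power_mono divide_nonneg_nonneg order_trans zero_le_numeral zero_le_one)
      ultimately show ?thesis using b2 by (simp add: power_mult_distrib power_divide)
    qed
  qed
  define \<kappa> where "\<kappa> = 5 powr (\<bar>g\<bar> / 2) * b powr g * (4 + 4 * real N + 24 * \<bar>g\<bar> + 8 * \<bar>g * (g - 2)\<bar>)"
  have \<kappa>: "0 \<le> \<kappa>" unfolding \<kappa>_def by (intro mult_nonneg_nonneg) auto
  define If where "If = (\<integral>\<^sup>+x. ennreal (norm (f x) powr p) \<partial>lborel)"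
  define R where "R = (8 * pi * \<rho>) powr p"
  have Rm: "R ^ n = ((8 * pi * \<rho>) ^ n) powr p" for n
    unfolding R_def power_powr_commute ..
  have cont: "continuous_on UNIV (fourier f)" by (rule continuous_fourier[OF f(1)])
  have Hb: "(\<integral>\<^sup>+x. ennreal (norm (piece n \<beta> l r g (fourier f) x) powr p) \<partial>lborel) \<le> ennreal (R ^ n) * (ennreal ((pi * \<kappa>) powr p) * If)" for n
  proof -
    have "(\<integral>\<^sup>+x. ennreal (norm (piece n \<beta> l r g (fourier f) x) powr p) \<partial>lborel)
        \<le> ennreal ((pi * (\<kappa> * (8 * pi * \<rho>) ^ n)) powr p) * If"
      unfolding \<kappa>_def If_def using p by (intro piece_Lp lr \<rho>(2) nb f) auto
    also have "(pi * (\<kappa> * (8 * pi * \<rho>) ^ n)) powr p = R ^ n * (pi * \<kappa>) powr p"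
      unfolding Rm by (simp add: powr_mult mult_ac)
    also have "ennreal (R ^ n * (pi * \<kappa>) powr p) * If = ennreal (R ^ n) * (ennreal ((pi * \<kappa>) powr p) * If)"
      by (simp add: ennreal_mult R_def mult.assoc)
    finally show ?thesis .
  qed
  have kc: "k = 0 \<or> (real N ^ k \<le> \<bar>\<beta>\<bar> \<and> (2 * real N / \<bar>\<beta>\<bar>) powr p * R \<le> (16 * pi) powr p)"
    using win
  proof
    assume *: "b = 1 \<and> \<rho> = 1 \<and> \<bar>\<beta>\<bar> \<le> 1"
    then have "k = 0" by (simp add: k_def)
    then show ?thesis ..
  next
    assume *: "\<bar>\<beta>\<bar> = b \<and> \<rho> = b / real N"
    have "(2 * real N / \<bar>\<beta>\<bar>) powr p * R = (2 * real N / \<bar>\<beta>\<bar> * (8 * pi * \<rho>)) powr p"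
      by (simp only: R_def powr_mult)
    also have "2 * real N / \<bar>\<beta>\<bar> * (8 * pi * \<rho>) = 16 * pi" using * b N1 by simp
    finally show ?thesis using * k by simp
  qed
  define Bc where "Bc = 2 powr (2 * p + 1) * C powr p * (1 + (4 * pi) powr p + (16 * pi) powr p)"
  have Bc: "0 \<le> Bc" by (simp add: Bc_def)
  have it: "energy \<mu> p \<beta> w (piece m \<beta> l r g (fourier f))
    \<le> ennreal ((Bc * real N0 powr (p / 2 - 1)) ^ k * (real N0 ^ k * (5 / real N0 ^ k) powr p) * R ^ m)
      * (ennreal ((pi * \<kappa>) powr p) * If)"
    unfolding Bc_def
    by (rule energy_iterate[where H = "\<lambda>m. piece m \<beta> l r g (fourier f)",
          OF p C Lam piece_derivative[OF lr(1,2) cont] piece_bounded[OF lr(1,2) cont] _ Hb _ kc w])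
      (simp_all add: R_def)
  have n0: "0 < real N0" using N0 by simp
  have real: "(Bc * real N0 powr (p / 2 - 1)) ^ k * (real N0 ^ k * (5 / real N0 ^ k) powr p)
      \<le> 5 powr p * real N powr (1 - e) * b powr (e - 1)"
  proof -
    have "5 / real N0 ^ k = 5 * inverse (real N0) ^ k" by (simp add: power_inverse divide_inverse)
    moreover have "(5 * inverse (real N0) ^ k) powr p = 5 powr p * (inverse (real N0) powr p) ^ k"
      by (simp only: powr_mult power_powr_commute)
    moreover have "inverse (real N0) powr p = real N0 powr (- p)" by (simp add: inverse_powr powr_minus)
    ultimately have "(5 / real N0 ^ k) powr p = 5 powr p * (real N0 powr (- p)) ^ k" by simp
    then have "(Bc * real N0 powr (p / 2 - 1)) ^ k * (real N0 ^ k * (5 / real N0 ^ k) powr p)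
        = 5 powr p * (Bc * (real N0 powr (p / 2 - 1) * real N0 powr 1 * real N0 powr (- p))) ^ k"
      using n0 by (simp add: power_mult_distrib mult_ac)
    also have "real N0 powr (p / 2 - 1) * real N0 powr 1 * real N0 powr (- p) = real N0 powr (- (p / 2))"
      by (simp only: powr_add[symmetric]) simp
    also have "5 powr p * (Bc * real N0 powr (- (p / 2))) ^ k \<le> 5 powr p * (real N powr (e - 1)) ^ k"
    proof (intro mult_left_mono power_mono)
      have "(c0 * real N powr (2 / p)) powr (p / 2) \<le> real N0 powr (p / 2)"
        using c0 p by (intro powr_mono2) auto
      then have "c0 powr (p / 2) * real N \<le> real N0 powr (p / 2)"
        using p N1 c0 by (simp add: powr_mult powr_powr)
      then have "(c0 powr (p / 2) * real N) * real N0 powr (- (p / 2)) \<le> real N0 powr (p / 2) * real N0 powr (- (p / 2))"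
        by (intro mult_right_mono) auto
      also have "\<dots> = 1" using n0 by (simp add: powr_add[symmetric])
      finally have le1: "c0 powr (p / 2) * real N0 powr (- (p / 2)) \<le> 1 / real N"
        using N1 by (simp add: field_simps)
      have "Bc * real N0 powr (- (p / 2)) \<le> (c0 powr (p / 2) * real N powr e) * real N0 powr (- (p / 2))"
        using big unfolding Bc_def by (intro mult_right_mono) auto
      also have "\<dots> = real N powr e * (c0 powr (p / 2) * real N0 powr (- (p / 2)))" by (simp add: mult_ac)
      also have "\<dots> \<le> real N powr e * (1 / real N)" by (intro mult_left_mono le1) auto
      also have "\<dots> = real N powr (e - 1)" using N1 by (simp add: powr_diff)
      finally show "Bc * real N0 powr (- (p / 2)) \<le> real N powr (e - 1)" .
    qed (use Bc in auto)
    also have "(real N powr (e - 1)) ^ k = (real N ^ k) powr (e - 1)"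
      unfolding power_powr_commute ..
    also have "\<dots> \<le> (b / real N) powr (e - 1)"
    proof (rule powr_mono2')
      show "b / real N \<le> real N ^ k" using k(2) N1 by (simp add: divide_le_eq mult.commute)
    qed (use e b N1 in auto)
    also have "(b / real N) powr (e - 1) = real N powr (1 - e) * b powr (e - 1)"
      using b N1 by (simp add: powr_divide powr_diff)
    finally show ?thesis by (simp add: mult.assoc)
  qed
  have R0: "0 \<le> R ^ m" by (simp add: R_def)
  note it
  also have "ennreal ((Bc * real N0 powr (p / 2 - 1)) ^ k * (real N0 ^ k * (5 / real N0 ^ k) powr p) * R ^ m)
      * (ennreal ((pi * \<kappa>) powr p) * If)
    \<le> ennreal (5 powr p * real N powr (1 - e) * b powr (e - 1) * R ^ m) * (ennreal ((pi * \<kappa>) powr p) * If)"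
    using real R0 by (intro mult_right_mono ennreal_leI) auto
  also have "\<dots> = ennreal (5 powr p * real N powr (1 - e) * b powr (e - 1) * R ^ m * (pi * \<kappa>) powr p) * If"
    using R0 by (intro ennreal_mult_assoc) auto
  also have "5 powr p * real N powr (1 - e) * b powr (e - 1) * R ^ m * (pi * \<kappa>) powr p
      = 5 powr p * real N powr (1 - e) * b powr (e - 1) * (pi * (\<kappa> * (8 * pi * \<rho>) ^ m)) powr p"
    unfolding Rm by (simp add: powr_mult mult_ac)
  finally show ?thesis unfolding \<kappa>_def If_def .
qed

end

section \<open>Decomposition of the averages\<close>

text \<open>
The function A_t applied to the Bessel potential of order -g of f; order 0 gives the averages
themselves.
\<close>

definition averaged_multiplier :: "real \<Rightarrow> real measure \<Rightarrow> (real \<Rightarrow> complex) \<Rightarrow> real \<Rightarrow> real \<Rightarrow> complex" where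
  "averaged_multiplier g \<mu> f x t
    = (LINT \<xi>|lborel. cis (2 * pi * x * \<xi>) * (bessel_weight g \<xi> * fourier f \<xi> * fourier_measure \<mu> (t * \<xi>)))"

lemma schwartz_facts:
  assumes "schwartz f"
  shows "integrable lborel f" "continuous_on UNIV f" "f \<in> borel_measurable borel" "\<exists>B. \<forall>x. norm (f x) \<le> B"
proof -
  obtain D c where D: "D 0 = f" "\<And>n x. (D n has_vector_derivative D (Suc n) x) (at x)" "\<And>n x. (1 + x\<^sup>2) * norm (D n x) \<le> c n" "\<And>n. continuous_on UNIV (D n)" "\<And>n. integrable lborel (D n)"
    using schwartzE[OF assms] by blast
  show "integrable lborel f" "continuous_on UNIV f" using D(4,5)[of 0] by (simp_all add: D(1))
  then show "f \<in> borel_measurable borel" by (intro borel_measurable_continuous_onI)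
  have "norm (f x) \<le> c 0" for x
  proof -
    have "1 * norm (f x) \<le> (1 + x\<^sup>2) * norm (f x)" by (intro mult_right_mono) auto
    then show ?thesis using D(3)[of x 0] by (simp add: D(1))
  qed
  then show "\<exists>B. \<forall>x. norm (f x) \<le> B" by blast
qed

lemma fourier_measure_measurable [measurable (raw)]:
  assumes "real_distribution \<mu>" and [measurable]: "h \<in> borel_measurable M"
  shows "(\<lambda>z. fourier_measure \<mu> (h z)) \<in> borel_measurable M"
proof -
  interpret real_distribution \<mu> by fact
  show ?thesis unfolding fourier_measure_def char_def by measurable
qed

lemma norm_fourier_measure_le:
  assumes "real_distribution \<mu>" shows "norm (fourier_measure \<mu> \<xi>) \<le> 1"
  unfolding fourier_measure_def using assms real_distribution.cmod_char_le_1[of \<mu>] by simp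

text \<open>
The Fourier transform decays like (1 + \<xi>^2)^(-2), and g \<le> 2 leaves one factor for
integrability.
\<close>

lemma weighted_fourier_integrable:
  assumes f: "schwartz f" and g: "g \<le> 2"
  shows "integrable lborel (\<lambda>\<xi>. bessel_weight g \<xi> * fourier f \<xi>)"
proof -
  have [measurable]: "fourier f \<in> borel_measurable borel"
    using continuous_fourier[OF schwartz_facts(1)[OF f]] by (rule borel_measurable_continuous_onI)
  obtain c where c: "\<And>\<xi>. (1 + \<xi>\<^sup>2)\<^sup>2 * norm (fourier f \<xi>) \<le> c" using schwartz_fourier_decay[OF f] by blast
  show ?thesis
  proof (rule integrable_cauchy_bound[of _ c])
    fix \<xi> :: real
    have "bessel_weight g \<xi> \<le> (1 + \<xi>\<^sup>2) powr 1"
      unfolding bessel_weight_def using g by (intro powr_mono) auto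
    also have "\<dots> = 1 + \<xi>\<^sup>2" by (simp add: add_nonneg_eq_0_iff)
    finally have "(1 + \<xi>\<^sup>2) * (bessel_weight g \<xi> * norm (fourier f \<xi>)) \<le> (1 + \<xi>\<^sup>2) * ((1 + \<xi>\<^sup>2) * norm (fourier f \<xi>))"
      by (intro mult_left_mono mult_right_mono) auto
    also have "\<dots> \<le> c" using c[of \<xi>] by (simp add: power2_eq_square mult.assoc)
    finally show "(1 + \<xi>\<^sup>2) * norm (bessel_weight g \<xi> * fourier f \<xi>) \<le> c"
      using bessel_weight_pos[of g \<xi>] by (simp add: norm_mult)
  qed measurable
qed

lemma average_eq_averaged_multiplier:
  assumes "real_distribution \<mu>" and f: "schwartz f"
  shows "average \<mu> f t x = averaged_multiplier 0 \<mu> f x t"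
proof -
  interpret real_distribution \<mu> by fact
  note sf = schwartz_facts[OF f]
  have w1: "bessel_weight 0 \<xi> = 1" for \<xi>
    by (simp add: bessel_weight_def) (use zero_le_power2[of \<xi>] in linarith)
  have iF: "integrable lborel (fourier f)"
    using weighted_fourier_integrable[OF f, of 0] by (simp add: w1)
  note [measurable] = borel_measurable_integrable[OF iF]
  obtain B where B: "\<And>x. norm (f x) \<le> B" using sf(4) by blast
  interpret P: pair_sigma_finite lborel \<mu> ..
  let ?k = "\<lambda>\<xi> y. cis (2 * pi * (x - t * y) * \<xi>)"
  have int: "integrable (lborel \<Otimes>\<^sub>M \<mu>) (\<lambda>(\<xi>, y). ?k \<xi> y * fourier f \<xi>)"
  proof (rule P.Fubini_integrable)
    show "integrable lborel (\<lambda>\<xi>. LINT y|\<mu>. norm (case (\<xi>, y) of (\<xi>, y) \<Rightarrow> ?k \<xi> y * fourier f \<xi>))"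
      using iF by (simp add: norm_mult prob_space[simplified])
    show "AE \<xi> in lborel. integrable \<mu> (\<lambda>y. case (\<xi>, y) of (\<xi>, y) \<Rightarrow> ?k \<xi> y * fourier f \<xi>)"
    proof (intro AE_I2)
      fix \<xi>
      show "integrable \<mu> (\<lambda>y. case (\<xi>, y) of (\<xi>, y) \<Rightarrow> ?k \<xi> y * fourier f \<xi>)"
        by (rule integrable_bounded[of _ "norm (fourier f \<xi>)"]) (simp_all add: norm_mult)
    qed
  qed measurable
  have "average \<mu> f t x = (LINT y|\<mu>. LINT \<xi>|lborel. ?k \<xi> y * fourier f \<xi>)"
    unfolding average_def fourier_inversion[OF sf(1,2) B iF] ..
  also have "\<dots> = (LINT \<xi>|lborel. LINT y|\<mu>. ?k \<xi> y * fourier f \<xi>)"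
    by (rule P.Fubini_integral[OF int])
  also have "\<dots> = averaged_multiplier 0 \<mu> f x t"
    unfolding averaged_multiplier_def
  proof (intro Bochner_Integration.integral_cong refl)
    fix \<xi>
    have "(LINT y|\<mu>. ?k \<xi> y * fourier f \<xi>) = (LINT y|\<mu>. (cis (2 * pi * x * \<xi>) * fourier f \<xi>) * cis (- (2 * pi * (t * \<xi>)) * y))"
    proof (intro Bochner_Integration.integral_cong refl)
      fix y
      have "?k \<xi> y = cis (2 * pi * x * \<xi>) * cis (- (2 * pi * (t * \<xi>)) * y)"
        by (simp add: cis_mult algebra_simps)
      then show "?k \<xi> y * fourier f \<xi> = (cis (2 * pi * x * \<xi>) * fourier f \<xi>) * cis (- (2 * pi * (t * \<xi>)) * y)"
        by (simp add: mult_ac)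
    qed
    also have "\<dots> = (cis (2 * pi * x * \<xi>) * fourier f \<xi>) * fourier_measure \<mu> (t * \<xi>)"
      unfolding integral_mult_right_zero fourier_measure_def char_def cis_conv_exp ..
    finally show "(LINT y|\<mu>. ?k \<xi> y * fourier f \<xi>)
        = cis (2 * pi * x * \<xi>) * (bessel_weight 0 \<xi> * fourier f \<xi> * fourier_measure \<mu> (t * \<xi>))"
      by (simp add: w1 mult.assoc)
  qed
  finally show ?thesis .
qed

definition center_piece :: "real measure \<Rightarrow> real \<Rightarrow> (real \<Rightarrow> complex) \<Rightarrow> real \<Rightarrow> real \<Rightarrow> ennreal" where
  "center_piece \<mu> g f x t = ennreal (norm (osc \<mu> 0 (\<lambda>_. 1) (piece 0 0 1 1 g (fourier f)) x t))"

definition right_piece :: "real measure \<Rightarrow> real \<Rightarrow> real \<Rightarrow> (real \<Rightarrow> complex) \<Rightarrow> nat \<Rightarrow> real \<Rightarrow> real \<Rightarrow> ennreal" where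
  "right_piece \<mu> \<theta> g f n x t = ennreal (norm (osc \<mu> (\<theta> ^ n) (\<lambda>_. 1)
     (piece 0 (\<theta> ^ n) (\<theta> ^ n - node \<theta> n) (\<theta> ^ Suc n - \<theta> ^ n) g (fourier f)) x t))"

definition left_piece :: "real measure \<Rightarrow> real \<Rightarrow> real \<Rightarrow> (real \<Rightarrow> complex) \<Rightarrow> nat \<Rightarrow> real \<Rightarrow> real \<Rightarrow> ennreal" where
  "left_piece \<mu> \<theta> g f n x t = ennreal (norm (osc \<mu> (- (\<theta> ^ n)) (\<lambda>_. 1)
     (piece 0 (- (\<theta> ^ n)) (\<theta> ^ Suc n - \<theta> ^ n) (\<theta> ^ n - node \<theta> n) g (fourier f)) x t))"

text \<open>
The partial sums of the window pieces converge to the whole, by dominated convergence, since the partial sums of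
the partition of unity lie between 0 and 1.
\<close>

lemma averaged_multiplier_le_pieces:
  assumes "real_distribution \<mu>" and f: "schwartz f" and g: "g \<le> 2" and \<theta>: "1 < \<theta>"
  shows "ennreal (norm (averaged_multiplier g \<mu> f x t))
    \<le> (\<Sum>n. (case n of 0 \<Rightarrow> center_piece \<mu> g f x t | Suc n \<Rightarrow> right_piece \<mu> \<theta> g f n x t))
      + (\<Sum>n. left_piece \<mu> \<theta> g f n x t)"
proof -
  interpret real_distribution \<mu> by fact
  define J where "J \<xi> = bessel_weight g \<xi> * fourier f \<xi> * fourier_measure \<mu> (t * \<xi>)" for \<xi>
  have cF: "continuous_on UNIV (fourier f)" by (rule continuous_fourier[OF schwartz_facts(1)[OF f]])
  then have [measurable]: "fourier f \<in> borel_measurable borel" by (rule borel_measurable_continuous_onI)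
  have Jm[measurable]: "J \<in> borel_measurable borel" unfolding J_def
    using fourier_measure_measurable[OF assms(1)] by measurable
  have iJ: "integrable lborel J"
  proof (rule Bochner_Integration.integrable_bound[OF weighted_fourier_integrable[OF f g]])
    show "AE \<xi> in lborel. norm (J \<xi>) \<le> norm (bessel_weight g \<xi> * fourier f \<xi>)"
      unfolding J_def norm_mult[of "_ * _"]
      by (intro AE_I2 mult_right_le_one_le norm_fourier_measure_le[OF assms(1)]) auto
  qed measurable
  define u where "u n = node \<theta> n" for n
  have u: "u n < u (Suc n)" for n unfolding u_def by (rule node_less[OF \<theta>])
  define c where "c = tent (- 1) 0 1"
  define R where "R n = tent (u n) (u (Suc n)) (u (Suc (Suc n)))" for n
  define L where "L n = tent (- u (Suc (Suc n))) (- u (Suc n)) (- u n)" for n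
  have RL: "0 \<le> R n \<xi>" "0 \<le> L n \<xi>" "0 \<le> c \<xi>" for n \<xi>
    unfolding R_def L_def c_def using u[of n] u[of "Suc n"] by (auto intro!: tent_bounds)
  have part: "(\<lambda>n. R n \<xi> + L n \<xi>) sums (1 - c \<xi>)" for \<xi>
    unfolding R_def L_def c_def u_def by (rule tent_partition[OF \<theta>])
  define T where "T k = (LINT \<xi>|lborel. cis (2 * pi * x * \<xi>) * (of_real (k \<xi>) * J \<xi>))" for k :: "real \<Rightarrow> real"
  have iT: "integrable lborel (\<lambda>\<xi>. cis (2 * pi * x * \<xi>) * (of_real (tent a b d \<xi>) * J \<xi>))"
    if ab: "a < b" "b < d" for a b d
  proof (rule Bochner_Integration.integrable_bound[OF iJ])
    show "AE \<xi> in lborel. norm (cis (2 * pi * x * \<xi>) * (of_real (tent a b d \<xi>) * J \<xi>)) \<le> norm (J \<xi>)"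
    proof (intro AE_I2)
      fix \<xi>
      show "norm (cis (2 * pi * x * \<xi>) * (of_real (tent a b d \<xi>) * J \<xi>)) \<le> norm (J \<xi>)"
        using tent_bounds[OF ab, of \<xi>] by (simp add: norm_mult mult_left_le_one_le)
    qed
  qed measurable
  have Tosc: "norm (T (tent (\<beta> - l) \<beta> (\<beta> + r))) = norm (osc \<mu> \<beta> (\<lambda>_. 1) (piece 0 \<beta> l r g (fourier f)) x t)"
    if "0 < l" "0 < r" for \<beta> l r
    unfolding T_def J_def piece_osc[OF that cF] by (simp add: norm_mult)
  have Tc: "ennreal (norm (T c)) = center_piece \<mu> g f x t"
    unfolding center_piece_def c_def using Tosc[of 1 1 0] by simp
  have TR: "ennreal (norm (T (R n))) = right_piece \<mu> \<theta> g f n x t" for n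
    unfolding right_piece_def R_def using Tosc[of "u (Suc n) - u n" "u (Suc (Suc n)) - u (Suc n)" "u (Suc n)"] u[of n] u[of "Suc n"]
    by (simp add: u_def)
  have TL: "ennreal (norm (T (L n))) = left_piece \<mu> \<theta> g f n x t" for n
    unfolding left_piece_def L_def using Tosc[of "u (Suc (Suc n)) - u (Suc n)" "u (Suc n) - u n" "- u (Suc n)"] u[of n] u[of "Suc n"]
    by (simp add: u_def)
  have iR: "integrable lborel (\<lambda>\<xi>. cis (2 * pi * x * \<xi>) * (of_real (R n \<xi>) * J \<xi>))"
    and iL: "integrable lborel (\<lambda>\<xi>. cis (2 * pi * x * \<xi>) * (of_real (L n \<xi>) * J \<xi>))"
    and ic: "integrable lborel (\<lambda>\<xi>. cis (2 * pi * x * \<xi>) * (of_real (c \<xi>) * J \<xi>))" for n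
    unfolding R_def L_def c_def using u[of n] u[of "Suc n"] by (intro iT; simp)+
  define s where "s M \<xi> = c \<xi> + (\<Sum>n<M. R n \<xi> + L n \<xi>)" for M \<xi>
  have s01: "0 \<le> s M \<xi>" "s M \<xi> \<le> 1" for M \<xi>
  proof -
    show "0 \<le> s M \<xi>" unfolding s_def by (intro add_nonneg_nonneg sum_nonneg RL)
    have "(\<Sum>n<M. R n \<xi> + L n \<xi>) \<le> (\<Sum>n. R n \<xi> + L n \<xi>)"
      using part[of \<xi>] RL by (intro sum_le_suminf) (auto simp: sums_iff)
    then show "s M \<xi> \<le> 1" using part[of \<xi>] by (simp add: s_def sums_iff)
  qed
  have lim: "(\<lambda>M. T (s M)) \<longlonglongrightarrow> averaged_multiplier g \<mu> f x t"
    unfolding T_def averaged_multiplier_def J_def[symmetric]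
  proof (rule integral_dominated_convergence[where w = "\<lambda>\<xi>. norm (J \<xi>)"])
    show "AE \<xi> in lborel. (\<lambda>M. cis (2 * pi * x * \<xi>) * (of_real (s M \<xi>) * J \<xi>)) \<longlonglongrightarrow> cis (2 * pi * x * \<xi>) * J \<xi>"
    proof (intro AE_I2)
      fix \<xi>
      have "(\<lambda>M. \<Sum>n<M. R n \<xi> + L n \<xi>) \<longlonglongrightarrow> 1 - c \<xi>" using part[of \<xi>] by (simp add: sums_def)
      then have "(\<lambda>M. s M \<xi>) \<longlonglongrightarrow> c \<xi> + (1 - c \<xi>)" unfolding s_def by (intro tendsto_intros)
      then have "(\<lambda>M. cis (2 * pi * x * \<xi>) * (of_real (s M \<xi>) * J \<xi>)) \<longlonglongrightarrow> cis (2 * pi * x * \<xi>) * (of_real (c \<xi> + (1 - c \<xi>)) * J \<xi>)"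
        by (intro tendsto_intros)
      then show "(\<lambda>M. cis (2 * pi * x * \<xi>) * (of_real (s M \<xi>) * J \<xi>)) \<longlonglongrightarrow> cis (2 * pi * x * \<xi>) * J \<xi>" by simp
    qed
    show "AE \<xi> in lborel. norm (cis (2 * pi * x * \<xi>) * (of_real (s M \<xi>) * J \<xi>)) \<le> norm (J \<xi>)" for M
      using s01[of M] by (intro AE_I2) (simp add: norm_mult mult_left_le_one_le)
    show "(\<lambda>\<xi>. cis (2 * pi * x * \<xi>) * (of_real (s M \<xi>) * J \<xi>)) \<in> borel_measurable lborel" for M
      unfolding s_def R_def L_def c_def by measurable
  qed (use iJ in auto)
  have Ts: "T (s M) = T c + (\<Sum>n<M. T (R n) + T (L n))" for M
  proof -
    have "T (s M) = (LINT \<xi>|lborel. cis (2 * pi * x * \<xi>) * (of_real (c \<xi>) * J \<xi>)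
        + (\<Sum>n<M. cis (2 * pi * x * \<xi>) * (of_real (R n \<xi>) * J \<xi>) + cis (2 * pi * x * \<xi>) * (of_real (L n \<xi>) * J \<xi>)))"
      unfolding T_def s_def
      by (intro Bochner_Integration.integral_cong refl) (simp add: distrib_left distrib_right sum_distrib_left sum_distrib_right)
    also have "\<dots> = T c + (\<Sum>n<M. T (R n) + T (L n))"
      unfolding T_def using ic iR iL
      by (subst Bochner_Integration.integral_add) (auto intro!: sum.cong Bochner_Integration.integral_add simp: Bochner_Integration.integral_sum)
    finally show ?thesis .
  qed
  define A where "A = (\<lambda>n. case n of 0 \<Rightarrow> center_piece \<mu> g f x t | Suc n \<Rightarrow> right_piece \<mu> \<theta> g f n x t)"
  have bound: "ennreal (norm (T (s M))) \<le> (\<Sum>n. A n) + (\<Sum>n. left_piece \<mu> \<theta> g f n x t)" for M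
  proof -
    have "norm (T (s M)) \<le> norm (T c) + (\<Sum>n<M. norm (T (R n)) + norm (T (L n)))"
      unfolding Ts by (rule order_trans[OF norm_triangle_ineq])
        (auto intro!: order_trans[OF norm_sum] sum_mono norm_triangle_ineq)
    then have "ennreal (norm (T (s M))) \<le> ennreal (norm (T c) + (\<Sum>n<M. norm (T (R n)) + norm (T (L n))))"
      by (rule ennreal_leI)
    also have "\<dots> = ennreal (norm (T c)) + (\<Sum>n<M. ennreal (norm (T (R n))) + ennreal (norm (T (L n))))"
      by (simp add: sum_nonneg sum_ennreal[symmetric])
    also have "\<dots> = (\<Sum>n<Suc M. A n) + (\<Sum>n<M. left_piece \<mu> \<theta> g f n x t)"
      unfolding Tc TR TL sum.lessThan_Suc_shift A_def by (simp add: sum.distrib add.assoc)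
    also have "\<dots> \<le> (\<Sum>n. A n) + (\<Sum>n. left_piece \<mu> \<theta> g f n x t)"
      by (intro add_mono sum_le_suminf) auto
    finally show ?thesis .
  qed
  have "(\<lambda>M. ennreal (norm (T (s M)))) \<longlonglongrightarrow> ennreal (norm (averaged_multiplier g \<mu> f x t))"
    by (intro tendsto_intros lim)
  then show ?thesis unfolding A_def[symmetric] by (rule LIMSEQ_le_const2) (use bound in blast)
qed

context cantor_system
begin

text \<open>
The p-th powers of the norms of the piece and of b^(-1) times its t-derivative are bounded by a multiple of
b powr (e - 1 + g p), and the Sobolev embedding in t costs b powr (1 - p / r').
\<close>

lemma piece_mixed:
  assumes p: "2 \<le> p" "p \<le> r'" and C: "0 \<le> C"
    and Lam: "\<And>j a. a \<in> pts j \<Longrightarrow> Lambda_set p C (S (Suc j) a)"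
    and f: "integrable lborel f" "f \<in> borel_measurable borel"
    and lr: "0 < l" "0 < r" "l \<le> \<rho>" "r \<le> \<rho>" "\<rho> \<le> real N * l" "\<rho> \<le> real N * r"
    and b: "1 \<le> b" and win: "(b = 1 \<and> \<rho> = 1 \<and> \<bar>\<beta>\<bar> \<le> 1) \<or> (\<bar>\<beta>\<bar> = b \<and> \<rho> = b / real N)"
    and c0: "0 < c0" "c0 * real N powr (2 / p) \<le> real N0" and e: "0 < e" "e < 1"
    and big: "2 powr (2 * p + 1) * C powr p * (1 + (4 * pi) powr p + (16 * pi) powr p) \<le> c0 powr (p / 2) * real N powr e"
  shows "mixed p r' (\<lambda>x t. ennreal (norm (osc \<mu> \<beta> (\<lambda>_. 1) (piece 0 \<beta> l r g (fourier f)) x t)))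
    \<le> ennreal (2 powr p * (1 + (8 * pi) powr p + (32 * pi) powr p) * (5 powr p * real N powr (1 - e)
        * (pi * (5 powr (\<bar>g\<bar> / 2) * (4 + 4 * real N + 24 * \<bar>g\<bar> + 8 * \<bar>g * (g - 2)\<bar>))) powr p)
        * b powr (- (p / r' - e - g * p)))
      * (\<integral>\<^sup>+x. ennreal (norm (f x) powr p) \<partial>lborel)"
proof -
  have N1: "1 < real N" using N by simp
  have \<rho>: "0 < \<rho>" "\<rho> \<le> b"
  proof -
    show "0 < \<rho>" using lr by linarith
    have "b / real N \<le> b / 1" using N1 b by (intro divide_left_mono) auto
    then show "\<rho> \<le> b" using win by auto
  qed
  have \<beta>b: "\<bar>\<beta>\<bar> \<le> b" using win by auto
  have cont: "continuous_on UNIV (fourier f)" by (rule continuous_fourier[OF f(1)])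
  let ?h = "\<lambda>m. piece m \<beta> l r g (fourier f)"
  define If where "If = (\<integral>\<^sup>+x. ennreal (norm (f x) powr p) \<partial>lborel)"
  define \<kappa> where "\<kappa> = 5 powr (\<bar>g\<bar> / 2) * (4 + 4 * real N + 24 * \<bar>g\<bar> + 8 * \<bar>g * (g - 2)\<bar>)"
  have \<kappa>: "0 \<le> \<kappa>" unfolding \<kappa>_def by (intro mult_nonneg_nonneg) auto
  define Y where "Y = 5 powr p * real N powr (1 - e) * (pi * \<kappa>) powr p"
  define Z where "Z = Y * b powr (e - 1 + g * p)"
  have YZ: "0 \<le> Y" "0 \<le> Z" by (simp_all add: Y_def Z_def)
  have en: "energy \<mu> p \<beta> w (?h m) \<le> ennreal (Z * ((8 * pi * \<rho>) ^ m) powr p) * If"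
    if w: "w \<in> borel_measurable borel" "\<And>y. norm (w y) \<le> 1" for w m
  proof -
    have "energy \<mu> p \<beta> w (?h m) \<le> ennreal (5 powr p * real N powr (1 - e) * b powr (e - 1)
        * (pi * (5 powr (\<bar>g\<bar> / 2) * b powr g * (4 + 4 * real N + 24 * \<bar>g\<bar> + 8 * \<bar>g * (g - 2)\<bar>) * (8 * pi * \<rho>) ^ m)) powr p) * If"
      unfolding If_def by (rule piece_energy[OF p(1) C Lam f lr b win w c0 e big])
    also have "pi * (5 powr (\<bar>g\<bar> / 2) * b powr g * (4 + 4 * real N + 24 * \<bar>g\<bar> + 8 * \<bar>g * (g - 2)\<bar>) * (8 * pi * \<rho>) ^ m)
        = (pi * \<kappa>) * (b powr g * (8 * pi * \<rho>) ^ m)" by (simp add: \<kappa>_def mult_ac)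
    also have "5 powr p * real N powr (1 - e) * b powr (e - 1) * ((pi * \<kappa>) * (b powr g * (8 * pi * \<rho>) ^ m)) powr p
        = Z * ((8 * pi * \<rho>) ^ m) powr p"
      unfolding Z_def Y_def powr_mult[of "pi * \<kappa>"] powr_mult[of "b powr g"] powr_powr powr_add by (simp add: mult_ac)
    finally show ?thesis .
  qed
  obtain B where B: "\<And>x. norm (?h 0 x) \<le> B" using piece_bounded[OF lr(1,2) cont] by blast
  obtain B' where B': "\<And>x. norm (?h (Suc 0) x) \<le> B'" using piece_bounded[OF lr(1,2) cont] by blast
  have cont1: "continuous_on UNIV (?h (Suc 0))"
    by (rule has_derivative_family_props(1)[of ?h, OF piece_derivative[OF lr(1,2) cont]])
  have one: "(\<lambda>_. 1 :: complex) \<in> borel_measurable borel" "norm (1 :: complex) \<le> 1" by auto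
  have e0: "energy \<mu> p \<beta> (\<lambda>_. 1) (?h 0) \<le> ennreal Z * If" "energy \<mu> p \<beta> half_point (?h 0) \<le> ennreal Z * If"
    using en[OF one, of 0] en[OF half_point_weight, of 0] by simp_all
  have e1: "ennreal ((4 / b) powr p) * energy \<mu> p \<beta> half_point (?h (Suc 0)) \<le> ennreal ((32 * pi) powr p * Z) * If"
  proof -
    have "ennreal ((4 / b) powr p) * energy \<mu> p \<beta> half_point (?h (Suc 0))
        \<le> ennreal ((4 / b) powr p) * (ennreal (Z * ((8 * pi * \<rho>) ^ Suc 0) powr p) * If)"
      by (intro mult_left_mono en half_point_weight) auto
    also have "\<dots> = ennreal ((4 / b) powr p * (Z * ((8 * pi * \<rho>) ^ Suc 0) powr p)) * If"
      using YZ by (intro ennreal_mult_assoc) auto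
    also have "(4 / b) powr p * (Z * ((8 * pi * \<rho>) ^ Suc 0) powr p) = (4 / b * (8 * pi * \<rho>)) powr p * Z"
      by (simp only: power_Suc0_right powr_mult mult_ac)
    also have "ennreal \<dots> * If \<le> ennreal ((32 * pi) powr p * Z) * If"
    proof (intro mult_right_mono ennreal_leI powr_mono2)
      have "4 / b * (8 * pi * \<rho>) = 32 * pi * (\<rho> / b)" by simp
      also have "\<dots> \<le> 32 * pi * 1" using \<rho> b by (intro mult_left_mono) auto
      finally show "4 / b * (8 * pi * \<rho>) \<le> 32 * pi" by simp
    qed (use p YZ \<rho> b in auto)
    finally show ?thesis .
  qed
  have "mixed p r' (\<lambda>x t. ennreal (norm (osc \<mu> \<beta> (\<lambda>_. 1) (?h 0) x t)))
      = (\<integral>\<^sup>+x. enn_powr (\<integral>\<^sup>+t\<in>{1..2}. ennreal (norm (osc \<mu> \<beta> (\<lambda>_. 1) (?h 0) x t) powr r') \<partial>lborel) (p / r') \<partial>lborel)"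
    unfolding mixed_def by (simp add: enn_powr_ennreal)
  also have "\<dots> \<le> ennreal (b powr (1 - p / r') * 2 powr p) * (energy \<mu> p \<beta> (\<lambda>_. 1) (?h 0)
      + ennreal ((8 * pi) powr p) * energy \<mu> p \<beta> half_point (?h 0)
      + ennreal ((4 / b) powr p) * energy \<mu> p \<beta> half_point (?h (Suc 0)))"
    using p by (intro mixed_norm_le[OF _ p(2) b \<beta>b piece_derivative[OF lr(1,2) cont] cont1 B B']) auto
  also have "\<dots> \<le> ennreal (b powr (1 - p / r') * 2 powr p) * (ennreal Z * If
      + ennreal ((8 * pi) powr p) * (ennreal Z * If) + ennreal ((32 * pi) powr p * Z) * If)"
    by (intro mult_left_mono add_mono e0 e1) auto
  also have "\<dots> = ennreal (b powr (1 - p / r') * 2 powr p) * (ennreal (Z + (8 * pi) powr p * Z + (32 * pi) powr p * Z) * If)"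
    using YZ by (simp add: distrib_right ennreal_mult_assoc)
  also have "\<dots> = ennreal (b powr (1 - p / r') * 2 powr p * (Z + (8 * pi) powr p * Z + (32 * pi) powr p * Z)) * If"
    using YZ by (intro ennreal_mult_assoc) auto
  also have "b powr (1 - p / r') * 2 powr p * (Z + (8 * pi) powr p * Z + (32 * pi) powr p * Z)
      = 2 powr p * (1 + (8 * pi) powr p + (32 * pi) powr p) * Y * (b powr (1 - p / r') * b powr (e - 1 + g * p))"
    unfolding Z_def by (simp add: algebra_simps)
  also have "b powr (1 - p / r') * b powr (e - 1 + g * p) = b powr (- (p / r' - e - g * p))"
    by (simp only: powr_add[symmetric]) (simp add: algebra_simps)
  finally show ?thesis unfolding Y_def \<kappa>_def If_def .
qed

end

section \<open>Proof of the estimates\<close>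

lemma cantor_systemI:
  assumes N: "2 \<le> N" and fam: "admissible_family p c0 c1 C N N0 \<Sigma>" and cm: "cantor_measure N \<Sigma> \<mu>"
  obtains S where "cantor_system N N0 S \<mu>" "\<And>k a. a \<in> cantor_points N S k \<Longrightarrow> Lambda_set p C (S (Suc k) a)"
proof -
  obtain S where S: "\<And>k a. a \<in> cantor_points N S k \<Longrightarrow> S (Suc k) a \<in> \<Sigma>" "real_distribution \<mu>"
    "weak_conv_m (\<lambda>j. uniform_measure lborel (cantor_level N S (Suc j))) \<mu>"
    using cm unfolding cantor_measure_def by blast
  have adm: "card (S (Suc k) a) = N0 \<and> S (Suc k) a \<subseteq> {..<N - 1} \<and> Lambda_set p C (S (Suc k) a)"
    if "a \<in> cantor_points N S k" for k a
    using fam S(1)[OF that] unfolding admissible_family_def admissible_set_def by blast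
  have "cantor_system N N0 S \<mu>"
    using N fam adm S(2,3) unfolding cantor_system_def admissible_family_def by blast
  then show ?thesis using adm by (intro that) auto
qed

lemma admissible_family_card:
  assumes "admissible_family p c0 c1 C N N0 \<Sigma>"
  shows "0 < N0" "c0 * real N powr (2 / p) \<le> real N0" "real N0 \<le> c1 * real N powr (2 / p)"
proof -
  have fam: "0 < N0" "\<Sigma> \<noteq> {}" "\<forall>S\<in>\<Sigma>. card S = N0 \<and> admissible_set p c0 c1 C N S"
    using assms by (auto simp: admissible_family_def)
  obtain S where "S \<in> \<Sigma>" using fam(2) by auto
  then have "card S = N0" "admissible_set p c0 c1 C N S" using fam(3) by auto
  then show "0 < N0" "c0 * real N powr (2 / p) \<le> real N0" "real N0 \<le> c1 * real N powr (2 / p)"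
    using fam(1) by (auto simp: admissible_set_def)
qed

text \<open>
Only the windows next to the origin are wide; all others have width comparable to their distance
from the origin divided by N.
\<close>

lemma grid_window:
  fixes n :: nat
  assumes N: "2 \<le> N" and \<theta>: "\<theta> = 1 + 1 / real N"
  defines "l \<equiv> \<theta> ^ n - node \<theta> n" and "r \<equiv> \<theta> ^ Suc n - \<theta> ^ n"
  shows "\<exists>\<rho>. 0 < l \<and> 0 < r \<and> l \<le> \<rho> \<and> r \<le> \<rho> \<and> \<rho> \<le> real N * l \<and> \<rho> \<le> real N * r
    \<and> ((\<theta> ^ n = 1 \<and> \<rho> = 1) \<or> \<rho> = \<theta> ^ n / real N)"
proof -
  have t: "1 < \<theta>" "\<theta> \<le> real N" "\<theta> - 1 = 1 / real N"
  proof -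
    have "1 / real N \<le> 1" using N by simp
    moreover have "2 \<le> real N" using N by simp
    ultimately show "\<theta> \<le> real N" unfolding \<theta> by linarith
  qed (use N \<theta> in auto)
  have r: "r = \<theta> ^ n / real N"
  proof -
    have "r = \<theta> ^ n * (\<theta> - 1)" unfolding r_def by (simp add: algebra_simps)
    then show ?thesis unfolding t(3) by simp
  qed
  show ?thesis
  proof (cases n)
    case 0
    then have l1: "l = 1" by (simp add: l_def)
    have r1: "r = 1 / real N" using r 0 by simp
    show ?thesis
      by (intro exI[of _ 1]) (use N 0 in \<open>auto simp: l1 r1\<close>)
  next
    case (Suc m)
    have "l = \<theta> ^ m * (\<theta> - 1)" unfolding l_def Suc by (simp add: algebra_simps)
    then have l: "l = \<theta> ^ m / real N" unfolding t(3) by simp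
    have m0: "0 < \<theta> ^ m" using t by simp
    have "\<theta> ^ m * 1 \<le> \<theta> ^ m * \<theta>" using t m0 by (intro mult_left_mono) auto
    then have 1: "\<theta> ^ m \<le> \<theta> ^ n" by (simp add: Suc mult.commute)
    have "\<theta> ^ m * \<theta> \<le> \<theta> ^ m * real N" using t m0 by (intro mult_left_mono) auto
    then have 2: "\<theta> ^ n \<le> \<theta> ^ m * real N" by (simp add: Suc mult.commute)
    have n0: "0 < \<theta> ^ n" using t by simp
    have "\<theta> ^ n / real N \<le> \<theta> ^ m" using 2 N by (simp add: divide_le_eq)
    moreover have "\<theta> ^ n / real N \<le> \<theta> ^ n / 1" using N n0 by (intro divide_left_mono) auto
    ultimately show ?thesis
      using N m0 n0 1 by (intro exI[of _ "\<theta> ^ n / real N"]) (auto simp: l r divide_right_mono)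
  qed
qed

text \<open>
The exponent d is the net gain: p / r comes from the decoupling after Sobolev embedding, e is
the loss in the iteration and g p is the cost of the weight.  A positive d makes the sum over the grid
converge, with ratio q = \<theta> powr (-d).
\<close>

proposition averaged_multiplier_bound:
  fixes p r g e c0 c1 C :: real
  assumes p: "2 \<le> p" "p \<le> r" and C: "0 \<le> C" and c0: "0 < c0" and e: "0 < e" "e < 1" and g: "g \<le> 2"
    and \<delta>: "0 < p / r - e - g * p" and N: "2 \<le> N"
    and big: "2 powr (2 * p + 1) * C powr p * (1 + (4 * pi) powr p + (16 * pi) powr p) \<le> c0 powr (p / 2) * real N powr e"
  shows "\<exists>K\<ge>0. \<forall>N0 \<Sigma> \<mu>. admissible_family p c0 c1 C N N0 \<Sigma> \<longrightarrow> cantor_measure N \<Sigma> \<mu> \<longrightarrow>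
    (\<forall>f. schwartz f \<longrightarrow> mixed p r (\<lambda>x t. ennreal (norm (averaged_multiplier g \<mu> f x t)))
      \<le> ennreal K * (\<integral>\<^sup>+x. ennreal (norm (f x) powr p) \<partial>lborel))"
proof -
  define \<theta> where "\<theta> = 1 + 1 / real N"
  define d where "d = p / r - e - g * p"
  define K3 where "K3 = 2 powr p * (1 + (8 * pi) powr p + (32 * pi) powr p) * (5 powr p * real N powr (1 - e)
        * (pi * (5 powr (\<bar>g\<bar> / 2) * (4 + 4 * real N + 24 * \<bar>g\<bar> + 8 * \<bar>g * (g - 2)\<bar>))) powr p)"
  define q where "q = \<theta> powr (- d)"
  define Mc where "Mc = K3 * \<theta> powr d"
  define K4 where "K4 = (1 / (1 - q powr (1 / (2 * p)))) powr p * (Mc * (1 / (1 - q powr (1 / 2))))"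
  define K where "K = 2 powr (p + p / r) * (K4 + K4)"
  have th: "1 < \<theta>" using N by (simp add: \<theta>_def)
  have d: "0 < d" using \<delta> by (simp add: d_def)
  have K3: "0 \<le> K3" unfolding K3_def by (intro mult_nonneg_nonneg add_nonneg_nonneg) auto
  have q: "0 < q" "q < 1"
  proof -
    show "0 < q" using th by (simp add: q_def)
    have "\<theta> powr (- d) < \<theta> powr 0" using th d by (intro powr_less_mono) auto
    then show "q < 1" using th by (simp add: q_def)
  qed
  have Mc: "0 \<le> Mc" "K3 \<le> Mc"
  proof -
    have "1 \<le> \<theta> powr d" using th d by (intro ge_one_powr_ge_zero) auto
    then have "K3 * 1 \<le> Mc" unfolding Mc_def using K3 by (intro mult_left_mono) auto
    then show "K3 \<le> Mc" by simp
    then show "0 \<le> Mc" using K3 by linarith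
  qed
  have "q powr (1 / 2) < 1 powr (1 / 2)" using q by (intro powr_less_mono2) auto
  then have K4: "0 \<le> K4" unfolding K4_def using Mc by (intro mult_nonneg_nonneg) auto
  have pr: "0 < p" "0 < r" using p by auto
  have main: "mixed p r (\<lambda>x t. ennreal (norm (averaged_multiplier g \<mu> f x t)))
      \<le> ennreal K * (\<integral>\<^sup>+x. ennreal (norm (f x) powr p) \<partial>lborel)"
    if fam: "admissible_family p c0 c1 C N N0 \<Sigma>" and cm: "cantor_measure N \<Sigma> \<mu>" and f: "schwartz f"
    for N0 \<Sigma> \<mu> f
  proof -
    obtain S where S: "cantor_system N N0 S \<mu>" "\<And>k a. a \<in> cantor_points N S k \<Longrightarrow> Lambda_set p C (S (Suc k) a)"
      using cantor_systemI[OF N fam cm] by blast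
    interpret cantor_system N N0 S \<mu> by (rule S(1))
    note sf = schwartz_facts[OF f]
    have cF: "continuous_on UNIV (fourier f)" by (rule continuous_fourier[OF sf(1)])
    define If where "If = (\<integral>\<^sup>+x. ennreal (norm (f x) powr p) \<partial>lborel)"
    have c0N: "c0 * real N powr (2 / p) \<le> real N0"
      by (rule admissible_family_card(2)[OF fam])
    have pm: "piece m \<beta> l r' g (fourier f) \<in> borel_measurable borel" if "0 < l" "0 < r'" for m \<beta> l r'
      by (rule has_derivative_family_props(2)[of "\<lambda>m. piece m \<beta> l r' g (fourier f)", OF piece_derivative[OF that cF]])
    have om: "case_prod (\<lambda>x t. ennreal (norm (osc \<mu> \<beta> (\<lambda>_. 1) (piece 0 \<beta> l r' g (fourier f)) x t)))
        \<in> borel_measurable (borel \<Otimes>\<^sub>M borel)" if "0 < l" "0 < r'" for \<beta> l r'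
    proof -
      note [measurable] = pm[OF that, of 0 \<beta>]
      show ?thesis by measurable
    qed
    have bound: "mixed p r (\<lambda>x t. ennreal (norm (osc \<mu> \<beta> (\<lambda>_. 1) (piece 0 \<beta> l r' g (fourier f)) x t)))
        \<le> ennreal (K3 * b powr (- d)) * If"
      if "0 < l" "0 < r'" "l \<le> \<rho>" "r' \<le> \<rho>" "\<rho> \<le> real N * l" "\<rho> \<le> real N * r'" "1 \<le> b"
        "(b = 1 \<and> \<rho> = 1 \<and> \<bar>\<beta>\<bar> \<le> 1) \<or> (\<bar>\<beta>\<bar> = b \<and> \<rho> = b / real N)" for \<beta> l r' \<rho> b
      unfolding K3_def d_def If_def by (rule piece_mixed[OF p C S(2) sf(1,3) that c0 c0N e big])
    have th1: "1 \<le> \<theta> ^ n" for n using th by (simp add: one_le_power)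
    have K3q: "K3 * (\<theta> ^ n) powr (- d) = K3 * q ^ n" for n unfolding q_def power_powr_commute ..
    define A where "A n x t = (case n of 0 \<Rightarrow> center_piece \<mu> g f x t | Suc n \<Rightarrow> right_piece \<mu> \<theta> g f n x t)" for n x t
    define B where "B n x t = left_piece \<mu> \<theta> g f n x t" for n x t
    have A: "case_prod (A n) \<in> borel_measurable (borel \<Otimes>\<^sub>M borel) \<and> mixed p r (A n) \<le> ennreal (Mc * q ^ n) * If" for n
    proof (cases n)
      case 0
      have An: "A n = (\<lambda>x t. ennreal (norm (osc \<mu> 0 (\<lambda>_. 1) (piece 0 0 1 1 g (fourier f)) x t)))"
        by (simp add: A_def 0 center_piece_def fun_eq_iff)
      have "mixed p r (A n) \<le> ennreal (K3 * 1 powr (- d)) * If"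
        unfolding An by (rule bound[of 1 1 1]) (use N in auto)
      also have "\<dots> \<le> ennreal (Mc * q ^ n) * If" using Mc by (intro mult_right_mono ennreal_leI) (auto simp: 0)
      finally show ?thesis using om[of 1 1 0] unfolding An by simp
    next
      case (Suc k)
      obtain \<rho> where w: "0 < \<theta> ^ k - node \<theta> k" "0 < \<theta> ^ Suc k - \<theta> ^ k" "\<theta> ^ k - node \<theta> k \<le> \<rho>" "\<theta> ^ Suc k - \<theta> ^ k \<le> \<rho>"
        "\<rho> \<le> real N * (\<theta> ^ k - node \<theta> k)" "\<rho> \<le> real N * (\<theta> ^ Suc k - \<theta> ^ k)"
        "(\<theta> ^ k = 1 \<and> \<rho> = 1) \<or> \<rho> = \<theta> ^ k / real N"
        using grid_window[OF N \<theta>_def, of k] by blast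
      have An: "A n = (\<lambda>x t. ennreal (norm (osc \<mu> (\<theta> ^ k) (\<lambda>_. 1)
          (piece 0 (\<theta> ^ k) (\<theta> ^ k - node \<theta> k) (\<theta> ^ Suc k - \<theta> ^ k) g (fourier f)) x t)))"
        by (simp add: A_def Suc right_piece_def fun_eq_iff)
      have "mixed p r (A n) \<le> ennreal (K3 * (\<theta> ^ k) powr (- d)) * If"
        unfolding An by (rule bound[OF w(1-6) th1]) (use w(7) th1[of k] in auto)
      also have "K3 * (\<theta> ^ k) powr (- d) = Mc * q ^ n"
      proof -
        have "\<theta> powr d * q = 1" unfolding q_def using th by (simp add: powr_add[symmetric])
        then have "Mc * q = K3" by (simp add: Mc_def)
        then show ?thesis unfolding K3q Suc power_Suc by (metis mult.assoc)
      qed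
      finally show ?thesis using om[OF w(1,2), of "\<theta> ^ k"] unfolding An by simp
    qed
    have B: "case_prod (B n) \<in> borel_measurable (borel \<Otimes>\<^sub>M borel) \<and> mixed p r (B n) \<le> ennreal (Mc * q ^ n) * If" for n
    proof -
      obtain \<rho> where w: "0 < \<theta> ^ n - node \<theta> n" "0 < \<theta> ^ Suc n - \<theta> ^ n" "\<theta> ^ n - node \<theta> n \<le> \<rho>" "\<theta> ^ Suc n - \<theta> ^ n \<le> \<rho>"
        "\<rho> \<le> real N * (\<theta> ^ n - node \<theta> n)" "\<rho> \<le> real N * (\<theta> ^ Suc n - \<theta> ^ n)"
        "(\<theta> ^ n = 1 \<and> \<rho> = 1) \<or> \<rho> = \<theta> ^ n / real N"
        using grid_window[OF N \<theta>_def, of n] by blast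
      have Bn: "B n = (\<lambda>x t. ennreal (norm (osc \<mu> (- (\<theta> ^ n)) (\<lambda>_. 1)
          (piece 0 (- (\<theta> ^ n)) (\<theta> ^ Suc n - \<theta> ^ n) (\<theta> ^ n - node \<theta> n) g (fourier f)) x t)))"
        by (simp add: B_def left_piece_def fun_eq_iff)
      have "mixed p r (B n) \<le> ennreal (K3 * (\<theta> ^ n) powr (- d)) * If"
        unfolding Bn by (rule bound[OF w(2,1,4,3,6,5) th1]) (use w(7) th1[of n] in auto)
      also have "\<dots> \<le> ennreal (Mc * q ^ n) * If"
        unfolding K3q using Mc q by (intro mult_right_mono ennreal_leI) auto
      finally show ?thesis using om[OF w(2,1), of "- (\<theta> ^ n)"] unfolding Bn by simp
    qed
    note [measurable] = conjunct1[OF A] conjunct1[OF B]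
    have sA: "mixed p r (\<lambda>x t. \<Sum>n. A n x t) \<le> ennreal K4 * If" "mixed p r (\<lambda>x t. \<Sum>n. B n x t) \<le> ennreal K4 * If"
      unfolding K4_def using A B by (intro mixed_suminf pr(1) p(2) q Mc(1); blast)+
    have "mixed p r (\<lambda>x t. ennreal (norm (averaged_multiplier g \<mu> f x t)))
        \<le> mixed p r (\<lambda>x t. (\<Sum>n. A n x t) + (\<Sum>n. B n x t))"
      unfolding A_def B_def by (intro mixed_mono pr averaged_multiplier_le_pieces mu f g th)
    also have "\<dots> \<le> ennreal (2 powr (p + p / r)) * (mixed p r (\<lambda>x t. \<Sum>n. A n x t) + mixed p r (\<lambda>x t. \<Sum>n. B n x t))"
      by (rule mixed_add[OF pr]) measurable
    also have "\<dots> \<le> ennreal (2 powr (p + p / r)) * (ennreal K4 * If + ennreal K4 * If)"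
      by (intro mult_left_mono add_mono sA) auto
    also have "\<dots> = ennreal (2 powr (p + p / r)) * (ennreal (K4 + K4) * If)"
      by (simp only: ennreal_plus[OF K4 K4] distrib_right)
    also have "\<dots> = ennreal K * If"
      unfolding K_def using K4 by (intro ennreal_mult_assoc) auto
    finally show ?thesis unfolding If_def .
  qed
  have "0 \<le> K" using K4 by (simp add: K_def)
  then show ?thesis using main by blast
qed

lemma eventually_powr_dominates:
  fixes A c e :: real
  assumes "0 \<le> A" "0 < c" "0 < e"
  shows "\<exists>Nmin. \<forall>N\<ge>Nmin. 2 \<le> N \<and> A \<le> c * real N powr e"
proof (intro exI allI impI)
  fix N assume N: "max 2 (nat \<lceil>(A / c) powr (1 / e)\<rceil>) \<le> N"
  then have "(A / c) powr (1 / e) \<le> real N" by linarith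
  then have "((A / c) powr (1 / e)) powr e \<le> real N powr e" using assms by (intro powr_mono2) auto
  then have "A / c \<le> real N powr e" using assms by (simp add: powr_powr)
  then have "A \<le> c * real N powr e" using assms by (simp add: divide_le_eq mult.commute)
  then show "2 \<le> N \<and> A \<le> c * real N powr e" using N by simp
qed

lemma enn_powr_root_le:
  assumes "0 < p" "0 \<le> K" "X \<le> ennreal K * Y"
  shows "enn_powr X (1 / p) \<le> ennreal (K powr (1 / p)) * enn_powr Y (1 / p)"
proof -
  have "enn_powr X (1 / p) \<le> enn_powr (ennreal K * Y) (1 / p)" using assms by (intro enn_powr_mono) auto
  also have "\<dots> = ennreal (K powr (1 / p)) * enn_powr Y (1 / p)"
    using assms by (simp add: enn_powr_mult enn_powr_ennreal)
  finally show ?thesis .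
qed

lemma Lp_norm_eq: "Lp_norm M p f = enn_powr (\<integral>\<^sup>+x. ennreal (norm (f x) powr p) \<partial>M) (1 / p)"
  by (simp add: Lp_norm_def eLp_norm_def enn_powr_ennreal)

lemma mixed_norm_eq:
  assumes "0 < p" "0 < r"
  shows "eLp_norm lborel p (\<lambda>x. Lp_norm (restrict_space lborel {1..2}) r (\<lambda>t. u x t))
    = enn_powr (mixed p r (\<lambda>x t. ennreal (norm (u x t)))) (1 / p)"
  unfolding eLp_norm_def Lp_norm_eq mixed_def using assms
  by (simp add: nn_integral_restrict_space enn_powr_enn_powr enn_powr_ennreal)

lemma space_time_norm_eq:
  assumes p: "0 < p" and u[measurable]: "case_prod u \<in> borel_measurable (borel \<Otimes>\<^sub>M borel)"
  shows "Lp_norm (lborel \<Otimes>\<^sub>M restrict_space lborel {1..2}) p (\<lambda>(x, t). u x t)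
    = enn_powr (mixed p p (\<lambda>x t. ennreal (norm (u x t)))) (1 / p)"
proof -
  interpret R: sigma_finite_measure "restrict_space lborel {1..2::real}"
    by (intro sigma_finite_measure_restrict_space sigma_finite_lborel) auto
  have id: "(\<lambda>t. t) \<in> measurable (restrict_space lborel {1..2::real}) borel"
    by (intro measurable_restrict_space1) auto
  have m: "case_prod u \<in> borel_measurable (lborel \<Otimes>\<^sub>M restrict_space lborel {1..2})"
  proof -
    have "(\<lambda>z. (fst z, snd z)) \<in> measurable (lborel \<Otimes>\<^sub>M restrict_space lborel {1..2::real}) (borel \<Otimes>\<^sub>M borel)"
      by (intro measurable_Pair measurable_compose[OF measurable_snd id] measurable_compose[OF measurable_fst]) auto
    from measurable_compose[OF this u] show ?thesis by simp
  qed
  then have m': "(\<lambda>z. ennreal (norm (case_prod u z) powr p)) \<in> borel_measurable (lborel \<Otimes>\<^sub>M restrict_space lborel {1..2})"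
    by measurable
  have "(\<integral>\<^sup>+z. ennreal (norm (case z of (x, t) \<Rightarrow> u x t) powr p) \<partial>(lborel \<Otimes>\<^sub>M restrict_space lborel {1..2}))
      = (\<integral>\<^sup>+x. (\<integral>\<^sup>+t. ennreal (norm (u x t) powr p) \<partial>restrict_space lborel {1..2}) \<partial>lborel)"
    using R.nn_integral_fst[OF m'] by simp
  also have "\<dots> = mixed p p (\<lambda>x t. ennreal (norm (u x t)))"
    unfolding mixed_def using p by (simp add: nn_integral_restrict_space enn_powr_ennreal)
  finally show ?thesis unfolding Lp_norm_eq by simp
qed

theorem theorem3:
  fixes p \<alpha>' c0 c1 C :: real
  assumes "2 \<le> p" and "\<alpha>' > 2 / p"
    and "c0 > 0" and "c1 > 0" and "C > 0"
    and "\<exists>N1. \<forall>N\<ge>N1. \<exists>S. admissible_set p c0 c1 C N S"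
  shows "(\<forall>r>p. \<exists>Nmin. \<forall>N\<ge>Nmin. \<exists>K\<ge>0.
           \<forall>N0 \<Sigma> \<mu>. admissible_family p c0 c1 C N N0 \<Sigma> \<longrightarrow> cantor_measure N \<Sigma> \<mu> \<longrightarrow>
             (\<forall>f. schwartz f \<longrightarrow>
               eLp_norm lborel p
                   (\<lambda>x. Lp_norm (restrict_space lborel {1..2}) r (\<lambda>t. average \<mu> f t x))
                 \<le> ennreal K * Lp_norm lborel p f))
       \<and> (\<forall>\<gamma>::real. \<gamma> \<noteq> 1 / p \<longrightarrow> (\<exists>Nmin. \<forall>N\<ge>Nmin. \<exists>K\<ge>0.
           \<forall>N0 \<Sigma> \<mu>. admissible_family p c0 c1 C N N0 \<Sigma> \<longrightarrow> cantor_measure N \<Sigma> \<mu> \<longrightarrow>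
             \<gamma> < cantor_dim N N0 / 2 \<longrightarrow>
             (\<forall>f. schwartz f \<longrightarrow>
               Lp_norm (lborel \<Otimes>\<^sub>M restrict_space lborel {1..2}) p
                   (\<lambda>(x, t). inv_fourier
                      (\<lambda>\<xi>. of_real ((1 + \<bar>\<xi>\<bar>\<^sup>2) powr (\<gamma> / 2)) * fourier f \<xi> * fourier_measure \<mu> (t * \<xi>)) x)
                 \<le> ennreal K * Lp_norm lborel p f)))"
proof (intro conjI allI impI)
  define A where "A = 2 powr (2 * p + 1) * C powr p * (1 + (4 * pi) powr p + (16 * pi) powr p)"
  have A: "0 \<le> A" by (simp add: A_def)
  have c: "0 < c0 powr (p / 2)" using assms by simp
  have p: "0 < p" using assms by simp
  have C: "0 \<le> C" using assms by simp
  fix r assume r: "r > p"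
  \<comment> \<open>The total gain is p / r for the weight 1; half of it may be lost in the iteration.\<close>
  define e where "e = p / (2 * r)"
  have e: "0 < e" "e < 1" "0 < p / r - e - 0 * p" using p r by (auto simp: e_def field_simps)
  obtain Nmin where Nmin: "\<And>N. N \<ge> Nmin \<Longrightarrow> 2 \<le> N \<and> A \<le> c0 powr (p / 2) * real N powr e"
    using eventually_powr_dominates[OF A c e(1)] by blast
  show "\<exists>Nmin. \<forall>N\<ge>Nmin. \<exists>K\<ge>0.
           \<forall>N0 \<Sigma> \<mu>. admissible_family p c0 c1 C N N0 \<Sigma> \<longrightarrow> cantor_measure N \<Sigma> \<mu> \<longrightarrow>
             (\<forall>f. schwartz f \<longrightarrow>
               eLp_norm lborel p
                   (\<lambda>x. Lp_norm (restrict_space lborel {1..2}) r (\<lambda>t. average \<mu> f t x))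
                 \<le> ennreal K * Lp_norm lborel p f)"
  proof (intro exI[of _ Nmin] allI impI)
    fix N assume "N \<ge> Nmin"
    from Nmin[OF this] have N: "2 \<le> N" "A \<le> c0 powr (p / 2) * real N powr e" by auto
    obtain K where K: "0 \<le> K" "\<And>N0 \<Sigma> \<mu> f. admissible_family p c0 c1 C N N0 \<Sigma> \<Longrightarrow> cantor_measure N \<Sigma> \<mu> \<Longrightarrow>
      schwartz f \<Longrightarrow> mixed p r (\<lambda>x t. ennreal (norm (averaged_multiplier 0 \<mu> f x t)))
      \<le> ennreal K * (\<integral>\<^sup>+x. ennreal (norm (f x) powr p) \<partial>lborel)"
      using averaged_multiplier_bound[where ?c1.0 = c1, OF assms(1) less_imp_le[OF r] C assms(3) e(1,2)
          zero_le_numeral e(3) N(1) N(2)[unfolded A_def]]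
      by blast
    show "\<exists>K\<ge>0. \<forall>N0 \<Sigma> \<mu>. admissible_family p c0 c1 C N N0 \<Sigma> \<longrightarrow> cantor_measure N \<Sigma> \<mu> \<longrightarrow>
             (\<forall>f. schwartz f \<longrightarrow>
               eLp_norm lborel p
                   (\<lambda>x. Lp_norm (restrict_space lborel {1..2}) r (\<lambda>t. average \<mu> f t x))
                 \<le> ennreal K * Lp_norm lborel p f)"
    proof (intro exI[of _ "K powr (1 / p)"] conjI allI impI)
      fix N0 \<Sigma> \<mu> f assume *: "admissible_family p c0 c1 C N N0 \<Sigma>" "cantor_measure N \<Sigma> \<mu>" "schwartz f"
      have mu: "real_distribution \<mu>" using *(2) by (auto simp: cantor_measure_def)
      show "eLp_norm lborel p (\<lambda>x. Lp_norm (restrict_space lborel {1..2}) r (\<lambda>t. average \<mu> f t x))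
          \<le> ennreal (K powr (1 / p)) * Lp_norm lborel p f"
        unfolding average_eq_averaged_multiplier[OF mu *(3)] Lp_norm_eq[of lborel p f]
        using p r enn_powr_root_le[OF p K(1) K(2)[OF *]] by (subst mixed_norm_eq) auto
    qed simp
  qed
next
  define A where "A = 2 powr (2 * p + 1) * C powr p * (1 + (4 * pi) powr p + (16 * pi) powr p)"
  have A: "0 \<le> A" by (simp add: A_def)
  have c: "0 < c0 powr (p / 2)" using assms by simp
  have p: "0 < p" using assms by simp
  have C: "0 \<le> C" using assms by simp
  fix \<gamma> :: real assume \<gamma>: "\<gamma> \<noteq> 1 / p"
  let ?concl = "\<lambda>N K. \<forall>N0 \<Sigma> \<mu>. admissible_family p c0 c1 C N N0 \<Sigma> \<longrightarrow> cantor_measure N \<Sigma> \<mu> \<longrightarrow>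
             \<gamma> < cantor_dim N N0 / 2 \<longrightarrow>
             (\<forall>f. schwartz f \<longrightarrow>
               Lp_norm (lborel \<Otimes>\<^sub>M restrict_space lborel {1..2}) p
                   (\<lambda>(x, t). inv_fourier
                      (\<lambda>\<xi>. of_real ((1 + \<bar>\<xi>\<bar>\<^sup>2) powr (\<gamma> / 2)) * fourier f \<xi> * fourier_measure \<mu> (t * \<xi>)) x)
                 \<le> ennreal K * Lp_norm lborel p f)"
  show "\<exists>Nmin. \<forall>N\<ge>Nmin. \<exists>K\<ge>0. ?concl N K"
  proof (cases "\<gamma> < 1 / p")
    case True
    then have gp: "\<gamma> * p < 1" using p by (simp add: less_divide_eq)
    have "1 / p \<le> 1" using assms(1) by simp
    then have g2: "\<gamma> \<le> 2" using True by linarith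
    \<comment> \<open>Again half of the gain 1 - \<open>\<gamma> * p\<close> is given away, but never so much that e reaches 1.\<close>
    define e where "e = min (1 / 2) ((1 - \<gamma> * p) / 2)"
    have e: "0 < e" "e < 1" "0 < p / p - e - \<gamma> * p" using p gp by (auto simp: e_def min_def field_simps)
    obtain Nmin where Nmin: "\<And>N. N \<ge> Nmin \<Longrightarrow> 2 \<le> N \<and> A \<le> c0 powr (p / 2) * real N powr e"
      using eventually_powr_dominates[OF A c e(1)] by blast
    show ?thesis
    proof (intro exI[of _ Nmin] allI impI)
      fix N assume "N \<ge> Nmin"
      from Nmin[OF this] have N: "2 \<le> N" "A \<le> c0 powr (p / 2) * real N powr e" by auto
      obtain K where K: "0 \<le> K" "\<And>N0 \<Sigma> \<mu> f. admissible_family p c0 c1 C N N0 \<Sigma> \<Longrightarrow> cantor_measure N \<Sigma> \<mu> \<Longrightarrow>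
        schwartz f \<Longrightarrow> mixed p p (\<lambda>x t. ennreal (norm (averaged_multiplier \<gamma> \<mu> f x t)))
        \<le> ennreal K * (\<integral>\<^sup>+x. ennreal (norm (f x) powr p) \<partial>lborel)"
        using averaged_multiplier_bound[where ?c1.0 = c1, OF assms(1) order_refl C assms(3) e(1,2)
            g2 e(3) N(1) N(2)[unfolded A_def]]
        by blast
      show "\<exists>K\<ge>0. ?concl N K"
      proof (intro exI[of _ "K powr (1 / p)"] conjI allI impI)
        fix N0 \<Sigma> \<mu> f assume *: "admissible_family p c0 c1 C N N0 \<Sigma>" "cantor_measure N \<Sigma> \<mu>" "schwartz f"
        have mu: "real_distribution \<mu>" using *(2) by (auto simp: cantor_measure_def)
        have [measurable]: "fourier f \<in> borel_measurable borel"
          using continuous_fourier[OF schwartz_facts(1)[OF *(3)]] by (rule borel_measurable_continuous_onI)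
        have m: "case_prod (averaged_multiplier \<gamma> \<mu> f) \<in> borel_measurable (borel \<Otimes>\<^sub>M borel)"
          using fourier_measure_measurable[OF mu] unfolding averaged_multiplier_def by measurable
        have eq: "inv_fourier (\<lambda>\<xi>. of_real ((1 + \<bar>\<xi>\<bar>\<^sup>2) powr (\<gamma> / 2)) * fourier f \<xi> * fourier_measure \<mu> (t * \<xi>)) x
            = averaged_multiplier \<gamma> \<mu> f x t" for x t
          unfolding inv_fourier_def averaged_multiplier_def bessel_weight_def by (simp add: cis_conv_exp)
        show "Lp_norm (lborel \<Otimes>\<^sub>M restrict_space lborel {1..2}) p
                   (\<lambda>(x, t). inv_fourier
                      (\<lambda>\<xi>. of_real ((1 + \<bar>\<xi>\<bar>\<^sup>2) powr (\<gamma> / 2)) * fourier f \<xi> * fourier_measure \<mu> (t * \<xi>)) x)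
                 \<le> ennreal (K powr (1 / p)) * Lp_norm lborel p f"
          unfolding eq space_time_norm_eq[OF p m] Lp_norm_eq[of lborel p f]
          by (rule enn_powr_root_le[OF p K(1) K(2)[OF *]])
      qed simp
    qed
  next
    case False
    with \<gamma> have "1 / p < \<gamma>" by simp
    \<comment> \<open>Since N0 is at most c1 N^(2/p), its logarithm to base N drops below \<open>2 * \<gamma>\<close>.\<close>
    then have s: "0 < 2 * \<gamma> - 2 / p" by simp
    obtain Nmin where Nmin: "\<And>N. N \<ge> Nmin \<Longrightarrow> 2 \<le> N \<and> c1 \<le> 1 * real N powr (2 * \<gamma> - 2 / p)"
      using eventually_powr_dominates[OF less_imp_le[OF assms(4)] zero_less_one s] by blast
    show ?thesis
    proof (intro exI[of _ Nmin] allI impI)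
      fix N assume "N \<ge> Nmin"
      from Nmin[OF this] have N: "2 \<le> N" "c1 \<le> real N powr (2 * \<gamma> - 2 / p)" by auto
      have "cantor_dim N N0 / 2 \<le> \<gamma>" if fam: "admissible_family p c0 c1 C N N0 \<Sigma>" for N0 \<Sigma>
      proof -
        have N0: "0 < N0" "real N0 \<le> c1 * real N powr (2 / p)"
          using admissible_family_card[OF fam] by auto
        note N0(2)
        also have "c1 * real N powr (2 / p) \<le> real N powr (2 * \<gamma> - 2 / p) * real N powr (2 / p)"
          using N by (intro mult_right_mono) auto
        also have "\<dots> = real N powr (2 * \<gamma>)" using N by (simp add: powr_add[symmetric])
        finally have "log (real N) (real N0) \<le> 2 * \<gamma>" using N N0 by (simp add: log_le_iff)
        then show ?thesis by (simp add: cantor_dim_def)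
      qed
      then show "\<exists>K\<ge>0. ?concl N K" by (intro exI[of _ 0]) (auto simp: not_less[symmetric])
    qed
  qed
qed

end
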